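(* Let $d\in\mathbb N$. If $f,g\in H^2_d$ are such that $f/g\in H^\infty(\mathbb B_d)$ and $f$ is cyclic in $H^2_d$, then $g$ is cyclic in $H^2_d$.
   Context: $\mathbb B_d$ is the open unit ball of $\mathbb C^d$; $H^\infty(\mathbb B_d)$ is the set of bounded analytic functions on $\mathbb B_d$. The Drury-Arveson space $H^2_d$ is the Hilbert space of analytic functions $f(z)=\sum_{\alpha\in\mathbb N_0^d}\hat f(\alpha)z^\alpha$ on $\mathbb B_d$ with $\|f\|^2_{H^2_d}=\sum_{\alpha\in\mathbb N_0^d}\frac{\alpha!}{|\alpha|!}|\hat f(\alpha)|^2<\infty$. $\mathrm{Mult}(H^2_d)=\{\varphi:\varphi f\in H^2_d\text{ for all }f\in H^2_d\}$. A function $f\in H^2_d$ is cyclic if $[f]$, the closure in $H^2_d$ of $\{\varphi f:\varphi\in\mathrm{Mult}(H^2_d)\}$, equals $H^2_d$. The notation $f/g\in H^\infty(\mathbb B_d)$ means that $g$ is not identically zero and $f=hg$ for some $h\in H^\infty(\mathbb B_d)$. *)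

theory Defs
  imports "HOL-Analysis.Analysis"
begin

text \<open>
  Functions on the ball are total functions on \<open>complex ^ 'd\<close>, of which only the values on the
  ball matter: every notion below is insensitive to the values elsewhere.
\<close>

abbreviation unit_ball :: "(complex ^ 'd) set" where
  "unit_ball \<equiv> ball 0 1"

text \<open>
  The derivative provided by the library is only real-linear here; complex-linearity is the
  additional condition on \<open>D\<close>.
\<close>

definition analytic_in_ball :: "(complex ^ 'd \<Rightarrow> complex) \<Rightarrow> bool" where
  "analytic_in_ball f \<longleftrightarrow>
     (\<forall>z\<in>unit_ball. \<exists>D. (f has_derivative D) (at z) \<and> (\<forall>c v. D (c *s v) = c * D v))"

definition H_infty :: "(complex ^ 'd \<Rightarrow> complex) set" where
  "H_infty = {h. analytic_in_ball h \<and> bounded (h ` unit_ball)}"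

definition monomial :: "('d::finite \<Rightarrow> nat) \<Rightarrow> complex ^ 'd \<Rightarrow> complex" where
  "monomial \<alpha> z = (\<Prod>i\<in>UNIV. (z $ i) ^ \<alpha> i)"

definition multi_fact :: "('d::finite \<Rightarrow> nat) \<Rightarrow> real" where
  "multi_fact \<alpha> = (\<Prod>i\<in>UNIV. fact (\<alpha> i))"

definition multi_size :: "('d::finite \<Rightarrow> nat) \<Rightarrow> nat" where
  "multi_size \<alpha> = (\<Sum>i\<in>UNIV. \<alpha> i)"

text \<open>
  The coefficients of the expansion of \<open>f\<close> about the origin; for \<open>f\<close> analytic in the ball the
  expansion exists, converges unconditionally on the whole ball, and is unique.
\<close>

definition power_coeff :: "(complex ^ 'd::finite \<Rightarrow> complex) \<Rightarrow> ('d \<Rightarrow> nat) \<Rightarrow> complex" where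
  "power_coeff f = (THE a. \<forall>z\<in>unit_ball. ((\<lambda>\<alpha>. a \<alpha> * monomial \<alpha> z) has_sum f z) UNIV)"

definition da_term :: "(complex ^ 'd::finite \<Rightarrow> complex) \<Rightarrow> ('d \<Rightarrow> nat) \<Rightarrow> real" where
  "da_term f \<alpha> = multi_fact \<alpha> / fact (multi_size \<alpha>) * (cmod (power_coeff f \<alpha>))\<^sup>2"

definition drury_arveson :: "(complex ^ 'd::finite \<Rightarrow> complex) set" where
  "drury_arveson = {f. analytic_in_ball f \<and> da_term f summable_on UNIV}"

definition da_norm :: "(complex ^ 'd::finite \<Rightarrow> complex) \<Rightarrow> real" where
  "da_norm f = sqrt (\<Sum>\<^sub>\<infinity>\<alpha>. da_term f \<alpha>)"

definition da_mult :: "(complex ^ 'd::finite \<Rightarrow> complex) set" where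
  "da_mult = {\<phi>. \<forall>f\<in>drury_arveson. (\<lambda>z. \<phi> z * f z) \<in> drury_arveson}"

definition da_closure :: "(complex ^ 'd::finite \<Rightarrow> complex) set \<Rightarrow> (complex ^ 'd \<Rightarrow> complex) set" where
  "da_closure S = {u \<in> drury_arveson. \<forall>\<epsilon>>0. \<exists>v\<in>S. da_norm (\<lambda>z. u z - v z) < \<epsilon>}"

definition da_cyclic :: "(complex ^ 'd::finite \<Rightarrow> complex) \<Rightarrow> bool" where
  "da_cyclic f \<longleftrightarrow> f \<in> drury_arveson \<and>
     da_closure {(\<lambda>z. \<phi> z * f z) | \<phi>. \<phi> \<in> da_mult} = drury_arveson"

definition quotient_in_H_infty ::
    "(complex ^ 'd \<Rightarrow> complex) \<Rightarrow> (complex ^ 'd \<Rightarrow> complex) \<Rightarrow> bool" where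
  "quotient_in_H_infty f g \<longleftrightarrow>
     (\<exists>z\<in>unit_ball. g z \<noteq> 0) \<and> (\<exists>h\<in>H_infty. \<forall>z\<in>unit_ball. f z = h z * g z)"

end

theory Submission
  imports Defs "HOL-Library.Function_Algebras" "HOL-Combinatorics.Multiset_Permutations"
    "HOL-Probability.Distributions" "HOL-Complex_Analysis.Complex_Analysis"
begin

text \<open>
  Suppose first that \<open>f\<close> and \<open>g\<close> are multipliers of the Drury-Arveson space \<open>H\<close> and \<open>f = h g\<close> with \<open>h\<close>
  bounded. Then \<open>h f\<^sup>d\<close> is a multiplier, where \<open>d\<close> is the number of variables
  (\<open>quotient_multiplier\<close>). To see this, let \<open>H\<^sub>j\<close> be the space whose norm weighs degree \<open>n\<close> with
  an additional factor \<open>(1 + n)\<^sup>-\<^sup>2\<^sup>j\<close>, so that \<open>1 + euler\<close>, with the radial derivative \<open>euler\<close>, maps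
  \<open>H\<^sub>j\<close> isometrically onto \<open>H\<^sub>j\<^sub>+\<^sub>1\<close>. Summation by parts shows that multipliers of \<open>H\<close> act on every
  \<open>H\<^sub>j\<close> (\<open>mult_bounded_Suc\<close>), and that bounded analytic functions act on \<open>H\<^sub>d\<close>, because its weights are
  those of the Hardy space of the ball times a decreasing function of the degree
  (\<open>H_infty_mult_bounded\<close>). From there one descends to \<open>H\<^sub>0 = H\<close>: differentiating \<open>h\<^sup>a f\<^sup>b\<^sup>+\<^sup>1\<close> produces
  only terms that are controlled in \<open>H\<^sub>j\<^sub>+\<^sub>1\<close> when the functions \<open>h\<^sup>a f\<^sup>b\<close> act there, since the
  denominator \<open>g\<close> in the derivative of \<open>h\<close> is compensated by one factor \<open>f\<close> (\<open>mult_bounded_step\<close>).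
  So each step costs one power of \<open>f\<close>. Now \<open>f\<^sup>d\<^sup>+\<^sup>1 = (h f\<^sup>d) g\<close> is a multiple of \<open>g\<close> by a multiplier, and
  it is cyclic as a power of a cyclic multiplier; hence \<open>g\<close> is cyclic.

  The general case reduces to this one because every function \<open>f\<close> in \<open>H\<close> has a denominator: a
  multiplier \<open>\<theta>\<close> such that \<open>\<theta> f\<close> is a multiplier, \<open>\<theta>(0) = 1\<close>, and multiplication by \<open>1 - \<theta>\<close> is a
  contraction (\<open>exists_denominator\<close>). It comes from lifting \<open>f\<close> to a unit vector \<open>F\<close> of square summable
  coefficients indexed by words in noncommuting letters and running a linear system there that
  conserves energy; the bound on the outputs of the system is the bound on the multipliers. Such a
  \<open>\<theta>\<close> is cyclic, even in the strong sense that multiplication by it preserves cyclicity, because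
  averages of sparse powers of \<open>1 - \<theta>\<close> tend to \<open>0\<close> strongly (\<open>denominator_approx\<close>).

  All of this takes place in the ring of formal power series. The link to functions is that analytic
  functions on the ball have unique power series expansions (\<open>analytic_in_ball_expands\<close>,
  \<open>expands_unique\<close>), and that convergent expansions are analytic (\<open>expands_imp_analytic\<close>).
\<close>

no_notation fps_nth (infixl "$" 75)

section \<open>Formal power series in several variables\<close>

text \<open>
  A type of its own, rather than plain coefficient functions, makes powers and the ring laws available
  for the Cauchy product.
\<close>

typedef 'd mpow = "UNIV :: (('d \<Rightarrow> nat) \<Rightarrow> complex) set" morphisms mcoeff Mpow
  by simp

lemma mcoeff_Mpow [simp]: "mcoeff (Mpow a) = a"
  by (simp add: Mpow_inverse)

lemma mpow_eqI: "(\<And>\<alpha>. mcoeff x \<alpha> = mcoeff y \<alpha>) \<Longrightarrow> x = y"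
  by (metis ext mcoeff_inject)

definition splits :: "('d \<Rightarrow> nat) \<Rightarrow> (('d \<Rightarrow> nat) \<times> ('d \<Rightarrow> nat)) set" where
  "splits \<alpha> = {(\<beta>, \<gamma>). \<beta> + \<gamma> = \<alpha>}"

lemma finite_bounded_fun: "finite {\<alpha> :: 'd::finite \<Rightarrow> nat. \<forall>i. \<alpha> i \<le> N i}"
proof -
  have "{\<alpha> :: 'd \<Rightarrow> nat. \<forall>i. \<alpha> i \<le> N i} = PiE UNIV (\<lambda>i. {..N i})"
    by (auto simp: PiE_def Pi_def)
  then show ?thesis by (simp add: finite_PiE)
qed

lemma finite_splits [simp]: "finite (splits (\<alpha> :: 'd::finite \<Rightarrow> nat))"
proof (rule finite_subset)
  show "splits \<alpha> \<subseteq> {\<beta>. \<forall>i. \<beta> i \<le> \<alpha> i} \<times> {\<beta>. \<forall>i. \<beta> i \<le> \<alpha> i}"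
    by (auto simp: splits_def)
qed (simp add: finite_bounded_fun)

lemma add_eq_0_fun [simp]: "\<beta> + \<gamma> = 0 \<longleftrightarrow> \<beta> = 0 \<and> \<gamma> = (0 :: 'd \<Rightarrow> nat)"
  by (auto simp: fun_eq_iff)

lemma splits_0 [simp]: "splits (0 :: 'd \<Rightarrow> nat) = {(0, 0)}"
  by (auto simp: splits_def)

instantiation mpow :: (finite) comm_ring_1
begin

definition zero_mpow_def: "0 = Mpow (\<lambda>_. 0)"
definition one_mpow_def: "1 = Mpow (\<lambda>\<alpha>. if \<alpha> = 0 then 1 else 0)"
definition plus_mpow_def: "x + y = Mpow (\<lambda>\<alpha>. mcoeff x \<alpha> + mcoeff y \<alpha>)"
definition minus_mpow_def: "x - y = Mpow (\<lambda>\<alpha>. mcoeff x \<alpha> - mcoeff y \<alpha>)"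
definition uminus_mpow_def: "- x = Mpow (\<lambda>\<alpha>. - mcoeff x \<alpha>)"
definition times_mpow_def:
  "x * y = Mpow (\<lambda>\<alpha>. \<Sum>(\<beta>, \<gamma>)\<in>splits \<alpha>. mcoeff x \<beta> * mcoeff y \<gamma>)"

instance
proof
  fix x y z :: "'a mpow"
  show "x * y * z = x * (y * z)"
  proof (rule mpow_eqI)
    fix \<alpha> :: "'a \<Rightarrow> nat"
    have "mcoeff (x * y * z) \<alpha> = (\<Sum>(p, q)\<in>Sigma (splits \<alpha>) (\<lambda>p. splits (fst p)).
        mcoeff x (fst q) * mcoeff y (snd q) * mcoeff z (snd p))"
      by (simp add: times_mpow_def sum.Sigma sum_distrib_right case_prod_unfold)
    also have "\<dots> = (\<Sum>(p, q)\<in>Sigma (splits \<alpha>) (\<lambda>p. splits (snd p)).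
        mcoeff x (fst p) * (mcoeff y (fst q) * mcoeff z (snd q)))"
      by (rule sum.reindex_bij_witness
          [where i = "\<lambda>(p, q). ((fst p + fst q, snd q), (fst p, fst q))"
             and j = "\<lambda>(p, q). ((fst q, snd q + snd p), (snd q, snd p))"])
         (auto simp: splits_def add.assoc)
    also have "\<dots> = mcoeff (x * (y * z)) \<alpha>"
      by (simp add: times_mpow_def sum.Sigma sum_distrib_left case_prod_unfold)
    finally show "mcoeff (x * y * z) \<alpha> = mcoeff (x * (y * z)) \<alpha>" .
  qed
  show "x * y = y * x"
  proof (rule mpow_eqI)
    fix \<alpha> :: "'a \<Rightarrow> nat"
    show "mcoeff (x * y) \<alpha> = mcoeff (y * x) \<alpha>"
      unfolding times_mpow_def mcoeff_Mpow
      by (rule sum.reindex_bij_witness[where i = prod.swap and j = prod.swap])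
         (auto simp: splits_def add.commute)
  qed
  show "1 * x = x"
  proof (rule mpow_eqI)
    fix \<alpha> :: "'a \<Rightarrow> nat"
    have "mcoeff (1 * x) \<alpha> = (\<Sum>p\<in>splits \<alpha>. if p = (0, \<alpha>) then mcoeff x \<alpha> else 0)"
      unfolding times_mpow_def one_mpow_def mcoeff_Mpow
      by (rule sum.cong) (auto simp: splits_def split: if_splits)
    also have "\<dots> = mcoeff x \<alpha>"
      by (subst sum.delta[OF finite_splits]) (auto simp: splits_def)
    finally show "mcoeff (1 * x) \<alpha> = mcoeff x \<alpha>" .
  qed
  show "x + y + z = x + (y + z)" "x + y = y + x" "0 + x = x" "- x + x = 0" "x - y = x + - y"
    by (simp_all add: plus_mpow_def zero_mpow_def uminus_mpow_def minus_mpow_def add_ac)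
      (simp_all add: mcoeff_inverse)
  show "(x + y) * z = x * z + y * z"
    by (simp add: plus_mpow_def times_mpow_def distrib_right sum.distrib case_prod_unfold)
  have "mcoeff (0 :: 'a mpow) 0 \<noteq> mcoeff 1 0"
    by (simp add: zero_mpow_def one_mpow_def)
  then show "(0 :: 'a mpow) \<noteq> 1"
    by metis
qed

end

lemma mcoeff_simps [simp]:
  fixes x y :: "'d::finite mpow"
  shows "mcoeff (0 :: 'd mpow) \<alpha> = 0"
    and "mcoeff (x + y) \<alpha> = mcoeff x \<alpha> + mcoeff y \<alpha>"
    and "mcoeff (x - y) \<alpha> = mcoeff x \<alpha> - mcoeff y \<alpha>"
    and "mcoeff (- x) \<alpha> = - mcoeff x \<alpha>"
  by (simp_all add: zero_mpow_def plus_mpow_def minus_mpow_def uminus_mpow_def)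

lemma mcoeff_1: "mcoeff (1 :: 'd::finite mpow) \<alpha> = (if \<alpha> = 0 then 1 else 0)"
  by (simp add: one_mpow_def)

lemma mcoeff_mult:
  "mcoeff (x * y :: 'd::finite mpow) \<alpha> = (\<Sum>(\<beta>, \<gamma>)\<in>splits \<alpha>. mcoeff x \<beta> * mcoeff y \<gamma>)"
  by (simp add: times_mpow_def)

definition mconst :: "complex \<Rightarrow> 'd::finite mpow" where
  "mconst c = Mpow (\<lambda>\<alpha>. if \<alpha> = 0 then c else 0)"

lemma mcoeff_mconst_mult [simp]: "mcoeff (mconst c * x :: 'd::finite mpow) \<alpha> = c * mcoeff x \<alpha>"
proof -
  have "mcoeff (mconst c * x) \<alpha> = (\<Sum>p\<in>splits \<alpha>. if p = (0, \<alpha>) then c * mcoeff x \<alpha> else 0)"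
    unfolding times_mpow_def mconst_def mcoeff_Mpow
    by (rule sum.cong) (auto simp: splits_def split: if_splits)
  also have "\<dots> = c * mcoeff x \<alpha>"
    by (subst sum.delta[OF finite_splits]) (auto simp: splits_def)
  finally show ?thesis .
qed

lemma of_nat_mpow: "(of_nat n :: 'd::finite mpow) = mconst (of_nat n)"
  by (induction n) (auto intro!: mpow_eqI simp: mconst_def mcoeff_1)

lemma multi_size_add [simp]: "multi_size (\<beta> + \<gamma> :: 'd::finite \<Rightarrow> nat) = multi_size \<beta> + multi_size \<gamma>"
  by (simp add: multi_size_def sum.distrib)

lemma multi_size_0 [simp]: "multi_size (0 :: 'd::finite \<Rightarrow> nat) = 0"
  by (simp add: multi_size_def)

lemma multi_size_eq_0_iff [simp]: "multi_size \<alpha> = 0 \<longleftrightarrow> \<alpha> = (0 :: 'd::finite \<Rightarrow> nat)"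
  by (auto simp: multi_size_def fun_eq_iff)

lemma component_le_multi_size: "\<alpha> i \<le> multi_size (\<alpha> :: 'd::finite \<Rightarrow> nat)"
  unfolding multi_size_def by (rule member_le_sum) auto

definition mball :: "nat \<Rightarrow> ('d::finite \<Rightarrow> nat) set" where
  "mball N = {\<alpha>. multi_size \<alpha> \<le> N}"

lemma finite_mball [simp]: "finite (mball N :: ('d::finite \<Rightarrow> nat) set)"
proof (rule finite_subset)
  show "mball N \<subseteq> {\<alpha> :: 'd \<Rightarrow> nat. \<forall>i. \<alpha> i \<le> N}"
    by (auto simp: mball_def intro: order_trans[OF component_le_multi_size])
qed (simp add: finite_bounded_fun)

lemma finite_subset_mball:
  assumes "finite (A :: ('d::finite \<Rightarrow> nat) set)"
  obtains N where "A \<subseteq> mball N"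
proof -
  have "A \<subseteq> mball (Max (multi_size ` A))"
    using assms by (auto simp: mball_def)
  then show thesis by (rule that)
qed

text \<open>
  The radial derivative \<open>\<Sum> z\<^sub>i \<partial>/\<partial>z\<^sub>i\<close>, which multiplies the part of degree \<open>n\<close> by \<open>n\<close>.
\<close>

definition euler :: "'d::finite mpow \<Rightarrow> 'd mpow" where
  "euler x = Mpow (\<lambda>\<alpha>. of_nat (multi_size \<alpha>) * mcoeff x \<alpha>)"

lemma mcoeff_euler [simp]: "mcoeff (euler x) \<alpha> = of_nat (multi_size \<alpha>) * mcoeff x \<alpha>"
  by (simp add: euler_def)

lemma euler_mult: "euler (x * y) = euler x * y + x * euler (y :: 'd::finite mpow)"
proof (rule mpow_eqI)
  fix \<alpha> :: "'d \<Rightarrow> nat"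
  have "mcoeff (euler (x * y)) \<alpha> = (\<Sum>(\<beta>, \<gamma>)\<in>splits \<alpha>.
      (of_nat (multi_size \<beta>) * mcoeff x \<beta>) * mcoeff y \<gamma> +
      mcoeff x \<beta> * (of_nat (multi_size \<gamma>) * mcoeff y \<gamma>))"
    unfolding mcoeff_euler mcoeff_mult sum_distrib_left
    by (rule sum.cong) (auto simp: splits_def algebra_simps)
  also have "\<dots> = mcoeff (euler x * y + x * euler y) \<alpha>"
    by (simp only: mcoeff_simps mcoeff_mult mcoeff_euler case_prod_unfold sum.distrib)
  finally show "mcoeff (euler (x * y)) \<alpha> = mcoeff (euler x * y + x * euler y) \<alpha>" .
qed

lemma euler_1 [simp]: "euler (1 :: 'd::finite mpow) = 0"
  by (rule mpow_eqI) (simp add: mcoeff_1)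

lemma euler_power: "euler (x ^ Suc n) = of_nat (Suc n) * (x ^ n * euler (x :: 'd::finite mpow))"
proof (induction n)
  case 0
  show ?case
    by (simp only: power_Suc power_0 mult_1_right of_nat_Suc of_nat_0 add_0_right mult_1)
next
  case (Suc n)
  have "euler (x ^ Suc (Suc n)) = euler x * x ^ Suc n + x * euler (x ^ Suc n)"
    by (simp only: power_Suc[of x "Suc n"] euler_mult)
  also have "\<dots> = euler x * x ^ Suc n + x * (of_nat (Suc n) * (x ^ n * euler x))"
    by (simp only: Suc)
  also have "\<dots> = of_nat (Suc (Suc n)) * (x ^ Suc n * euler x)"
    by (simp only: of_nat_Suc[of "Suc n"] power_Suc[of x n] distrib_right distrib_left mult_1 mult_1_right mult_ac)
  finally show ?case .
qed

section \<open>Fourier coefficients on products of roots of unity\<close>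

text \<open>
  The means below are taken over the points of a torus all of whose coordinates are \<open>M\<close>-th roots of
  unity up to scaling. They replace integrals over the torus: for polynomials of degree less than \<open>M\<close>
  the characters are exactly orthonormal, and series are reached by letting \<open>M\<close> grow.
\<close>

definition grid :: "nat \<Rightarrow> ('d::finite \<Rightarrow> nat) set" where
  "grid M = PiE UNIV (\<lambda>_. {..<M})"

definition character :: "nat \<Rightarrow> ('d::finite \<Rightarrow> nat) \<Rightarrow> ('d \<Rightarrow> nat) \<Rightarrow> complex" where
  "character M k \<alpha> = (\<Prod>i\<in>UNIV. cis (2 * pi * real (k i) * real (\<alpha> i) / real M))"

definition grid_mean :: "nat \<Rightarrow> (('d::finite \<Rightarrow> nat) \<Rightarrow> 'a::field) \<Rightarrow> 'a" where
  "grid_mean M G = (\<Sum>k\<in>grid M. G k) / of_nat (M ^ CARD('d))"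

lemma finite_grid [simp]: "finite (grid M :: ('d::finite \<Rightarrow> nat) set)"
  by (simp add: grid_def finite_PiE)

lemma card_grid: "card (grid M :: ('d::finite \<Rightarrow> nat) set) = M ^ CARD('d)"
  by (simp add: grid_def card_PiE)

lemma norm_character [simp]: "cmod (character M k \<alpha>) = 1"
  by (simp add: character_def prod_norm[symmetric])

lemma sum_cis_roots:
  assumes "M > 0"
  shows "(\<Sum>k<M. cis (2 * pi * real k * of_int n / real M)) = (if int M dvd n then of_nat M else 0)"
proof -
  define z where "z = cis (2 * pi * of_int n / real M)"
  have pw: "cis (2 * pi * real k * of_int n / real M) = z ^ k" for k
    by (simp add: z_def Complex.DeMoivre mult_ac)
  have zM: "z ^ M = 1"
    using assms cis_multiple_2pi[of "of_int n"] by (simp add: z_def Complex.DeMoivre)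
  show ?thesis
  proof (cases "z = 1")
    case True
    then have "cos (2 * pi * of_int n / real M) = 1"
      by (metis Re_complex_of_real cis.simps(1) of_real_1 z_def)
    then obtain m :: int where "2 * pi * of_int n / real M = of_int m * 2 * pi"
      using cos_one_2pi_int by blast
    then have "real_of_int n = of_int (m * int M)"
      using assms by (simp add: field_simps)
    then have "int M dvd n"
      by (metis dvd_triv_right of_int_eq_iff)
    then show ?thesis by (simp add: pw True)
  next
    case False
    have "\<not> int M dvd n"
    proof
      assume "int M dvd n"
      then obtain m where "n = int M * m" by blast
      then have "2 * pi * of_int n / real M = 2 * pi * of_int m"
        using assms by simp
      then have "z = cis (2 * pi * of_int m)"
        by (simp only: z_def)
      also have "\<dots> = 1" by (rule cis_multiple_2pi) simp
      finally show False using False by contradiction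
    qed
    moreover have "(\<Sum>k<M. z ^ k) = 0"
      using False zM by (simp add: geometric_sum)
    ultimately show ?thesis by (simp add: pw)
  qed
qed

lemma grid_mean_character:
  fixes \<alpha> \<beta> :: "'d::finite \<Rightarrow> nat"
  assumes "\<And>i. \<alpha> i < M" and "\<And>i. \<beta> i < M"
  shows "grid_mean M (\<lambda>k. character M k \<alpha> * cnj (character M k \<beta>)) = (if \<alpha> = \<beta> then 1 else 0)"
proof -
  have M: "M > 0" using assms(1)[of undefined] by simp
  define g where "g i m = cis (2 * pi * real m * of_int (int (\<alpha> i) - int (\<beta> i)) / real M)"
    for i m
  have "character M k \<alpha> * cnj (character M k \<beta>) = (\<Prod>i\<in>UNIV. g i (k i))" for k
    unfolding character_def g_def cnj_prod prod.distrib[symmetric] cis_cnj[symmetric]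
    by (rule prod.cong) (auto simp: cis_cnj cis_mult diff_divide_distrib right_diff_distrib)
  then have "(\<Sum>k\<in>grid M. character M k \<alpha> * cnj (character M k \<beta>)) =
      (\<Sum>k\<in>PiE UNIV (\<lambda>_. {..<M}). \<Prod>i\<in>UNIV. g i (k i))"
    by (simp add: grid_def)
  also have "\<dots> = (\<Prod>i\<in>UNIV. \<Sum>m<M. g i m)"
    by (rule prod_sum_PiE[symmetric]) auto
  also have "\<dots> = (\<Prod>i\<in>UNIV. if \<alpha> i = \<beta> i then of_nat M else 0)"
  proof (rule prod.cong[OF refl])
    fix i
    have "int M dvd int (\<alpha> i) - int (\<beta> i) \<longleftrightarrow> \<alpha> i = \<beta> i"
    proof
      assume "int M dvd int (\<alpha> i) - int (\<beta> i)"
      moreover have "\<bar>int (\<alpha> i) - int (\<beta> i)\<bar> < int M"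
        using assms(1)[of i] assms(2)[of i] by linarith
      ultimately show "\<alpha> i = \<beta> i"
        using dvd_imp_le_int[of "int (\<alpha> i) - int (\<beta> i)" "int M"] by linarith
    qed simp
    then show "(\<Sum>m<M. g i m) = (if \<alpha> i = \<beta> i then of_nat M else 0)"
      unfolding g_def using M by (subst sum_cis_roots) auto
  qed
  also have "\<dots> = (if \<alpha> = \<beta> then of_nat (M ^ CARD('d)) else 0)"
    by (auto simp: fun_eq_iff)
  finally show ?thesis using M by (simp add: grid_mean_def)
qed

lemma grid_mean_add: "grid_mean M (\<lambda>k. f k + g k) = grid_mean M f + grid_mean M g"
  by (simp add: grid_mean_def sum.distrib add_divide_distrib)

lemma grid_mean_diff: "grid_mean M (\<lambda>k. f k - g k) = grid_mean M f - grid_mean M g"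
  by (simp add: grid_mean_def sum_subtractf diff_divide_distrib)

lemma grid_mean_mult: "grid_mean M (\<lambda>k. c * f k) = c * grid_mean M f"
  by (simp add: grid_mean_def sum_distrib_left)

lemma grid_mean_sum: "grid_mean M (\<lambda>k. \<Sum>i\<in>A. f i k) = (\<Sum>i\<in>A. grid_mean M (f i))"
  by (simp add: grid_mean_def sum_divide_distrib[symmetric]) (subst sum.swap, simp)

lemma grid_mean_Re: "grid_mean M (\<lambda>k. Re (f k)) = Re (grid_mean M f)"
  by (simp add: grid_mean_def)

lemma grid_mean_of_real: "grid_mean M (\<lambda>k. complex_of_real (f k)) = of_real (grid_mean M f)"
  by (simp add: grid_mean_def)

lemma grid_mean_mono:
  fixes f g :: "('d::finite \<Rightarrow> nat) \<Rightarrow> real"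
  shows "(\<And>k. f k \<le> g k) \<Longrightarrow> grid_mean M f \<le> grid_mean M g"
  by (auto simp: grid_mean_def intro!: divide_right_mono sum_mono)

lemma norm_grid_mean_le:
  fixes f :: "('d::finite \<Rightarrow> nat) \<Rightarrow> complex"
  assumes "M > 0" and "\<And>k. cmod (f k) \<le> B"
  shows "cmod (grid_mean M f) \<le> B"
proof -
  have "cmod (\<Sum>k\<in>grid M. f k) \<le> of_nat (card (grid M :: ('d \<Rightarrow> nat) set)) * B"
    by (rule sum_norm_bound) (rule assms(2))
  then show ?thesis
    using assms(1) by (simp add: grid_mean_def norm_divide norm_power card_grid field_simps)
qed

lemma grid_parseval:
  fixes A :: "('d::finite \<Rightarrow> nat) set"
  assumes "finite A" and "\<And>\<alpha> i. \<alpha> \<in> A \<Longrightarrow> \<alpha> i < M"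
  shows "grid_mean M (\<lambda>k. (cmod (\<Sum>\<alpha>\<in>A. c \<alpha> * character M k \<alpha>))\<^sup>2) = (\<Sum>\<alpha>\<in>A. (cmod (c \<alpha>))\<^sup>2)"
proof -
  have "complex_of_real (grid_mean M (\<lambda>k. (cmod (\<Sum>\<alpha>\<in>A. c \<alpha> * character M k \<alpha>))\<^sup>2)) =
      grid_mean M (\<lambda>k. \<Sum>\<alpha>\<in>A. \<Sum>\<beta>\<in>A. (c \<alpha> * cnj (c \<beta>)) * (character M k \<alpha> * cnj (character M k \<beta>)))"
    unfolding grid_mean_of_real[symmetric] complex_norm_square cnj_sum sum_product
    by (simp add: mult_ac)
  also have "\<dots> = (\<Sum>\<alpha>\<in>A. \<Sum>\<beta>\<in>A. (c \<alpha> * cnj (c \<beta>)) * (if \<alpha> = \<beta> then 1 else 0))"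
    unfolding grid_mean_sum grid_mean_mult
    by (intro sum.cong refl) (subst grid_mean_character, auto simp: assms)
  also have "\<dots> = (\<Sum>\<alpha>\<in>A. c \<alpha> * cnj (c \<alpha>))"
    by (intro sum.cong refl) (simp add: if_distrib[of "(*) _"] sum.delta' assms(1) cong: if_cong)
  also have "\<dots> = complex_of_real (\<Sum>\<alpha>\<in>A. (cmod (c \<alpha>))\<^sup>2)"
    by (simp add: complex_norm_square[symmetric])
  finally show ?thesis by (simp only: of_real_eq_iff)
qed

lemma grid_bessel:
  fixes A :: "('d::finite \<Rightarrow> nat) set"
  assumes "finite A" and "\<And>\<alpha> i. \<alpha> \<in> A \<Longrightarrow> \<alpha> i < M"
  shows "(\<Sum>\<alpha>\<in>A. (cmod (grid_mean M (\<lambda>k. G k * cnj (character M k \<alpha>))))\<^sup>2)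
    \<le> grid_mean M (\<lambda>k. (cmod (G k))\<^sup>2)"
proof -
  define c where "c \<alpha> = grid_mean M (\<lambda>k. G k * cnj (character M k \<alpha>))" for \<alpha>
  define S where "S k = (\<Sum>\<alpha>\<in>A. c \<alpha> * character M k \<alpha>)" for k
  have SS: "grid_mean M (\<lambda>k. (cmod (S k))\<^sup>2) = (\<Sum>\<alpha>\<in>A. (cmod (c \<alpha>))\<^sup>2)"
    unfolding S_def by (rule grid_parseval) (use assms in auto)
  have "grid_mean M (\<lambda>k. G k * cnj (S k)) =
      grid_mean M (\<lambda>k. \<Sum>\<alpha>\<in>A. cnj (c \<alpha>) * (G k * cnj (character M k \<alpha>)))"
    by (simp add: S_def sum_distrib_left mult_ac)
  also have "\<dots> = (\<Sum>\<alpha>\<in>A. cnj (c \<alpha>) * c \<alpha>)"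
    by (simp only: grid_mean_sum grid_mean_mult c_def)
  also have "\<dots> = of_real (\<Sum>\<alpha>\<in>A. (cmod (c \<alpha>))\<^sup>2)"
    unfolding of_real_sum complex_norm_square by (simp only: mult.commute)
  finally have GS: "grid_mean M (\<lambda>k. Re (G k * cnj (S k))) = (\<Sum>\<alpha>\<in>A. (cmod (c \<alpha>))\<^sup>2)"
    by (simp only: grid_mean_Re Re_complex_of_real)
  have "0 = grid_mean M (\<lambda>k :: 'd \<Rightarrow> nat. 0 :: real)" by (simp add: grid_mean_def)
  also have "\<dots> \<le> grid_mean M (\<lambda>k. (cmod (G k - S k))\<^sup>2)"
    by (rule grid_mean_mono) simp
  also have "\<dots> = grid_mean M (\<lambda>k. (cmod (G k))\<^sup>2 - 2 * Re (G k * cnj (S k)) + (cmod (S k))\<^sup>2)"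
    by (rule arg_cong[where f = "grid_mean M"], rule ext, unfold cmod_power2)
       (simp add: power2_eq_square algebra_simps)
  also have "\<dots> = grid_mean M (\<lambda>k. (cmod (G k))\<^sup>2) - (\<Sum>\<alpha>\<in>A. (cmod (c \<alpha>))\<^sup>2)"
    by (simp only: grid_mean_add grid_mean_diff grid_mean_mult SS GS)
  finally show ?thesis by (simp add: c_def)
qed

text \<open>
  The mean picks out one coefficient exactly from a polynomial of small degree; the terms of high
  degree, which alias onto it, contribute at most the tail of an absolutely convergent series.
\<close>

lemma grid_mean_tendsto_coeff:
  fixes c :: "('d::finite \<Rightarrow> nat) \<Rightarrow> complex"
  assumes G: "\<And>M k. ((\<lambda>\<beta>. c \<beta> * character M k \<beta>) has_sum G M k) UNIV"
  shows "(\<lambda>M. grid_mean M (\<lambda>k. G M k * cnj (character M k \<alpha>))) \<longlonglongrightarrow> c \<alpha>"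
proof (rule LIMSEQ_I)
  fix e :: real assume e: "e > 0"
  have "character 1 (\<lambda>_. 0) \<beta> = 1" for \<beta> :: "'d \<Rightarrow> nat"
    by (simp add: character_def)
  then have "c summable_on UNIV"
    using G[of 1 "\<lambda>_. 0"] by (auto simp: summable_on_def)
  then have cs: "(\<lambda>\<beta>. cmod (c \<beta>)) summable_on UNIV"
    by (simp add: summable_on_iff_abs_summable_on_complex)
  define T where "T = infsum (\<lambda>\<beta>. cmod (c \<beta>)) UNIV"
  have "((\<lambda>\<beta>. cmod (c \<beta>)) has_sum T) UNIV"
    using cs by (simp add: T_def)
  then have "\<forall>\<^sub>F F in finite_subsets_at_top UNIV. dist (sum (\<lambda>\<beta>. cmod (c \<beta>)) F) T < e"
    using e by (auto simp: has_sum_def tendsto_iff)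
  then obtain X where X: "finite X"
    "\<And>Y. finite Y \<Longrightarrow> X \<subseteq> Y \<Longrightarrow> dist (sum (\<lambda>\<beta>. cmod (c \<beta>)) Y) T < e"
    unfolding eventually_finite_subsets_at_top by auto
  define A where "A = insert \<alpha> X"
  have A: "finite A" "\<alpha> \<in> A" "X \<subseteq> A"
    using X(1) by (auto simp: A_def)
  have TA: "T - sum (\<lambda>\<beta>. cmod (c \<beta>)) A < e"
    using X(2)[OF A(1,3)] unfolding dist_real_def by linarith
  obtain N where N: "A \<subseteq> mball N" using finite_subset_mball[OF A(1)] .
  have "cmod (grid_mean M (\<lambda>k. G M k * cnj (character M k \<alpha>)) - c \<alpha>) < e" if M: "M \<ge> Suc N" for M
  proof -
    have small: "\<beta> i < M" if "\<beta> \<in> A" for \<beta> i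
      using N that component_le_multi_size[of \<beta> i] M by (force simp: mball_def)
    define R where "R k = G M k - (\<Sum>\<beta>\<in>A. c \<beta> * character M k \<beta>)" for k
    have R: "cmod (R k) \<le> T - sum (\<lambda>\<beta>. cmod (c \<beta>)) A" for k
    proof -
      have "((\<lambda>\<beta>. c \<beta> * character M k \<beta>) has_sum R k) (UNIV - A)"
        unfolding R_def
        by (rule has_sum_Diff[OF G]) (use A in auto)
      moreover have "((\<lambda>\<beta>. cmod (c \<beta>)) has_sum (T - sum (\<lambda>\<beta>. cmod (c \<beta>)) A)) (UNIV - A)"
        by (rule has_sum_Diff) (use A cs T_def in auto)
      ultimately show ?thesis
        by (rule norm_infsum_le[of _ _ _ "\<lambda>\<beta>. cmod (c \<beta>)"]) (simp_all add: norm_mult)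
    qed
    have "G M k * cnj (character M k \<alpha>) =
        (\<Sum>\<beta>\<in>A. c \<beta> * (character M k \<beta> * cnj (character M k \<alpha>)))
          + R k * cnj (character M k \<alpha>)" for k
      unfolding R_def left_diff_distrib sum_distrib_right by (simp add: mult.assoc)
    then have "grid_mean M (\<lambda>k. G M k * cnj (character M k \<alpha>)) =
        grid_mean M (\<lambda>k. (\<Sum>\<beta>\<in>A. c \<beta> * (character M k \<beta> * cnj (character M k \<alpha>)))
          + R k * cnj (character M k \<alpha>))"
      by (simp only:)
    also have "\<dots> = (\<Sum>\<beta>\<in>A. c \<beta> * (if \<beta> = \<alpha> then 1 else 0))
        + grid_mean M (\<lambda>k. R k * cnj (character M k \<alpha>))"
      unfolding grid_mean_add grid_mean_sum grid_mean_mult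
      by (intro arg_cong2[where f = "(+)"] sum.cong refl)
        (subst grid_mean_character, auto simp: small A)
    also have "(\<Sum>\<beta>\<in>A. c \<beta> * (if \<beta> = \<alpha> then 1 else 0)) = c \<alpha>"
      using A by (simp add: if_distrib[of "(*) _"] sum.delta cong: if_cong)
    finally have "cmod (grid_mean M (\<lambda>k. G M k * cnj (character M k \<alpha>)) - c \<alpha>) =
        cmod (grid_mean M (\<lambda>k. R k * cnj (character M k \<alpha>)))"
      by simp
    also have "\<dots> \<le> T - sum (\<lambda>\<beta>. cmod (c \<beta>)) A"
      by (rule norm_grid_mean_le) (use M R in \<open>auto simp: norm_mult\<close>)
    finally show ?thesis using TA by simp
  qed
  then show "\<exists>no. \<forall>n\<ge>no. cmod (grid_mean n (\<lambda>k. G n k * cnj (character n k \<alpha>)) - c \<alpha>) < e"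
    by blast
qed

definition torus_point :: "('d::finite \<Rightarrow> real) \<Rightarrow> nat \<Rightarrow> ('d \<Rightarrow> nat) \<Rightarrow> complex ^ 'd" where
  "torus_point r M k = (\<chi> i. of_real (r i) * cis (2 * pi * real (k i) / real M))"

lemma monomial_torus_point:
  "monomial \<alpha> (torus_point r M k) = of_real (\<Prod>i\<in>UNIV. r i ^ \<alpha> i) * character M k \<alpha>"
  unfolding monomial_def torus_point_def character_def of_real_prod prod.distrib[symmetric]
  by (rule prod.cong) (simp_all add: power_mult_distrib Complex.DeMoivre mult_ac)

text \<open>
  The difference of the two series vanishes on the torus, hence so do all its means, and these
  converge to the scaled coefficients.
\<close>

lemma expansion_unique:
  fixes x y :: "'d::finite mpow"
  assumes r: "r > 0"
    and x: "\<And>z. (\<And>i. cmod (z $ i) = r) \<Longrightarrow> ((\<lambda>\<alpha>. mcoeff x \<alpha> * monomial \<alpha> z) has_sum f z) UNIV"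
    and y: "\<And>z. (\<And>i. cmod (z $ i) = r) \<Longrightarrow> ((\<lambda>\<alpha>. mcoeff y \<alpha> * monomial \<alpha> z) has_sum f z) UNIV"
  shows "x = y"
proof (rule mpow_eqI)
  fix \<alpha> :: "'d \<Rightarrow> nat"
  define c where "c \<beta> = (mcoeff x \<beta> - mcoeff y \<beta>) * of_real (\<Prod>i\<in>UNIV. r ^ \<beta> i)" for \<beta>
  have "((\<lambda>\<beta>. c \<beta> * character M k \<beta>) has_sum 0) UNIV" for M k
  proof -
    have *: "cmod (torus_point (\<lambda>_. r) M k $ i) = r" for i
      using r by (simp add: torus_point_def norm_mult)
    show ?thesis
      using has_sum_add[OF x[OF *] has_sum_cmult_right[OF y[OF *], of "-1"]]
      by (simp add: c_def monomial_torus_point algebra_simps)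
  qed
  from grid_mean_tendsto_coeff[OF this, of \<alpha>] have "(\<lambda>M. 0) \<longlonglongrightarrow> c \<alpha>"
    by (simp add: grid_mean_def)
  then have "c \<alpha> = 0"
    using LIMSEQ_unique tendsto_const by blast
  then show "mcoeff x \<alpha> = mcoeff y \<alpha>"
    using r by (simp add: c_def)
qed

section \<open>Power series expansions of analytic functions on the ball\<close>

definition polydisc :: "('d \<Rightarrow> real) \<Rightarrow> (complex ^ 'd) set" where
  "polydisc R = {z. \<forall>i. cmod (z $ i) < R i}"

definition set_coord :: "complex ^ 'd \<Rightarrow> 'd \<Rightarrow> complex \<Rightarrow> complex ^ 'd" where
  "set_coord z i w = (\<chi> j. if j = i then w else z $ j)"

lemma set_coord_simps [simp]:
  "set_coord z i w $ j = (if j = i then w else z $ j)"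
  "set_coord z i (z $ i) = z"
  by (simp_all add: set_coord_def vec_eq_iff)

lemma set_coord_commute:
  "i \<noteq> j \<Longrightarrow> set_coord (set_coord z j w) i x = set_coord (set_coord z i x) j w"
  by (simp add: vec_eq_iff)

lemma set_coord_in_polydisc:
  "z \<in> polydisc R \<Longrightarrow> w \<in> ball 0 (R i) \<Longrightarrow> set_coord z i w \<in> polydisc R"
  by (simp add: polydisc_def)

text \<open>
  Cauchy's inequality on circles of radius \<open>s < R\<close>, in the limit \<open>s \<longlongrightarrow> R\<close>, as nothing is assumed
  about \<open>f\<close> on the boundary.
\<close>

lemma taylor_coeff_bound:
  assumes hol: "f holomorphic_on ball 0 R" and R: "R > 0"
    and B: "\<And>w. w \<in> ball 0 R \<Longrightarrow> cmod (f w) \<le> B"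
  shows "cmod ((deriv ^^ n) f 0 / fact n) \<le> B / R ^ n"
proof -
  define c where "c = cmod ((deriv ^^ n) f 0 / fact n)"
  have less: "c * s ^ n \<le> B" if s: "0 < s" "s < R" for s
  proof -
    have "cmod ((deriv ^^ n) f 0) \<le> fact n * B / s ^ n"
    proof (rule Cauchy_inequality)
      show "f holomorphic_on ball 0 s"
        by (rule holomorphic_on_subset[OF hol]) (use s in auto)
      have "f holomorphic_on cball 0 s"
        by (rule holomorphic_on_subset[OF hol]) (use s in auto)
      then show "continuous_on (cball 0 s) f"
        by (rule holomorphic_on_imp_continuous_on)
    qed (use s B in auto)
    then show ?thesis
      using s by (simp add: c_def norm_divide field_simps)
  qed
  have "c * R ^ n \<le> B"
  proof (rule tendsto_upperbound)
    show "((\<lambda>s. c * s ^ n) \<longlongrightarrow> c * R ^ n) (at_left R)"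
      by (intro tendsto_intros)
    show "eventually (\<lambda>s. c * s ^ n \<le> B) (at_left R)"
      using less R by (intro eventually_at_leftI[of 0]) auto
  qed simp
  then show ?thesis using R by (simp add: c_def field_simps)
qed

text \<open>
  The Taylor coefficients in one variable depend holomorphically on a second one: each is the
  limit, uniform by the Cauchy bounds, of difference quotients built from the preceding ones.
\<close>

lemma taylor_coeff_holomorphic:
  fixes F :: "complex \<Rightarrow> complex \<Rightarrow> complex"
  assumes R: "R > 0" and U: "open U" and B0: "0 \<le> B"
    and hol1: "\<And>\<mu>. \<mu> \<in> U \<Longrightarrow> (\<lambda>w. F w \<mu>) holomorphic_on ball 0 R"
    and hol2: "\<And>w. w \<in> ball 0 R \<Longrightarrow> F w holomorphic_on U"
    and B: "\<And>w \<mu>. w \<in> ball 0 R \<Longrightarrow> \<mu> \<in> U \<Longrightarrow> cmod (F w \<mu>) \<le> B"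
  shows "(\<lambda>\<mu>. (deriv ^^ n) (\<lambda>w. F w \<mu>) 0 / fact n) holomorphic_on U"
proof (induction n rule: less_induct)
  case (less n)
  define c where "c n \<mu> = (deriv ^^ n) (\<lambda>w. F w \<mu>) 0 / fact n" for n \<mu>
  define t where "t m = 1 / (2 * (real m + 1))" for m :: nat
  define w where "w m = complex_of_real (R * t m)" for m
  define q where "q m \<mu> = (F (w m) \<mu> - (\<Sum>k<n. c k \<mu> * w m ^ k)) / w m ^ n" for m \<mu>
  have t: "0 < t m" "t m \<le> 1 / 2" for m
    by (auto simp: t_def field_simps)
  have w: "w m \<in> ball 0 R" "w m \<noteq> 0" "cmod (w m) = R * t m" for m
    using t[of m] R by (auto simp: w_def norm_mult intro: le_less_trans[of _ "R * (1/2)"])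
  have hol_q: "q m holomorphic_on U" for m
    unfolding q_def using less.IH w(2)[of m]
    by (intro holomorphic_intros hol2 w) (auto simp: c_def)
  have est: "cmod (q m \<mu> - c n \<mu>) \<le> 2 * B / R ^ n * t m" if \<mu>: "\<mu> \<in> U" for m \<mu>
  proof -
    have cb: "cmod (c k \<mu>) \<le> B / R ^ k" for k
      unfolding c_def by (rule taylor_coeff_bound[OF hol1[OF \<mu>] R]) (use B \<mu> in auto)
    have "(\<lambda>k. c k \<mu> * w m ^ k) sums F (w m) \<mu>"
      using holomorphic_power_series[OF hol1[OF \<mu>] w(1)[of m]] by (simp add: c_def)
    then have tail: "(\<lambda>k. c (k + Suc n) \<mu> * w m ^ (k + Suc n)) sums
        (F (w m) \<mu> - (\<Sum>k<Suc n. c k \<mu> * w m ^ k))"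
      by (rule sums_split_initial_segment)
    have geo: "(\<lambda>k. B * t m ^ Suc n * t m ^ k) sums (B * t m ^ Suc n * (1 / (1 - t m)))"
      using t[of m] by (intro sums_mult geometric_sums) auto
    have "cmod (F (w m) \<mu> - (\<Sum>k<Suc n. c k \<mu> * w m ^ k)) \<le> B * t m ^ Suc n * (1 / (1 - t m))"
      unfolding sums_unique[OF tail] sums_unique[OF geo]
    proof (rule norm_suminf_le)
      fix k
      have "cmod (c (k + Suc n) \<mu> * w m ^ (k + Suc n)) \<le>
          B / R ^ (k + Suc n) * (R * t m) ^ (k + Suc n)"
        unfolding norm_mult norm_power w(3)
        by (rule mult_right_mono[OF cb]) (use R t[of m] in auto)
      also have "\<dots> = B * t m ^ Suc n * t m ^ k"
        using R by (simp add: power_mult_distrib power_add)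
      finally show "cmod (c (k + Suc n) \<mu> * w m ^ (k + Suc n)) \<le> B * t m ^ Suc n * t m ^ k" .
    qed (use geo in \<open>auto simp: sums_iff\<close>)
    also have "\<dots> \<le> B * t m ^ Suc n * 2"
      using t[of m] B0 by (intro mult_left_mono) (auto simp: field_simps)
    finally have le: "cmod (F (w m) \<mu> - (\<Sum>k<Suc n. c k \<mu> * w m ^ k)) \<le> B * t m ^ Suc n * 2" .
    have "q m \<mu> - c n \<mu> = (F (w m) \<mu> - (\<Sum>k<Suc n. c k \<mu> * w m ^ k)) / w m ^ n"
      using w(2)[of m] by (simp add: q_def field_simps)
    then have "cmod (q m \<mu> - c n \<mu>) \<le> (B * t m ^ Suc n * 2) / (R * t m) ^ n"
      using le w(3)[of m] R t(1)[of m] by (simp add: norm_divide norm_power divide_right_mono)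
    also have "\<dots> = 2 * B / R ^ n * t m"
      using R t(1)[of m] by (simp add: power_mult_distrib field_simps)
    finally show ?thesis .
  qed
  have t0: "t \<longlonglongrightarrow> 0"
    unfolding t_def by real_asymp
  have "c n holomorphic_on U"
  proof (rule holomorphic_uniform_sequence[OF U hol_q])
    fix x assume "x \<in> U"
    then obtain d where d: "d > 0" "cball x d \<subseteq> U"
      using U open_contains_cball by blast
    have "uniform_limit (cball x d) q (c n) sequentially"
    proof (rule uniform_limitI)
      fix e :: real assume e: "e > 0"
      have "(\<lambda>m. 2 * B / R ^ n * t m) \<longlonglongrightarrow> 2 * B / R ^ n * 0"
        by (intro tendsto_intros t0)
      then have "eventually (\<lambda>m. 2 * B / R ^ n * t m < e) sequentially"
        using e by (intro order_tendstoD(2)) auto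
      then show "eventually (\<lambda>m. \<forall>\<mu>\<in>cball x d. dist (q m \<mu>) (c n \<mu>) < e) sequentially"
      proof eventually_elim
        case (elim m)
        then show ?case
          using est d(2) unfolding dist_norm by (meson le_less_trans subsetD)
      qed
    qed
    with d show "\<exists>d>0. cball x d \<subseteq> U \<and> uniform_limit (cball x d) q (c n) sequentially"
      by blast
  qed
  then show ?case by (simp add: c_def[abs_def])
qed

lemma prod_power_split:
  fixes g :: "'d::finite \<Rightarrow> 'a::comm_monoid_mult"
  shows "(\<Prod>k\<in>UNIV. g k ^ \<alpha> k) = g i ^ \<alpha> i * (\<Prod>k\<in>UNIV. g k ^ (\<alpha>(i := 0)) k)"
proof -
  have "(\<Prod>k\<in>UNIV. g k ^ (\<alpha>(i := 0)) k) = (\<Prod>k\<in>UNIV - {i}. g k ^ (\<alpha>(i := 0)) k)"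
    by (subst prod.remove[of _ i]) auto
  also have "\<dots> = (\<Prod>k\<in>UNIV - {i}. g k ^ \<alpha> k)"
    by (rule prod.cong) auto
  finally show ?thesis
    by (simp add: prod.remove[of UNIV i])
qed

lemma summable_multi_geometric:
  fixes s :: "'d::finite \<Rightarrow> real"
  assumes s: "\<And>i. 0 \<le> s i" "\<And>i. s i < 1"
  shows "(\<lambda>\<alpha>. \<Prod>i\<in>UNIV. s i ^ \<alpha> i) summable_on UNIV"
proof (rule nonneg_bdd_above_summable_on)
  show "bdd_above (sum (\<lambda>\<alpha>. \<Prod>i\<in>UNIV. s i ^ \<alpha> i) ` {F. F \<subseteq> UNIV \<and> finite F})"
  proof (rule bdd_aboveI2)
    fix F :: "('d \<Rightarrow> nat) set" assume "F \<in> {F. F \<subseteq> UNIV \<and> finite F}"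
    then obtain N where N: "F \<subseteq> mball N" using finite_subset_mball by auto
    have "(\<Sum>\<alpha>\<in>F. \<Prod>i\<in>UNIV. s i ^ \<alpha> i) \<le> (\<Sum>\<alpha>\<in>PiE UNIV (\<lambda>_. {..N}). \<Prod>i\<in>UNIV. s i ^ \<alpha> i)"
    proof (rule sum_mono2)
      show "F \<subseteq> PiE UNIV (\<lambda>_. {..N})"
        using N by (auto simp: mball_def intro: order_trans[OF component_le_multi_size])
    qed (auto intro!: finite_PiE prod_nonneg zero_le_power s)
    also have "\<dots> = (\<Prod>i\<in>UNIV. \<Sum>n\<le>N. s i ^ n)"
      by (rule prod_sum_PiE[symmetric]) auto
    also have "\<dots> \<le> (\<Prod>i\<in>UNIV. 1 / (1 - s i))"
    proof (rule prod_mono, safe)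
      fix i
      show "0 \<le> (\<Sum>n\<le>N. s i ^ n)" by (intro sum_nonneg) (simp add: s)
      have "(\<Sum>n\<le>N. s i ^ n) \<le> (\<Sum>n. s i ^ n)"
        using s by (intro sum_le_suminf summable_geometric) auto
      also have "\<dots> = 1 / (1 - s i)"
        using s by (intro suminf_geometric) auto
      finally show "(\<Sum>n\<le>N. s i ^ n) \<le> 1 / (1 - s i)" .
    qed
    finally show "(\<Sum>\<alpha>\<in>F. \<Prod>i\<in>UNIV. s i ^ \<alpha> i) \<le> (\<Prod>i\<in>UNIV. 1 / (1 - s i))" .
  qed
qed (intro prod_nonneg, simp add: s)

text \<open>
  Induction on the set \<open>S\<close> of variables on which \<open>f\<close> depends. Expanding in one variable gives Taylor
  coefficients that depend on the others only, are again separately holomorphic, and satisfy Cauchy's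
  bounds; by induction each of them has an expansion, and the bounds make the resulting double series
  converge absolutely.
\<close>

lemma expansion_polydisc_aux:
  fixes R :: "'d::finite \<Rightarrow> real"
  assumes R: "\<And>i. R i > 0" and S: "finite S"
  shows "\<And>f B. 0 \<le> B \<Longrightarrow> (\<And>z. z \<in> polydisc R \<Longrightarrow> cmod (f z) \<le> B) \<Longrightarrow>
    (\<And>i z. i \<in> S \<Longrightarrow> z \<in> polydisc R \<Longrightarrow> (\<lambda>w. f (set_coord z i w)) holomorphic_on ball 0 (R i)) \<Longrightarrow>
    (\<And>z z'. (\<forall>i\<in>S. z $ i = z' $ i) \<Longrightarrow> f z = f z') \<Longrightarrow>
    \<exists>a. (\<forall>\<alpha>. cmod (a \<alpha>) * (\<Prod>i\<in>UNIV. R i ^ \<alpha> i) \<le> B) \<and>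
        (\<forall>\<alpha>. (\<exists>i. i \<notin> S \<and> \<alpha> i \<noteq> 0) \<longrightarrow> a \<alpha> = 0) \<and>
        (\<forall>z\<in>polydisc R. ((\<lambda>\<alpha>. a \<alpha> * monomial \<alpha> z) has_sum f z) UNIV)"
  using S
proof (induction S)
  case empty
  define a where "a \<alpha> = (if \<alpha> = 0 then f 0 else 0)" for \<alpha> :: "'d \<Rightarrow> nat"
  have "cmod (a \<alpha>) * (\<Prod>i\<in>UNIV. R i ^ \<alpha> i) \<le> B" for \<alpha>
    using empty(1) empty(2)[of 0] R by (auto simp: a_def polydisc_def)
  moreover have "(\<exists>i. i \<notin> {} \<and> \<alpha> i \<noteq> 0) \<longrightarrow> a \<alpha> = 0" for \<alpha>
    by (auto simp: a_def)
  moreover have "((\<lambda>\<alpha>. a \<alpha> * monomial \<alpha> z) has_sum f z) UNIV" for z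
    by (rule has_sum_finite_neutralI[of "{0}"])
      (use empty(4)[of z 0] in \<open>auto simp: a_def monomial_def\<close>)
  ultimately show ?case by blast
next
  case (insert i S)
  define c where "c n z = (deriv ^^ n) (\<lambda>w. f (set_coord z i w)) 0 / fact n" for n z
  have "\<exists>a. (\<forall>\<alpha>. cmod (a \<alpha>) * (\<Prod>i\<in>UNIV. R i ^ \<alpha> i) \<le> B / R i ^ n) \<and>
        (\<forall>\<alpha>. (\<exists>i. i \<notin> S \<and> \<alpha> i \<noteq> 0) \<longrightarrow> a \<alpha> = 0) \<and>
        (\<forall>z\<in>polydisc R. ((\<lambda>\<alpha>. a \<alpha> * monomial \<alpha> z) has_sum c n z) UNIV)" for n
  proof (rule insert.IH)
    show "0 \<le> B / R i ^ n" using insert.prems(1) R[of i] by simp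
    show "cmod (c n z) \<le> B / R i ^ n" if z: "z \<in> polydisc R" for z
      unfolding c_def
      by (rule taylor_coeff_bound[OF insert.prems(3)[OF _ z] R])
        (use z in \<open>auto intro!: insert.prems(2) simp: set_coord_in_polydisc\<close>)
    show "(\<lambda>w. c n (set_coord z j w)) holomorphic_on ball 0 (R j)"
      if j: "j \<in> S" and z: "z \<in> polydisc R" for j z
    proof -
      have ij: "i \<noteq> j" using j insert.hyps by auto
      show ?thesis
        unfolding c_def
      proof (rule taylor_coeff_holomorphic[OF R _ insert.prems(1)])
        fix w :: complex assume w: "w \<in> ball 0 (R j)"
        show "(\<lambda>x. f (set_coord (set_coord z j w) i x)) holomorphic_on ball 0 (R i)"
          by (rule insert.prems(3)) (use z w in \<open>auto simp: set_coord_in_polydisc\<close>)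
      next
        fix x :: complex assume x: "x \<in> ball 0 (R i)"
        show "(\<lambda>w. f (set_coord (set_coord z j w) i x)) holomorphic_on ball 0 (R j)"
          unfolding set_coord_commute[OF ij]
          by (rule insert.prems(3)) (use z x j in \<open>auto simp: set_coord_in_polydisc\<close>)
      next
        fix x w :: complex assume "x \<in> ball 0 (R i)" "w \<in> ball 0 (R j)"
        then show "cmod (f (set_coord (set_coord z j w) i x)) \<le> B"
          using z by (intro insert.prems(2) set_coord_in_polydisc)
      qed simp
    qed
    show "c n z = c n z'" if "\<forall>j\<in>S. z $ j = z' $ j" for z z'
    proof -
      have "f (set_coord z i w) = f (set_coord z' i w)" for w
        by (rule insert.prems(4)) (use that in auto)
      then show ?thesis by (simp add: c_def)
    qed
  qed
  then have "\<exists>A. \<forall>n. (\<forall>\<alpha>. cmod (A n \<alpha>) * (\<Prod>i\<in>UNIV. R i ^ \<alpha> i) \<le> B / R i ^ n) \<and>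
        (\<forall>\<alpha>. (\<exists>i. i \<notin> S \<and> \<alpha> i \<noteq> 0) \<longrightarrow> A n \<alpha> = 0) \<and>
        (\<forall>z\<in>polydisc R. ((\<lambda>\<alpha>. A n \<alpha> * monomial \<alpha> z) has_sum c n z) UNIV)"
    by (intro choice allI)
  then obtain A where A:
    "\<And>n. (\<forall>\<alpha>. cmod (A n \<alpha>) * (\<Prod>i\<in>UNIV. R i ^ \<alpha> i) \<le> B / R i ^ n) \<and>
        (\<forall>\<alpha>. (\<exists>i. i \<notin> S \<and> \<alpha> i \<noteq> 0) \<longrightarrow> A n \<alpha> = 0) \<and>
        (\<forall>z\<in>polydisc R. ((\<lambda>\<alpha>. A n \<alpha> * monomial \<alpha> z) has_sum c n z) UNIV)"
    by blast
  have A1: "cmod (A n \<alpha>) * (\<Prod>i\<in>UNIV. R i ^ \<alpha> i) \<le> B / R i ^ n" for n \<alpha>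
    using A by blast
  have A2: "A n \<alpha> = 0" if "k \<notin> S" "\<alpha> k \<noteq> 0" for n \<alpha> k
    using A that by blast
  have A3: "((\<lambda>\<alpha>. A n \<alpha> * monomial \<alpha> z) has_sum c n z) UNIV" if "z \<in> polydisc R" for n z
    using A that by blast
  define a where "a \<alpha> = A (\<alpha> i) (\<alpha>(i := 0))" for \<alpha>
  have bnd: "cmod (a \<alpha>) * (\<Prod>k\<in>UNIV. R k ^ \<alpha> k) \<le> B" for \<alpha>
  proof -
    have "cmod (a \<alpha>) * (\<Prod>k\<in>UNIV. R k ^ \<alpha> k) =
        R i ^ \<alpha> i * (cmod (A (\<alpha> i) (\<alpha>(i := 0))) * (\<Prod>k\<in>UNIV. R k ^ (\<alpha>(i := 0)) k))"
      unfolding a_def prod_power_split[of R \<alpha> i] by (simp only: mult_ac)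
    also have "\<dots> \<le> R i ^ \<alpha> i * (B / R i ^ \<alpha> i)"
      by (rule mult_left_mono[OF A1]) (use R[of i] in auto)
    also have "\<dots> = B" using R[of i] by simp
    finally show ?thesis .
  qed
  moreover have "a \<alpha> = 0" if "k \<notin> insert i S" "\<alpha> k \<noteq> 0" for \<alpha> k
    unfolding a_def by (rule A2[of k]) (use that in auto)
  moreover have "((\<lambda>\<alpha>. a \<alpha> * monomial \<alpha> z) has_sum f z) UNIV" if z: "z \<in> polydisc R" for z
  proof -
    have zR: "cmod (z $ k) < R k" for k using z by (simp add: polydisc_def)
    have "(\<lambda>\<alpha>. B * (\<Prod>k\<in>UNIV. (cmod (z $ k) / R k) ^ \<alpha> k)) summable_on UNIV"
      by (intro summable_on_cmult_right summable_multi_geometric)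
        (use zR R in \<open>auto simp: less_imp_le\<close>)
    moreover have "cmod (a \<alpha> * monomial \<alpha> z) \<le> B * (\<Prod>k\<in>UNIV. (cmod (z $ k) / R k) ^ \<alpha> k)" for \<alpha>
    proof -
      have P: "(\<Prod>k\<in>UNIV. R k ^ \<alpha> k) > 0" by (intro prod_pos) (simp add: R)
      have "cmod (a \<alpha> * monomial \<alpha> z) = (cmod (a \<alpha>) * (\<Prod>k\<in>UNIV. R k ^ \<alpha> k)) *
          (\<Prod>k\<in>UNIV. (cmod (z $ k) / R k) ^ \<alpha> k)"
        using P less_imp_neq[OF R] by (simp add: monomial_def norm_mult prod_norm[symmetric] norm_power
            power_divide prod_dividef)
      also have "\<dots> \<le> B * (\<Prod>k\<in>UNIV. (cmod (z $ k) / R k) ^ \<alpha> k)"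
        by (rule mult_right_mono[OF bnd]) (use R in \<open>auto intro!: prod_nonneg simp: less_imp_le\<close>)
      finally show ?thesis .
    qed
    ultimately have "(\<lambda>\<alpha>. cmod (a \<alpha> * monomial \<alpha> z)) summable_on UNIV"
      by (rule Infinite_Sum.abs_summable_on_comparison_test')
    then have "(\<lambda>\<alpha>. a \<alpha> * monomial \<alpha> z) summable_on UNIV"
      by (rule Infinite_Sum.abs_summable_summable)
    then obtain T where T: "((\<lambda>\<alpha>. a \<alpha> * monomial \<alpha> z) has_sum T) UNIV"
      by (auto simp: summable_on_def)
    have mono: "monomial \<alpha> z = z $ i ^ \<alpha> i * monomial (\<alpha>(i := 0)) z" for \<alpha>
      unfolding monomial_def by (rule prod_power_split)
    have "((\<lambda>(n, \<beta>). A n \<beta> * monomial \<beta> z * z $ i ^ n) has_sum T) (SIGMA n:UNIV. {\<beta>. \<beta> i = 0})"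
      (is "(?h has_sum T) ?T")
    proof -
      have "?h (\<alpha> i, \<alpha>(i := 0)) = a \<alpha> * monomial \<alpha> z" for \<alpha>
        by (simp add: a_def mono[of \<alpha>])
      then have "((\<lambda>\<alpha>. a \<alpha> * monomial \<alpha> z) has_sum T) UNIV = (?h has_sum T) ?T"
        by (intro has_sum_reindex_bij_witness[where i = "\<lambda>(n, \<beta>). \<beta>(i := n)"
            and j = "\<lambda>\<alpha>. (\<alpha> i, \<alpha>(i := 0))"]) auto
      then show ?thesis using T by blast
    qed
    then have "((\<lambda>n. c n z * z $ i ^ n) has_sum T) UNIV"
    proof (rule has_sum_SigmaD)
      fix n
      have "((\<lambda>\<beta>. A n \<beta> * monomial \<beta> z) has_sum c n z) {\<beta>. \<beta> i = 0}"
        using A3[OF z, of n]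
        by (subst has_sum_cong_neutral[where T = UNIV and g = "\<lambda>\<beta>. A n \<beta> * monomial \<beta> z"])
          (use A2[of i] insert.hyps in auto)
      then show "((\<lambda>\<beta>. (case (n, \<beta>) of (n, \<beta>) \<Rightarrow> A n \<beta> * monomial \<beta> z * z $ i ^ n))
          has_sum c n z * z $ i ^ n) {\<beta>. \<beta> i = 0}"
        by (simp add: has_sum_cmult_left)
    qed
    then have "(\<lambda>n. c n z * z $ i ^ n) sums T"
      by (rule has_sum_imp_sums)
    moreover have "(\<lambda>n. c n z * z $ i ^ n) sums f z"
      using holomorphic_power_series[OF insert.prems(3)[of i z], of "z $ i"] z zR
      by (simp add: c_def)
    ultimately show ?thesis
      using T sums_unique2 by blast
  qed
  ultimately show ?case by blast
qed

definition expands :: "'d::finite mpow \<Rightarrow> (complex ^ 'd \<Rightarrow> complex) \<Rightarrow> bool" where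
  "expands x f \<longleftrightarrow> (\<forall>z\<in>unit_ball. ((\<lambda>\<alpha>. mcoeff x \<alpha> * monomial \<alpha> z) has_sum f z) UNIV)"

lemma norm_complex_vec: "norm (z :: complex ^ 'd::finite) = sqrt (\<Sum>i\<in>UNIV. (cmod (z $ i))\<^sup>2)"
  by (simp add: norm_vec_def L2_set_def)

lemma bounded_linear_scale_vec: "bounded_linear (\<lambda>w :: complex. w *s (v :: complex ^ 'd::finite))"
proof -
  have "linear (\<lambda>w :: complex. w *s v)"
  proof (rule linearI)
    show "(a + b) *s v = a *s v + b *s v" for a b by (rule vector_sadd_rdistrib)
    show "(r *\<^sub>R a) *s v = r *\<^sub>R (a *s v)" for r a by (simp add: vec_eq_iff)
  qed
  then show ?thesis by (simp only: linear_linear)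
qed

lemma has_field_derivative_on_line:
  fixes v :: "complex ^ 'd::finite"
  assumes D: "(f has_derivative D) (at (x + w *s v))" and lin: "\<And>c. D (c *s v) = c * D v"
  shows "((\<lambda>w. f (x + w *s v)) has_field_derivative D v) (at w)"
proof -
  have "((\<lambda>w. x + w *s v) has_derivative (\<lambda>h. 0 + h *s v)) (at w)"
    by (intro has_derivative_add has_derivative_const
        bounded_linear.has_derivative[OF bounded_linear_scale_vec] has_derivative_ident)
  from has_derivative_compose[OF this D] show ?thesis
    unfolding has_field_derivative_def by (simp add: lin mult_commute_abs)
qed

lemma analytic_in_ball_coord:
  fixes f :: "complex ^ 'd::finite \<Rightarrow> complex"
  assumes f: "analytic_in_ball f" and U: "open U"
    and z: "\<And>w. w \<in> U \<Longrightarrow> set_coord z i w \<in> unit_ball"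
  shows "(\<lambda>w. f (set_coord z i w)) holomorphic_on U"
  unfolding holomorphic_on_open[OF U]
proof (intro ballI)
  fix w assume w: "w \<in> U"
  have eq: "set_coord z i w = set_coord z i 0 + w *s axis i 1" for w
    by (auto simp: vec_eq_iff axis_def)
  obtain D where D: "(f has_derivative D) (at (set_coord z i w))"
    and lin: "\<And>c v. D (c *s v) = c * D v"
    using f z[OF w] unfolding analytic_in_ball_def by blast
  have "((\<lambda>w. f (set_coord z i 0 + w *s axis i 1)) has_field_derivative D (axis i 1)) (at w)"
    by (rule has_field_derivative_on_line) (use D lin eq[of w] in simp_all)
  then have "((\<lambda>w. f (set_coord z i w)) has_field_derivative D (axis i 1)) (at w)"
    by (simp only: eq[symmetric])
  then show "\<exists>f'. ((\<lambda>w. f (set_coord z i w)) has_field_derivative f') (at w)"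
    by blast
qed

lemma analytic_in_ball_continuous_on:
  "analytic_in_ball f \<Longrightarrow> continuous_on unit_ball f"
  unfolding analytic_in_ball_def
  by (intro continuous_at_imp_continuous_on ballI) (blast intro: has_derivative_continuous)

lemma ball_enlarge:
  fixes z :: "complex ^ 'd::finite"
  assumes "z \<in> unit_ball"
  obtains \<rho> where "\<rho> > 0" "(\<Sum>i\<in>UNIV. (cmod (z $ i) + \<rho>)\<^sup>2) < 1"
proof -
  have "((\<lambda>\<rho>. \<Sum>i\<in>UNIV. (cmod (z $ i) + \<rho>)\<^sup>2) \<longlongrightarrow> (\<Sum>i\<in>UNIV. (cmod (z $ i) + 0)\<^sup>2)) (at_right 0)"
    by (intro tendsto_intros)
  moreover have "(\<Sum>i\<in>UNIV. (cmod (z $ i) + 0)\<^sup>2) < 1"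
    using assms by (simp add: norm_complex_vec real_sqrt_lt_1_iff)
  ultimately have "eventually (\<lambda>\<rho>. (\<Sum>i\<in>UNIV. (cmod (z $ i) + \<rho>)\<^sup>2) < 1) (at_right 0)"
    by (rule order_tendstoD(2))
  then have "eventually (\<lambda>\<rho>. \<rho> > 0 \<and> (\<Sum>i\<in>UNIV. (cmod (z $ i) + \<rho>)\<^sup>2) < 1) (at_right 0)"
    using eventually_at_right_less by (rule eventually_conj[rotated])
  then obtain \<rho> where "\<rho> > 0" "(\<Sum>i\<in>UNIV. (cmod (z $ i) + \<rho>)\<^sup>2) < 1"
    using eventually_happens'[OF trivial_limit_at_right_real] by blast
  then show thesis by (rule that)
qed

lemma torus_in_ball:
  obtains \<rho> :: real where "\<rho> > 0" "(\<Sum>i\<in>(UNIV :: 'd::finite set). \<rho>\<^sup>2) < 1"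
proof -
  have "(0 :: complex ^ 'd) \<in> unit_ball" by simp
  then obtain \<rho> where "\<rho> > 0" "(\<Sum>i\<in>UNIV. (cmod ((0 :: complex ^ 'd) $ i) + \<rho>)\<^sup>2) < 1"
    by (rule ball_enlarge)
  then show thesis
    by (intro that[of \<rho>]) (simp_all only: zero_index norm_zero add_0)
qed

lemma norm_less_1_if_components:
  fixes z :: "complex ^ 'd::finite"
  assumes "\<And>i. cmod (z $ i) \<le> R i" and "(\<Sum>i\<in>UNIV. (R i)\<^sup>2) < 1"
  shows "norm z \<le> sqrt (\<Sum>i\<in>UNIV. (R i)\<^sup>2)" "z \<in> unit_ball"
proof -
  show le: "norm z \<le> sqrt (\<Sum>i\<in>UNIV. (R i)\<^sup>2)"
    unfolding norm_complex_vec
    by (intro real_sqrt_le_mono sum_mono power_mono assms) simp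
  show "z \<in> unit_ball"
    using le_less_trans[OF le] assms(2) by (simp add: real_sqrt_lt_1_iff)
qed

lemma expansion_polydisc:
  fixes f :: "complex ^ 'd::finite \<Rightarrow> complex"
  assumes f: "analytic_in_ball f" and R: "\<And>i. R i > 0" "(\<Sum>i\<in>UNIV. (R i)\<^sup>2) < 1"
  obtains x where "\<And>z. z \<in> polydisc R \<Longrightarrow> ((\<lambda>\<alpha>. mcoeff x \<alpha> * monomial \<alpha> z) has_sum f z) UNIV"
proof -
  define \<rho> where "\<rho> = sqrt (\<Sum>i\<in>UNIV. (R i)\<^sup>2)"
  have \<rho>: "\<rho> < 1" using R(2) by (simp add: \<rho>_def real_sqrt_lt_1_iff)
  have sub: "polydisc R \<subseteq> cball 0 \<rho>" "polydisc R \<subseteq> unit_ball"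
    using norm_less_1_if_components[OF _ R(2)] by (auto simp: polydisc_def \<rho>_def less_imp_le)
  have "continuous_on (cball 0 \<rho>) f"
    by (rule continuous_on_subset[OF analytic_in_ball_continuous_on[OF f]]) (use \<rho> in auto)
  then have "bounded (f ` cball 0 \<rho>)"
    by (intro compact_imp_bounded compact_continuous_image) auto
  then obtain B where B: "0 < B" "\<And>z. z \<in> cball 0 \<rho> \<Longrightarrow> cmod (f z) \<le> B"
    unfolding bounded_pos by auto
  have "\<exists>a. (\<forall>\<alpha>. cmod (a \<alpha>) * (\<Prod>i\<in>UNIV. R i ^ \<alpha> i) \<le> B) \<and>
        (\<forall>\<alpha>. (\<exists>i. i \<notin> UNIV \<and> \<alpha> i \<noteq> 0) \<longrightarrow> a \<alpha> = 0) \<and>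
        (\<forall>z\<in>polydisc R. ((\<lambda>\<alpha>. a \<alpha> * monomial \<alpha> z) has_sum f z) UNIV)"
  proof (rule expansion_polydisc_aux[OF R(1)])
    show "(\<lambda>w. f (set_coord z i w)) holomorphic_on ball 0 (R i)" if "z \<in> polydisc R" for z i
      by (rule analytic_in_ball_coord[OF f open_ball subsetD[OF sub(2)]])
        (rule set_coord_in_polydisc[OF that])
    show "f z = f z'" if "\<forall>i\<in>UNIV. z $ i = z' $ i" for z z'
      using that by (metis UNIV_I vec_eq_iff)
  qed (use B sub in auto)
  then obtain a where "\<And>z. z \<in> polydisc R \<Longrightarrow> ((\<lambda>\<alpha>. a \<alpha> * monomial \<alpha> z) has_sum f z) UNIV"
    by blast
  then show thesis by (intro that[of "Mpow a"]) simp
qed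

text \<open>
  The ball is a union of polydiscs, and the expansions on any two of them coincide because both
  represent \<open>f\<close> on a small torus that the polydiscs share.
\<close>

theorem analytic_in_ball_expands:
  fixes f :: "complex ^ 'd::finite \<Rightarrow> complex"
  assumes f: "analytic_in_ball f"
  obtains x where "expands x f"
proof -
  obtain \<rho>0 :: real where \<rho>0: "\<rho>0 > 0" "(\<Sum>i\<in>(UNIV :: 'd set). \<rho>0\<^sup>2) < 1"
    by (rule torus_in_ball)
  obtain x where x: "\<And>z. z \<in> polydisc (\<lambda>_. \<rho>0) \<Longrightarrow> ((\<lambda>\<alpha>. mcoeff x \<alpha> * monomial \<alpha> z) has_sum f z) UNIV"
    using expansion_polydisc[OF f \<rho>0] by blast
  have "((\<lambda>\<alpha>. mcoeff x \<alpha> * monomial \<alpha> z) has_sum f z) UNIV" if z: "z \<in> unit_ball" for z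
  proof -
    obtain \<rho> where \<rho>: "\<rho> > 0" "(\<Sum>i\<in>UNIV. (cmod (z $ i) + \<rho>)\<^sup>2) < 1"
      using ball_enlarge[OF z] .
    have pos: "cmod (z $ i) + \<rho> > 0" for i using \<rho>(1) by (simp add: add_nonneg_pos)
    obtain y where y: "\<And>z'. z' \<in> polydisc (\<lambda>i. cmod (z $ i) + \<rho>) \<Longrightarrow>
        ((\<lambda>\<alpha>. mcoeff y \<alpha> * monomial \<alpha> z') has_sum f z') UNIV"
      using expansion_polydisc[OF f pos \<rho>(2)] by blast
    define r where "r = min \<rho> \<rho>0 / 2"
    have r: "0 < r" "r < \<rho>0" "r < \<rho>" using \<rho> \<rho>0 by (auto simp: r_def)
    have "x = y"
    proof (rule expansion_unique[OF r(1)])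
      fix w :: "complex ^ 'd" assume w: "\<And>i. cmod (w $ i) = r"
      show "((\<lambda>\<alpha>. mcoeff x \<alpha> * monomial \<alpha> w) has_sum f w) UNIV"
        by (rule x) (simp add: polydisc_def w r)
      have "r < cmod (z $ i) + \<rho>" for i
        using r(3) norm_ge_zero[of "z $ i"] by linarith
      then show "((\<lambda>\<alpha>. mcoeff y \<alpha> * monomial \<alpha> w) has_sum f w) UNIV"
        by (intro y) (simp add: polydisc_def w)
    qed
    moreover have "z \<in> polydisc (\<lambda>i. cmod (z $ i) + \<rho>)"
      using \<rho> by (simp add: polydisc_def)
    ultimately show ?thesis using y by blast
  qed
  then show thesis by (intro that[of x]) (simp add: expands_def)
qed

lemma expands_unique:
  fixes x y :: "'d::finite mpow"
  assumes "expands x f" "expands y g" "\<And>z. z \<in> unit_ball \<Longrightarrow> f z = g z"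
  shows "x = y"
proof -
  obtain \<rho> :: real where \<rho>: "\<rho> > 0" "(\<Sum>i\<in>(UNIV :: 'd set). \<rho>\<^sup>2) < 1"
    by (rule torus_in_ball)
  have ball: "z \<in> unit_ball" if "\<And>i. cmod (z $ i) = \<rho>" for z :: "complex ^ 'd"
    by (rule norm_less_1_if_components(2)[of z "\<lambda>_. \<rho>"]) (use \<rho> that in simp_all)
  show ?thesis
  proof (rule expansion_unique[OF \<rho>(1)])
    fix z :: "complex ^ 'd" assume "\<And>i. cmod (z $ i) = \<rho>"
    then have z: "z \<in> unit_ball" by (rule ball)
    show "((\<lambda>\<alpha>. mcoeff x \<alpha> * monomial \<alpha> z) has_sum f z) UNIV"
      using assms(1) z by (simp only: expands_def)
    show "((\<lambda>\<alpha>. mcoeff y \<alpha> * monomial \<alpha> z) has_sum f z) UNIV"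
      using assms(2) z unfolding assms(3)[OF z] by (simp only: expands_def)
  qed
qed

lemma power_coeff_eq: "expands x f \<Longrightarrow> power_coeff f = mcoeff x"
  unfolding power_coeff_def
proof (rule the_equality)
  assume x: "expands x f"
  then show "\<forall>z\<in>unit_ball. ((\<lambda>\<alpha>. mcoeff x \<alpha> * monomial \<alpha> z) has_sum f z) UNIV"
    by (simp add: expands_def)
  fix a assume "\<forall>z\<in>unit_ball. ((\<lambda>\<alpha>. a \<alpha> * monomial \<alpha> z) has_sum f z) UNIV"
  then have "expands (Mpow a) f" by (simp add: expands_def)
  from expands_unique[OF this x refl] show "a = mcoeff x" by auto
qed

section \<open>Operations on expansions\<close>

lemma has_sum_mult_complex:
  fixes f :: "'a \<Rightarrow> complex" and g :: "'b \<Rightarrow> complex"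
  assumes f: "(f has_sum S) A" and g: "(g has_sum T) B"
  shows "((\<lambda>(x, y). f x * g y) has_sum S * T) (A \<times> B)"
proof -
  have nf: "(\<lambda>x. cmod (f x)) summable_on A" and ng: "(\<lambda>y. cmod (g y)) summable_on B"
    using f g by (auto simp: summable_on_iff_abs_summable_on_complex[symmetric] summable_on_def)
  obtain T' where T': "((\<lambda>y. cmod (g y)) has_sum T') B" using ng by (auto simp: summable_on_def)
  have "(\<lambda>p. cmod (f (fst p) * g (snd p))) summable_on A \<times> B"
  proof (rule summable_on_SigmaI)
    show "((\<lambda>y. cmod (f (fst (x, y)) * g (snd (x, y)))) has_sum cmod (f x) * T') B" for x
      using has_sum_cmult_right[OF T', of "cmod (f x)"] by (simp add: norm_mult)
    show "(\<lambda>x. cmod (f x) * T') summable_on A"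
      by (rule summable_on_cmult_left[OF nf])
  qed simp
  then have "(\<lambda>(x, y). f x * g y) summable_on A \<times> B"
    by (simp add: summable_on_iff_abs_summable_on_complex case_prod_unfold)
  then obtain U where U: "((\<lambda>(x, y). f x * g y) has_sum U) (A \<times> B)"
    by (auto simp: summable_on_def)
  have "((\<lambda>x. f x * T) has_sum U) A"
    using U by (rule has_sum_SigmaD) (simp add: has_sum_cmult_right[OF g])
  moreover have "((\<lambda>x. f x * T) has_sum S * T) A"
    by (rule has_sum_cmult_left[OF f])
  ultimately have "U = S * T" by (rule has_sum_unique)
  with U show ?thesis by simp
qed

lemma monomial_add: "monomial (\<beta> + \<gamma>) z = monomial \<beta> z * monomial \<gamma> z"
  by (simp add: monomial_def power_add prod.distrib)

lemma expands_mult: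
  assumes x: "expands x f" and y: "expands y g"
  shows "expands (x * y) (\<lambda>z. f z * g z)"
  unfolding expands_def
proof
  fix z :: "complex ^ 'a" assume z: "z \<in> unit_ball"
  define h where "h p = mcoeff x (fst p) * mcoeff y (snd p) * monomial (fst p + snd p) z" for p
  have "(h has_sum f z * g z) (UNIV \<times> UNIV)"
  proof -
    have "((\<lambda>\<alpha>. mcoeff x \<alpha> * monomial \<alpha> z) has_sum f z) UNIV"
      "((\<lambda>\<alpha>. mcoeff y \<alpha> * monomial \<alpha> z) has_sum g z) UNIV"
      using x y z by (simp_all add: expands_def)
    from has_sum_mult_complex[OF this] show ?thesis
      by (simp add: h_def[abs_def] monomial_add case_prod_unfold mult_ac)
  qed
  moreover have "(h has_sum f z * g z) (UNIV \<times> UNIV) =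
      ((\<lambda>(\<alpha>, p). h p) has_sum f z * g z) (SIGMA \<alpha>:UNIV. splits \<alpha>)"
    by (rule has_sum_reindex_bij_witness[where i = snd and j = "\<lambda>p. (fst p + snd p, p)"])
      (auto simp: splits_def)
  ultimately have "((\<lambda>(\<alpha>, p). h p) has_sum f z * g z) (SIGMA \<alpha>:UNIV. splits \<alpha>)"
    by simp
  then show "((\<lambda>\<alpha>. mcoeff (x * y) \<alpha> * monomial \<alpha> z) has_sum f z * g z) UNIV"
  proof (rule has_sum_SigmaD)
    fix \<alpha> :: "'a \<Rightarrow> nat"
    have "mcoeff (x * y) \<alpha> * monomial \<alpha> z = (\<Sum>p\<in>splits \<alpha>. h p)"
      unfolding mcoeff_mult sum_distrib_right h_def
      by (rule sum.cong) (auto simp: splits_def)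
    then show "((\<lambda>p. case (\<alpha>, p) of (\<alpha>, p) \<Rightarrow> h p) has_sum mcoeff (x * y) \<alpha> * monomial \<alpha> z) (splits \<alpha>)"
      by (simp add: has_sum_finite_iff)
  qed
qed

lemma expands_diff:
  assumes x: "expands x f" and y: "expands y g"
  shows "expands (x - y) (\<lambda>z. f z - g z)"
  unfolding expands_def
proof
  fix z :: "complex ^ 'a" assume z: "z \<in> unit_ball"
  then have "((\<lambda>\<alpha>. mcoeff x \<alpha> * monomial \<alpha> z) has_sum f z) UNIV"
    "((\<lambda>\<alpha>. mcoeff y \<alpha> * monomial \<alpha> z) has_sum g z) UNIV"
    using x y by (auto simp: expands_def)
  from has_sum_add[OF this(1) has_sum_cmult_right[OF this(2), of "-1"]]
  show "((\<lambda>\<alpha>. mcoeff (x - y) \<alpha> * monomial \<alpha> z) has_sum f z - g z) UNIV"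
    by (simp add: algebra_simps)
qed

lemma expands_polynomial:
  assumes "finite A"
  shows "expands (Mpow (\<lambda>\<alpha>. if \<alpha> \<in> A then c \<alpha> else 0)) (\<lambda>z. \<Sum>\<alpha>\<in>A. c \<alpha> * monomial \<alpha> z)"
  unfolding expands_def
  by (auto intro!: has_sum_finite_neutralI[OF assms])

lemma expands_1: "expands 1 (\<lambda>_. 1)"
  unfolding expands_def
  by (auto intro!: has_sum_finite_neutralI[of "{0}"] simp: mcoeff_1 monomial_def split: if_splits)

lemma expands_power: "expands x f \<Longrightarrow> expands (x ^ n) (\<lambda>z. f z ^ n)"
  by (induction n) (auto intro: expands_1 expands_mult)

section \<open>Analyticity of convergent power series\<close>

definition complex_differentiable :: "(complex ^ 'd::finite \<Rightarrow> complex) \<Rightarrow> complex ^ 'd \<Rightarrow> bool" where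
  "complex_differentiable f z \<longleftrightarrow>
     (\<exists>D. (f has_derivative D) (at z) \<and> (\<forall>c v. D (c *s v) = c * D v))"

lemma analytic_in_ball_iff: "analytic_in_ball f \<longleftrightarrow> (\<forall>z\<in>unit_ball. complex_differentiable f z)"
  by (simp add: analytic_in_ball_def complex_differentiable_def)

lemma complex_differentiable_const: "complex_differentiable (\<lambda>_. c) z"
  unfolding complex_differentiable_def by (rule exI[of _ "\<lambda>_. 0"]) auto

lemma complex_differentiable_coord: "complex_differentiable (\<lambda>z. z $ i) z"
  unfolding complex_differentiable_def
  by (rule exI[of _ "\<lambda>v. v $ i"])
    (auto intro: bounded_linear.has_derivative[OF bounded_linear_vec_nth] has_derivative_ident)

lemma complex_differentiable_add:
  assumes "complex_differentiable f z" "complex_differentiable g z"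
  shows "complex_differentiable (\<lambda>z. f z + g z) z"
proof -
  obtain D E where "(f has_derivative D) (at z)" "\<forall>c v. D (c *s v) = c * D v"
    "(g has_derivative E) (at z)" "\<forall>c v. E (c *s v) = c * E v"
    using assms unfolding complex_differentiable_def by blast
  then show ?thesis
    unfolding complex_differentiable_def
    by (intro exI[of _ "\<lambda>v. D v + E v"]) (simp add: has_derivative_add distrib_left)
qed

lemma complex_differentiable_mult:
  assumes "complex_differentiable f z" "complex_differentiable g z"
  shows "complex_differentiable (\<lambda>z. f z * g z) z"
proof -
  obtain D E where "(f has_derivative D) (at z)" "\<forall>c v. D (c *s v) = c * D v"
    "(g has_derivative E) (at z)" "\<forall>c v. E (c *s v) = c * E v"
    using assms unfolding complex_differentiable_def by blast
  then show ?thesis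
    unfolding complex_differentiable_def
    by (intro exI[of _ "\<lambda>v. f z * E v + D v * g z"] conjI has_derivative_mult)
      (simp_all add: algebra_simps)
qed

lemma complex_differentiable_power:
  "complex_differentiable f z \<Longrightarrow> complex_differentiable (\<lambda>z. f z ^ n) z"
  by (induction n) (auto intro: complex_differentiable_const complex_differentiable_mult)

lemma complex_differentiable_monomial: "complex_differentiable (monomial \<alpha>) z"
proof -
  have "complex_differentiable (\<lambda>z. \<Prod>i\<in>A. z $ i ^ \<alpha> i) z" for A
    by (induction A rule: infinite_finite_induct)
      (simp_all add: complex_differentiable_const
        complex_differentiable_mult[OF complex_differentiable_power[OF complex_differentiable_coord]])
  then show ?thesis unfolding monomial_def[abs_def] .
qed

lemma complex_differentiable_sum:
  "(\<And>i. i \<in> A \<Longrightarrow> complex_differentiable (f i) z) \<Longrightarrow> complex_differentiable (\<lambda>z. \<Sum>i\<in>A. f i z) z"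
  by (induction A rule: infinite_finite_induct)
    (auto intro: complex_differentiable_const complex_differentiable_add)

definition msphere :: "nat \<Rightarrow> ('d::finite \<Rightarrow> nat) set" where
  "msphere n = {\<alpha>. multi_size \<alpha> = n}"

lemma finite_msphere [simp]: "finite (msphere n :: ('d::finite \<Rightarrow> nat) set)"
  by (rule finite_subset[OF _ finite_mball[of n]]) (auto simp: msphere_def mball_def)

lemma has_sum_by_degree:
  fixes g :: "('d::finite \<Rightarrow> nat) \<Rightarrow> 'a::real_normed_vector"
  assumes "(g has_sum T) UNIV"
  shows "(\<lambda>n. \<Sum>\<alpha>\<in>msphere n. g \<alpha>) sums T"
proof (rule has_sum_imp_sums)
  have "(g has_sum T) UNIV = ((\<lambda>(n, \<alpha>). g \<alpha>) has_sum T) (SIGMA n:UNIV. msphere n)"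
    by (rule has_sum_reindex_bij_witness[where i = snd and j = "\<lambda>\<alpha>. (multi_size \<alpha>, \<alpha>)"])
      (auto simp: msphere_def)
  then have "((\<lambda>(n, \<alpha>). g \<alpha>) has_sum T) (SIGMA n:UNIV. msphere n)"
    using assms by simp
  then show "((\<lambda>n. \<Sum>\<alpha>\<in>msphere n. g \<alpha>) has_sum T) UNIV"
    by (rule has_sum_SigmaD) (simp add: has_sum_finite_iff)
qed

text \<open>
  On a slightly smaller polydisc the homogeneous parts are dominated by a convergent series, and
  Cauchy's inequality on complex lines transfers the domination to their derivatives.
\<close>

theorem expands_imp_analytic:
  fixes f :: "complex ^ 'd::finite \<Rightarrow> complex"
  assumes x: "expands x f"
  shows "analytic_in_ball f"
  unfolding analytic_in_ball_iff
proof
  fix z0 :: "complex ^ 'd" assume z0: "z0 \<in> unit_ball"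
  obtain \<rho> where \<rho>: "\<rho> > 0" "(\<Sum>i\<in>UNIV. (cmod (z0 $ i) + \<rho>)\<^sup>2) < 1"
    using ball_enlarge[OF z0] .
  define s where "s i = cmod (z0 $ i) + \<rho>" for i
  have s: "s i > 0" for i using \<rho>(1) by (simp add: s_def add_nonneg_pos)
  define P where "P n z = (\<Sum>\<alpha>\<in>msphere n. mcoeff x \<alpha> * monomial \<alpha> z)" for n z
  define m where "m n = (\<Sum>\<alpha>\<in>msphere n. cmod (mcoeff x \<alpha>) * (\<Prod>i\<in>UNIV. s i ^ \<alpha> i))" for n
  have m0: "m n \<ge> 0" for n
    unfolding m_def using s by (intro sum_nonneg mult_nonneg_nonneg prod_nonneg) (auto simp: less_imp_le)
  have sm: "summable m"
  proof -
    define w :: "complex ^ 'd" where "w = (\<chi> i. of_real (s i))"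
    have cw: "cmod (w $ i) = s i" for i using s[of i] by (simp add: w_def)
    have "w \<in> unit_ball"
      by (rule norm_less_1_if_components(2)[of w s]) (use cw \<rho> in \<open>simp_all add: s_def\<close>)
    then have "(\<lambda>\<alpha>. mcoeff x \<alpha> * monomial \<alpha> w) summable_on UNIV"
      using x by (auto simp: expands_def summable_on_def)
    then have "(\<lambda>\<alpha>. cmod (mcoeff x \<alpha> * monomial \<alpha> w)) summable_on UNIV"
      by (simp add: summable_on_iff_abs_summable_on_complex)
    then obtain T where "((\<lambda>\<alpha>. cmod (mcoeff x \<alpha> * monomial \<alpha> w)) has_sum T) UNIV"
      by (auto simp: summable_on_def)
    from has_sum_by_degree[OF this] show ?thesis
      unfolding m_def
      by (simp add: norm_mult monomial_def prod_norm[symmetric] norm_power cw sums_iff)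
  qed
  have P_bound: "cmod (P n z) \<le> m n" if "norm (z - z0) \<le> \<rho>" for n z
  proof -
    have zs: "cmod (z $ i) \<le> s i" for i
    proof -
      have "cmod (z $ i) \<le> cmod (z0 $ i) + cmod ((z - z0) $ i)"
        using norm_triangle_ineq[of "z0 $ i" "(z - z0) $ i"] by simp
      also have "cmod ((z - z0) $ i) \<le> \<rho>"
        using Finite_Cartesian_Product.norm_nth_le[of "z - z0" i] that by linarith
      finally show ?thesis by (simp add: s_def)
    qed
    have "cmod (P n z) \<le> (\<Sum>\<alpha>\<in>msphere n. cmod (mcoeff x \<alpha> * monomial \<alpha> z))"
      unfolding P_def by (rule norm_sum)
    also have "\<dots> \<le> m n"
      unfolding m_def norm_mult monomial_def prod_norm[symmetric] norm_power
      by (intro sum_mono mult_left_mono prod_mono conjI power_mono zs) auto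
    finally show ?thesis .
  qed
  have "complex_differentiable (P n) z" for n z
    unfolding P_def[abs_def]
    by (intro complex_differentiable_sum complex_differentiable_mult complex_differentiable_const
        complex_differentiable_monomial)
  then have "\<forall>n z. \<exists>D. (P n has_derivative D) (at z) \<and> (\<forall>c v. D (c *s v) = c * D v)"
    unfolding complex_differentiable_def by blast
  then obtain D where D: "\<And>n z. (P n has_derivative D n z) (at z)"
    and lin: "\<And>n z c v. D n z (c *s v) = c * D n z v"
    by (metis (no_types, lifting))
  define S where "S = ball z0 (\<rho> / 2)"
  have D_bound: "cmod (D n z h) \<le> m n * (4 / \<rho> * norm h)" if z: "z \<in> S" for n z h
  proof (cases "h = 0")
    case True
    then show ?thesis using lin[of n z 0 0] by simp
  next
    case False
    \<comment> \<open>A circle of radius \<open>r\<close> on the line through \<open>z\<close> in direction \<open>h\<close> stays within \<open>\<rho>\<close> of \<open>z0\<close>.\<close>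
    define r where "r = \<rho> / (4 * norm h)"
    have r: "r > 0" "r * norm h = \<rho> / 4" using False \<rho>(1) by (auto simp: r_def)
    define g where "g w = P n (z + w *s h)" for w
    have g': "(g has_field_derivative D n (z + w *s h) h) (at w)" for w
      unfolding g_def by (rule has_field_derivative_on_line[OF D lin])
    have gh: "g holomorphic_on A" for A
      using g' by (auto simp: holomorphic_on_def field_differentiable_def
          intro: has_field_derivative_at_within)
    have "cmod ((deriv ^^ 1) g 0) \<le> fact 1 * m n / r ^ 1"
    proof (rule Cauchy_inequality[OF gh holomorphic_on_imp_continuous_on[OF gh] r(1)])
      fix w :: complex assume "cmod (0 - w) = r"
      then have "norm (w *s h) = \<rho> / 4"
        using r by (simp add: norm_complex_vec norm_mult power_mult_distrib
            sum_distrib_left[symmetric] real_sqrt_mult)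
      moreover have "norm (z - z0) < \<rho> / 2"
        using z by (simp add: S_def dist_norm norm_minus_commute)
      ultimately have "norm (z + w *s h - z0) \<le> \<rho>"
        using norm_triangle_ineq[of "z - z0" "w *s h"] \<rho>(1) by (simp add: algebra_simps)
      then show "cmod (g w) \<le> m n"
        unfolding g_def by (rule P_bound)
    qed
    moreover have "deriv g 0 = D n z h"
      using DERIV_imp_deriv[OF g'[of 0]] by simp
    ultimately show ?thesis by (simp add: r_def mult_ac)
  qed
  define D' where "D' z h = (\<Sum>n. D n z h)" for z h
  have sD: "summable (\<lambda>n. D n z h)" if "z \<in> S" for z h
    by (rule summable_comparison_test'[of "\<lambda>n. m n * (4 / \<rho> * norm h)" 0])
      (use D_bound that sm in \<open>auto intro: summable_mult2\<close>)
  have sums_P: "(\<lambda>n. P n z) sums f z" if "z \<in> unit_ball" for z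
    unfolding P_def using x that by (intro has_sum_by_degree) (simp add: expands_def)
  have sub: "S \<subseteq> unit_ball"
  proof
    fix z assume "z \<in> S"
    then have n: "norm (z - z0) < \<rho>" using \<rho>(1) by (simp add: S_def dist_norm norm_minus_commute)
    have "cmod (z $ i) \<le> s i" for i
    proof -
      have "cmod (z $ i) \<le> cmod (z0 $ i) + cmod ((z - z0) $ i)"
        using norm_triangle_ineq[of "z0 $ i" "(z - z0) $ i"] by simp
      then show ?thesis
        using Finite_Cartesian_Product.norm_nth_le[of "z - z0" i] n by (simp add: s_def)
    qed
    then show "z \<in> unit_ball"
      by (rule norm_less_1_if_components(2)) (use \<rho> in \<open>simp add: s_def\<close>)
  qed
  have z0S: "z0 \<in> S" using \<rho>(1) by (simp add: S_def)
  have "\<exists>g. \<forall>z\<in>S. (\<lambda>n. P n z) sums g z \<and> (g has_derivative D' z) (at z within S)"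
  proof (rule has_derivative_series[where f' = D])
    show "convex S" by (simp add: S_def)
    show "(P n has_derivative D n z) (at z within S)" for n z
      by (rule has_derivative_at_withinI[OF D])
    show "z0 \<in> S" by (rule z0S)
    show "(\<lambda>n. P n z0) sums f z0" by (rule sums_P[OF z0])
    fix e :: real assume e: "e > 0"
    have "e * \<rho> / 4 > 0" using e \<rho>(1) by simp
    from suminf_exist_split[OF this sm] obtain N where
      N: "\<And>n. n \<ge> N \<Longrightarrow> norm (\<Sum>i. m (i + n)) < e * \<rho> / 4" by blast
    have "cmod ((\<Sum>i<n. D i z h) - D' z h) \<le> e * norm h" if n: "n \<ge> N" and z: "z \<in> S" for n z h
    proof -
      have sm': "summable (\<lambda>i. m (i + n))" using sm by (simp add: summable_iff_shift)
      have "cmod ((\<Sum>i<n. D i z h) - D' z h) = cmod (\<Sum>i. D (i + n) z h)"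
        unfolding D'_def suminf_split_initial_segment[OF sD[OF z, of h], of n] by simp
      also have "\<dots> \<le> (\<Sum>i. m (i + n) * (4 / \<rho> * norm h))"
        by (rule norm_suminf_le[OF D_bound[OF z]]) (rule summable_mult2[OF sm'])
      also have "\<dots> = (\<Sum>i. m (i + n)) * (4 / \<rho> * norm h)"
        by (rule suminf_mult2[OF sm', symmetric])
      also have "\<dots> \<le> (e * \<rho> / 4) * (4 / \<rho> * norm h)"
        using N[OF n] \<rho>(1) by (intro mult_right_mono) auto
      also have "\<dots> = e * norm h" using \<rho>(1) by simp
      finally show ?thesis .
    qed
    then show "\<forall>\<^sub>F n in sequentially. \<forall>z\<in>S. \<forall>h. cmod ((\<Sum>i<n. D i z h) - D' z h) \<le> e * norm h"
      unfolding eventually_sequentially by blast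
  qed
  then obtain g where g: "\<And>z. z \<in> S \<Longrightarrow> (\<lambda>n. P n z) sums g z"
    "\<And>z. z \<in> S \<Longrightarrow> (g has_derivative D' z) (at z within S)"
    by blast
  have gf: "g z = f z" if "z \<in> S" for z
    using g(1)[OF that] sums_P[of z] sub that sums_unique2 by blast
  have "open S" by (simp add: S_def)
  have "(g has_derivative D' z0) (at z0)"
    using g(2)[OF z0S] at_within_open[OF z0S \<open>open S\<close>] by simp
  then have "(f has_derivative D' z0) (at z0)"
    by (rule has_derivative_transform_within_open[OF _ \<open>open S\<close> z0S gf])
  moreover have "D' z0 (c *s v) = c * D' z0 v" for c v
    unfolding D'_def lin by (rule suminf_mult[OF sD[OF z0S]])
  ultimately show "complex_differentiable f z0"
    unfolding complex_differentiable_def by blast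
qed

section \<open>Bounded multiplication on weighted spaces\<close>

text \<open>
  Index \<open>0\<close> is the weight of the Drury-Arveson norm. A step up divides by the square of
  \<open>1 + multi_size\<close>, the factor by which the operator \<open>1 + euler\<close> scales, so that this operator maps
  each space isometrically onto the next.
\<close>

definition weight :: "nat \<Rightarrow> ('d::finite \<Rightarrow> nat) \<Rightarrow> real" where
  "weight j \<alpha> = multi_fact \<alpha> / fact (multi_size \<alpha>) / (1 + real (multi_size \<alpha>)) ^ (2 * j)"

lemma weight_pos [simp]: "weight j \<alpha> > 0"
  by (auto simp: weight_def multi_fact_def intro!: divide_pos_pos prod_pos)

lemma weight_nonneg [simp]: "weight j \<alpha> \<ge> 0"
  using weight_pos less_imp_le by blast

text \<open>
  Truncation at total degree \<open>N\<close> keeps every sum finite, and it loses nothing: the coefficients of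
  a product up to degree \<open>N\<close> only depend on those of the factors up to degree \<open>N\<close>.
\<close>

definition trunc_norm :: "nat \<Rightarrow> nat \<Rightarrow> 'd::finite mpow \<Rightarrow> real" where
  "trunc_norm j N x = L2_set (\<lambda>\<alpha>. sqrt (weight j \<alpha>) * cmod (mcoeff x \<alpha>)) (mball N)"

definition mult_bounded :: "nat \<Rightarrow> 'd::finite mpow \<Rightarrow> real \<Rightarrow> bool" where
  "mult_bounded j x C \<longleftrightarrow> 0 \<le> C \<and> (\<forall>N y. trunc_norm j N (x * y) \<le> C * trunc_norm j N y)"

lemma trunc_norm_nonneg [simp]: "0 \<le> trunc_norm j N x"
  by (simp add: trunc_norm_def)

lemma trunc_norm_power2: "(trunc_norm j N x)\<^sup>2 = (\<Sum>\<alpha>\<in>mball N. weight j \<alpha> * (cmod (mcoeff x \<alpha>))\<^sup>2)"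
  unfolding trunc_norm_def L2_set_def
  by (subst real_sqrt_pow2) (auto intro!: sum_nonneg simp: power_mult_distrib)

lemma trunc_norm_leI:
  assumes "0 \<le> K" and "(\<Sum>\<alpha>\<in>mball N. weight j \<alpha> * (cmod (mcoeff x \<alpha>))\<^sup>2) \<le> K\<^sup>2"
  shows "trunc_norm j N x \<le> K"
  using assms unfolding trunc_norm_power2[symmetric] by (rule power2_le_imp_le[rotated])

lemma trunc_norm_add: "trunc_norm j N (x + y) \<le> trunc_norm j N x + trunc_norm j N y"
proof -
  have "trunc_norm j N (x + y) \<le> L2_set (\<lambda>\<alpha>. sqrt (weight j \<alpha>) * cmod (mcoeff x \<alpha>)
      + sqrt (weight j \<alpha>) * cmod (mcoeff y \<alpha>)) (mball N)"
    unfolding trunc_norm_def distrib_left[symmetric]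
    by (rule L2_set_mono) (auto intro!: mult_left_mono norm_triangle_ineq)
  also have "\<dots> \<le> trunc_norm j N x + trunc_norm j N y"
    unfolding trunc_norm_def by (rule L2_set_triangle_ineq)
  finally show ?thesis .
qed

lemma trunc_norm_mconst: "trunc_norm j N (mconst c * x) = cmod c * trunc_norm j N x"
  unfolding trunc_norm_def
  by (simp add: norm_mult L2_set_right_distrib mult.left_commute)

lemma trunc_norm_of_nat: "trunc_norm j N (of_nat k * x) = real k * trunc_norm j N x"
  by (simp add: of_nat_mpow trunc_norm_mconst)

lemma trunc_norm_diff: "trunc_norm j N (x - y) \<le> trunc_norm j N x + trunc_norm j N y"
proof -
  have "x - y = x + mconst (-1) * y" by (rule mpow_eqI) simp
  moreover have "trunc_norm j N (x + mconst (-1) * y) \<le> trunc_norm j N x + trunc_norm j N y"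
    using trunc_norm_add[of j N x "mconst (-1) * y"] by (simp add: trunc_norm_mconst)
  ultimately show ?thesis by (simp only:)
qed

lemma mult_boundedD: "mult_bounded j x C \<Longrightarrow> trunc_norm j N (x * y) \<le> C * trunc_norm j N y"
  by (simp add: mult_bounded_def)

lemma mult_bounded_nonneg: "mult_bounded j x C \<Longrightarrow> 0 \<le> C"
  by (simp add: mult_bounded_def)

lemma mult_bounded_mult:
  assumes x: "mult_bounded j x C" and y: "mult_bounded j y D"
  shows "mult_bounded j (x * y) (C * D)"
  unfolding mult_bounded_def
proof (intro conjI allI)
  show "0 \<le> C * D" using assms by (simp add: mult_bounded_def)
  fix N z
  have "trunc_norm j N (x * (y * z)) \<le> C * trunc_norm j N (y * z)"
    by (rule mult_boundedD[OF x])
  also have "\<dots> \<le> C * (D * trunc_norm j N z)"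
    by (rule mult_left_mono[OF mult_boundedD[OF y] mult_bounded_nonneg[OF x]])
  finally show "trunc_norm j N (x * y * z) \<le> C * D * trunc_norm j N z"
    by (simp add: mult.assoc)
qed

lemma mult_bounded_1: "mult_bounded j 1 1"
  by (simp add: mult_bounded_def)

lemma mult_bounded_power: "mult_bounded j x C \<Longrightarrow> mult_bounded j (x ^ n) (C ^ n)"
  by (induction n) (auto intro: mult_bounded_1 mult_bounded_mult)

lemma mult_bounded_add:
  assumes x: "mult_bounded j x C" and y: "mult_bounded j y D"
  shows "mult_bounded j (x + y) (C + D)"
  unfolding mult_bounded_def
proof (intro conjI allI)
  show "0 \<le> C + D" using assms by (simp add: mult_bounded_def)
  fix N z
  show "trunc_norm j N ((x + y) * z) \<le> (C + D) * trunc_norm j N z"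
    using trunc_norm_add[of j N "x * z" "y * z"] mult_boundedD[OF x, of N z] mult_boundedD[OF y, of N z]
    by (simp add: distrib_right)
qed

lemma mult_bounded_mconst: "mult_bounded j (mconst c) (cmod c)"
  by (simp add: mult_bounded_def trunc_norm_mconst)

lemma mball_Suc: "mball (Suc n) = mball n \<union> msphere (Suc n)"
  and mball_msphere_disjoint: "mball n \<inter> msphere (Suc n) = {}"
  by (auto simp: mball_def msphere_def)

text \<open>
  Summation by parts: an inequality between all truncated sums survives multiplication by weights
  that decrease with the degree.
\<close>

lemma abel_weights:
  fixes Z :: "('d::finite \<Rightarrow> nat) \<Rightarrow> real"
  assumes Z: "\<And>n. 0 \<le> sum Z (mball n)" and v: "decseq v" "\<And>n. 0 \<le> v n"
  shows "0 \<le> (\<Sum>\<alpha>\<in>mball N. v (multi_size \<alpha>) * Z \<alpha>)"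
proof -
  have "v n * sum Z (mball n) \<le> (\<Sum>\<alpha>\<in>mball n. v (multi_size \<alpha>) * Z \<alpha>)" for n
  proof (induction n)
    case 0
    have "mball 0 = {0 :: 'd \<Rightarrow> nat}" by (auto simp: mball_def)
    then show ?case by (simp add: multi_size_def)
  next
    case (Suc n)
    have "v (Suc n) * sum Z (mball (Suc n)) = v (Suc n) * sum Z (mball n) + v (Suc n) * sum Z (msphere (Suc n))"
      unfolding mball_Suc by (subst sum.union_disjoint) (auto simp: mball_msphere_disjoint distrib_left)
    also have "\<dots> \<le> v n * sum Z (mball n) + v (Suc n) * sum Z (msphere (Suc n))"
      by (intro add_right_mono mult_right_mono Z decseq_SucD[OF v(1)])
    also have "\<dots> \<le> (\<Sum>\<alpha>\<in>mball n. v (multi_size \<alpha>) * Z \<alpha>) + v (Suc n) * sum Z (msphere (Suc n))"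
      by (intro add_right_mono Suc)
    also have "v (Suc n) * sum Z (msphere (Suc n)) = (\<Sum>\<alpha>\<in>msphere (Suc n). v (multi_size \<alpha>) * Z \<alpha>)"
      unfolding sum_distrib_left by (rule sum.cong) (auto simp: msphere_def)
    finally show ?case
      unfolding mball_Suc by (subst sum.union_disjoint) (auto simp: mball_msphere_disjoint)
  qed
  from order_trans[OF mult_nonneg_nonneg[OF v(2) Z] this] show ?thesis .
qed

lemma mult_boundedI_abel:
  assumes C: "0 \<le> C"
    and le: "\<And>N y. (\<Sum>\<alpha>\<in>mball N. u \<alpha> * (cmod (mcoeff (x * y) \<alpha>))\<^sup>2)
        \<le> C\<^sup>2 * (\<Sum>\<alpha>\<in>mball N. u \<alpha> * (cmod (mcoeff y \<alpha>))\<^sup>2)"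
    and v: "decseq v" "\<And>n. 0 \<le> v n" and w: "\<And>\<alpha>. weight j \<alpha> = v (multi_size \<alpha>) * u \<alpha>"
  shows "mult_bounded j x C"
  unfolding mult_bounded_def
proof (intro conjI allI C)
  fix N and y
  define Z where "Z \<alpha> = C\<^sup>2 * (u \<alpha> * (cmod (mcoeff y \<alpha>))\<^sup>2) - u \<alpha> * (cmod (mcoeff (x * y) \<alpha>))\<^sup>2" for \<alpha>
  have "0 \<le> (\<Sum>\<alpha>\<in>mball N. v (multi_size \<alpha>) * Z \<alpha>)"
    by (rule abel_weights[OF _ v])
      (use le in \<open>simp add: Z_def sum_subtractf sum_distrib_left[symmetric]\<close>)
  also have "\<dots> = (C * trunc_norm j N y)\<^sup>2 - (trunc_norm j N (x * y))\<^sup>2"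
    unfolding power_mult_distrib trunc_norm_power2 sum_distrib_left sum_subtractf[symmetric]
    by (rule sum.cong) (simp_all add: Z_def w algebra_simps)
  finally have "(trunc_norm j N (x * y))\<^sup>2 \<le> (C * trunc_norm j N y)\<^sup>2"
    by (simp only: diff_ge_0_iff_ge)
  then show "trunc_norm j N (x * y) \<le> C * trunc_norm j N y"
    by (rule power2_le_imp_le) (simp add: C)
qed

lemma mult_bounded_Suc:
  assumes "mult_bounded j x C"
  shows "mult_bounded (Suc j) x C"
proof (rule mult_boundedI_abel)
  show "0 \<le> C" by (rule mult_bounded_nonneg[OF assms])
  show "(\<Sum>\<alpha>\<in>mball N. weight j \<alpha> * (cmod (mcoeff (x * y) \<alpha>))\<^sup>2)
        \<le> C\<^sup>2 * (\<Sum>\<alpha>\<in>mball N. weight j \<alpha> * (cmod (mcoeff y \<alpha>))\<^sup>2)" for N y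
    unfolding trunc_norm_power2[symmetric] power_mult_distrib[symmetric]
    by (intro power_mono mult_boundedD[OF assms]) simp
  show "decseq (\<lambda>n. 1 / (1 + real n)\<^sup>2)"
    by (intro decseq_SucI divide_left_mono power_mono) auto
  show "weight (Suc j) \<alpha> = 1 / (1 + real (multi_size \<alpha>))\<^sup>2 * weight j \<alpha>" for \<alpha> :: "'a \<Rightarrow> nat"
    by (simp add: weight_def power2_eq_square)
qed simp

lemma mult_bounded_le: "mult_bounded 0 x C \<Longrightarrow> mult_bounded j x C"
  by (induction j) (auto intro: mult_bounded_Suc)

lemma trunc_norm_euler: "trunc_norm (Suc j) N (y + euler y) = trunc_norm j N y"
proof -
  have "sqrt (weight (Suc j) \<alpha>) * cmod (mcoeff (y + euler y) \<alpha>) = sqrt (weight j \<alpha>) * cmod (mcoeff y \<alpha>)"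
    for \<alpha> :: "'a \<Rightarrow> nat"
  proof -
    have "mcoeff (y + euler y) \<alpha> = of_nat (Suc (multi_size \<alpha>)) * mcoeff y \<alpha>"
      by (simp add: algebra_simps)
    then have "cmod (mcoeff (y + euler y) \<alpha>) = real (Suc (multi_size \<alpha>)) * cmod (mcoeff y \<alpha>)"
      by (simp only: norm_mult norm_of_nat)
    moreover have "sqrt (weight (Suc j) \<alpha>) = sqrt (weight j \<alpha>) / real (Suc (multi_size \<alpha>))"
      by (simp add: weight_def real_sqrt_divide power2_eq_square[symmetric] real_sqrt_mult)
    ultimately show ?thesis by (simp del: of_nat_Suc)
  qed
  then show ?thesis by (simp only: trunc_norm_def)
qed

section \<open>Multipliers from bounded quotients of multipliers\<close>

lemma euler_power_mult_power:
  fixes f g h :: "'d::finite mpow"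
  assumes fhg: "f = h * g"
  shows "euler (h ^ a * f ^ Suc b) =
    of_nat (a + Suc b) * (h ^ a * f ^ b * euler f) - of_nat a * (h ^ Suc a * f ^ b * euler g)"
proof -
  have hf: "euler h * f = h * euler f - h * h * euler g"
    unfolding fhg euler_mult by (simp add: algebra_simps)
  have "euler (h ^ a) * f = of_nat a * (h ^ a * euler f - h ^ Suc a * euler g)"
  proof (cases a)
    case (Suc k)
    have "euler (h ^ Suc k) * f = of_nat (Suc k) * (h ^ k * (euler h * f))"
      unfolding euler_power by (simp only: mult_ac)
    also have "\<dots> = of_nat (Suc k) * (h ^ Suc k * euler f - h ^ Suc (Suc k) * euler g)"
      unfolding hf by (simp only: power_Suc right_diff_distrib mult_ac)
    finally show ?thesis using Suc by simp
  qed simp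
  then have 1: "euler (h ^ a) * f ^ Suc b = of_nat a * (h ^ a * euler f - h ^ Suc a * euler g) * f ^ b"
    by (simp only: power_Suc mult.assoc[symmetric])
  have "euler (h ^ a * f ^ Suc b) = euler (h ^ a) * f ^ Suc b + h ^ a * euler (f ^ Suc b)"
    by (rule euler_mult)
  also have "\<dots> = of_nat a * (h ^ a * euler f - h ^ Suc a * euler g) * f ^ b
      + of_nat (Suc b) * (h ^ a * f ^ b * euler f)"
    unfolding 1 euler_power by (simp only: mult_ac)
  also have "\<dots> = of_nat (a + Suc b) * (h ^ a * f ^ b * euler f) - of_nat a * (h ^ Suc a * f ^ b * euler g)"
    unfolding of_nat_add by (simp only: algebra_simps)
  finally show ?thesis .
qed

text \<open>
  One power of \<open>f\<close> buys one step down in the scale of spaces. The operator \<open>1 + euler\<close> maps each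
  space isometrically onto the next larger one, and Leibniz' rule expresses
  \<open>(1 + euler) (h\<^sup>a f\<^sup>b\<^sup>+\<^sup>1 y)\<close> through products of \<open>h\<^sup>a f\<^sup>b\<close> and \<open>h\<^sup>a\<^sup>+\<^sup>1 f\<^sup>b\<close> with
  terms that multiplication by \<open>f\<close> and \<open>g\<close> controls: the denominators that arise when \<open>h = f / g\<close> is
  differentiated are absorbed by the surplus factor \<open>f\<close>.
\<close>

lemma mult_bounded_step:
  fixes f g h :: "'d::finite mpow"
  assumes fhg: "f = h * g"
    and f: "mult_bounded j f Cf" "mult_bounded (Suc j) f Cf"
    and g: "mult_bounded j g Cg" "mult_bounded (Suc j) g Cg"
    and U: "mult_bounded (Suc j) (h ^ a * f ^ b) C1" and W: "mult_bounded (Suc j) (h ^ Suc a * f ^ b) C2"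
  shows "mult_bounded j (h ^ a * f ^ Suc b)
    (C1 * Cf + real (a + Suc b) * (C1 * (2 * Cf)) + real a * (C2 * (2 * Cg)))"
  unfolding mult_bounded_def
proof (intro conjI allI)
  note nn = mult_bounded_nonneg[OF f(1)] mult_bounded_nonneg[OF g(1)]
    mult_bounded_nonneg[OF U] mult_bounded_nonneg[OF W]
  then show "0 \<le> C1 * Cf + real (a + Suc b) * (C1 * (2 * Cf)) + real a * (C2 * (2 * Cg))"
    by (intro add_nonneg_nonneg mult_nonneg_nonneg) auto
  fix N and y :: "'d mpow"
  define E where "E y = y + euler y" for y :: "'d mpow"
  let ?U = "h ^ a * f ^ b" and ?W = "h ^ Suc a * f ^ b"
  let ?n = "trunc_norm j N y" and ?t = "trunc_norm (Suc j) N"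
  have n0: "0 \<le> ?n" by simp
  have tE: "?t (E z) = trunc_norm j N z" for z
    unfolding E_def by (rule trunc_norm_euler)
  have comm: "euler p * y = E (p * y) - p * E y" for p
    unfolding E_def euler_mult by (simp add: algebra_simps)
  have id: "E (h ^ a * f ^ Suc b * y) = ?U * (f * E y)
      + of_nat (a + Suc b) * (?U * (E (f * y) - f * E y)) - of_nat a * (?W * (E (g * y) - g * E y))"
  proof -
    have "E (h ^ a * f ^ Suc b * y) = h ^ a * f ^ Suc b * E y + euler (h ^ a * f ^ Suc b) * y"
      unfolding E_def euler_mult[of "h ^ a * f ^ Suc b"] by (simp only: algebra_simps)
    also have "euler (h ^ a * f ^ Suc b) * y =
        of_nat (a + Suc b) * (?U * (euler f * y)) - of_nat a * (?W * (euler g * y))"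
      unfolding euler_power_mult_power[OF fhg] by (simp only: left_diff_distrib mult.assoc)
    also have "h ^ a * f ^ Suc b * E y = ?U * (f * E y)"
      by (simp only: power_Suc mult_ac)
    finally show ?thesis
      unfolding comm by (simp only: add_diff_eq)
  qed
  have bound: "?t (E (p * y) - p * E y) \<le> 2 * C * ?n"
    if "mult_bounded j p C" "mult_bounded (Suc j) p C" for p :: "'d mpow" and C
    using trunc_norm_diff[of "Suc j" N "E (p * y)" "p * E y"] mult_boundedD[OF that(1), of N y]
      mult_boundedD[OF that(2), of N "E y"] unfolding tE by linarith
  have 1: "?t (?U * (f * E y)) \<le> C1 * (Cf * ?n)"
    by (rule order_trans[OF mult_boundedD[OF U]])
      (use mult_boundedD[OF f(2), of N "E y"] nn in \<open>auto simp: tE intro: mult_left_mono\<close>)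
  have 2: "?t (?U * (E (f * y) - f * E y)) \<le> C1 * (2 * Cf * ?n)"
    by (rule order_trans[OF mult_boundedD[OF U]])
      (intro mult_left_mono bound f nn)
  have 3: "?t (?W * (E (g * y) - g * E y)) \<le> C2 * (2 * Cg * ?n)"
    by (rule order_trans[OF mult_boundedD[OF W]])
      (intro mult_left_mono bound g nn)
  have "trunc_norm j N (h ^ a * f ^ Suc b * y) = ?t (E (h ^ a * f ^ Suc b * y))"
    by (rule tE[symmetric])
  also have "\<dots> \<le> ?t (?U * (f * E y)) + real (a + Suc b) * ?t (?U * (E (f * y) - f * E y))
      + real a * ?t (?W * (E (g * y) - g * E y))"
    unfolding id trunc_norm_of_nat[symmetric]
    by (intro order_trans[OF trunc_norm_diff] add_right_mono trunc_norm_add)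
  also have "\<dots> \<le> C1 * (Cf * ?n) + real (a + Suc b) * (C1 * (2 * Cf * ?n)) + real a * (C2 * (2 * Cg * ?n))"
    by (intro add_mono mult_left_mono 1 2 3) auto
  finally show "trunc_norm j N (h ^ a * f ^ Suc b * y) \<le>
      (C1 * Cf + real (a + Suc b) * (C1 * (2 * Cf)) + real a * (C2 * (2 * Cg))) * ?n"
    by (simp only: algebra_simps)
qed

theorem quotient_multiplier:
  fixes f g h :: "'d::finite mpow"
  assumes fhg: "f = h * g" and f: "mult_bounded 0 f Cf" and g: "mult_bounded 0 g Cg"
    and h: "mult_bounded d h Ch"
  obtains C where "mult_bounded 0 (h * f ^ d) C"
proof -
  have "\<exists>C. mult_bounded j (h ^ a * f ^ b) C" if "j + b = d" for j a b
    using that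
  proof (induction b arbitrary: j a)
    case 0
    then show ?case using mult_bounded_power[OF h] by auto
  next
    case (Suc b)
    then have jb: "Suc j + b = d" by simp
    obtain C1 C2 where "mult_bounded (Suc j) (h ^ a * f ^ b) C1"
      "mult_bounded (Suc j) (h ^ Suc a * f ^ b) C2"
      using Suc.IH[OF jb, of a] Suc.IH[OF jb, of "Suc a"] by blast
    from mult_bounded_step[OF fhg mult_bounded_le[OF f] mult_bounded_le[OF f]
        mult_bounded_le[OF g] mult_bounded_le[OF g] this]
    show ?case by blast
  qed
  from this[of 0 d 1] show thesis using that by auto
qed

section \<open>Bounded analytic functions act on a large weighted space\<close>

text \<open>
  On a torus inside the ball, multiplication by \<open>h\<close> increases the mean square at most by \<open>C\<^sup>2\<close>.
  Parseval's identity evaluates the mean square of the truncation of \<open>y\<close>, and Bessel's inequality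
  extracts the coefficients of the product.
\<close>

lemma torus_bound:
  fixes h :: "complex ^ 'd::finite \<Rightarrow> complex"
  assumes x: "expands x h" and C: "\<And>z. z \<in> unit_ball \<Longrightarrow> cmod (h z) \<le> C"
    and r: "\<And>i. 0 \<le> r i" "(\<Sum>i\<in>UNIV. (r i)\<^sup>2) < 1"
  shows "(\<Sum>\<alpha>\<in>mball N. (cmod (mcoeff (x * y) \<alpha>))\<^sup>2 * (\<Prod>i\<in>UNIV. r i ^ \<alpha> i)\<^sup>2)
    \<le> C\<^sup>2 * (\<Sum>\<alpha>\<in>mball N. (cmod (mcoeff y \<alpha>))\<^sup>2 * (\<Prod>i\<in>UNIV. r i ^ \<alpha> i)\<^sup>2)"
proof -
  define R where "R \<alpha> = (\<Prod>i\<in>UNIV. r i ^ \<alpha> i)" for \<alpha> :: "'d \<Rightarrow> nat"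
  have R0: "R \<alpha> \<ge> 0" for \<alpha> unfolding R_def by (intro prod_nonneg) (simp add: r)
  define yN where "yN = Mpow (\<lambda>\<alpha>. if \<alpha> \<in> mball N then mcoeff y \<alpha> else 0)"
  define P where "P z = (\<Sum>\<alpha>\<in>mball N. mcoeff y \<alpha> * monomial \<alpha> z)" for z
  have ex: "expands (x * yN) (\<lambda>z. h z * P z)"
    unfolding yN_def P_def[abs_def] by (intro expands_mult x expands_polynomial) simp
  have trunc: "mcoeff (x * yN) \<alpha> = mcoeff (x * y) \<alpha>" if "\<alpha> \<in> mball N" for \<alpha>
    unfolding mcoeff_mult
    by (rule sum.cong) (use that in \<open>auto simp: splits_def mball_def yN_def\<close>)
  define c where "c \<alpha> = mcoeff (x * yN) \<alpha> * of_real (R \<alpha>)" for \<alpha>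
  define p where "p M k = torus_point r M k" for M k
  have p: "p M k \<in> unit_ball" for M k
    by (rule norm_less_1_if_components(2)[of _ r])
      (use r in \<open>auto simp: p_def torus_point_def norm_mult\<close>)
  define G where "G M k = h (p M k) * P (p M k)" for M k
  have G: "((\<lambda>\<beta>. c \<beta> * character M k \<beta>) has_sum G M k) UNIV" for M k
  proof -
    have "((\<lambda>\<beta>. mcoeff (x * yN) \<beta> * monomial \<beta> (p M k)) has_sum h (p M k) * P (p M k)) UNIV"
      using ex p[of M k] unfolding expands_def by blast
    then show ?thesis
      by (simp only: G_def c_def R_def p_def monomial_torus_point mult.assoc)
  qed
  have lim: "(\<lambda>M. \<Sum>\<alpha>\<in>mball N. (cmod (grid_mean M (\<lambda>k. G M k * cnj (character M k \<alpha>))))\<^sup>2)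
      \<longlonglongrightarrow> (\<Sum>\<alpha>\<in>mball N. (cmod (c \<alpha>))\<^sup>2)"
    by (intro tendsto_intros grid_mean_tendsto_coeff[OF G])
  have le: "(\<Sum>\<alpha>\<in>mball N. (cmod (grid_mean M (\<lambda>k. G M k * cnj (character M k \<alpha>))))\<^sup>2)
      \<le> C\<^sup>2 * (\<Sum>\<alpha>\<in>mball N. (cmod (mcoeff y \<alpha> * of_real (R \<alpha>)))\<^sup>2)" if M: "M > N" for M
  proof -
    have small: "\<alpha> i < M" if "\<alpha> \<in> mball N" for \<alpha> :: "'d \<Rightarrow> nat" and i
      using component_le_multi_size[of \<alpha> i] that M by (simp add: mball_def)
    have "(\<Sum>\<alpha>\<in>mball N. (cmod (grid_mean M (\<lambda>k. G M k * cnj (character M k \<alpha>))))\<^sup>2)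
        \<le> grid_mean M (\<lambda>k. (cmod (G M k))\<^sup>2)"
      by (rule grid_bessel) (use small in auto)
    also have "\<dots> \<le> grid_mean M (\<lambda>k. C\<^sup>2 * (cmod (P (p M k)))\<^sup>2)"
      by (rule grid_mean_mono)
        (simp add: G_def norm_mult power_mult_distrib mult_right_mono power_mono C[OF p])
    also have "\<dots> = C\<^sup>2 * grid_mean M (\<lambda>k. (cmod (\<Sum>\<alpha>\<in>mball N. (mcoeff y \<alpha> * of_real (R \<alpha>)) * character M k \<alpha>))\<^sup>2)"
      unfolding grid_mean_mult P_def p_def monomial_torus_point R_def by (simp only: mult.assoc)
    also have "\<dots> = C\<^sup>2 * (\<Sum>\<alpha>\<in>mball N. (cmod (mcoeff y \<alpha> * of_real (R \<alpha>)))\<^sup>2)"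
      by (subst grid_parseval) (use small in auto)
    finally show ?thesis .
  qed
  have "(\<Sum>\<alpha>\<in>mball N. (cmod (c \<alpha>))\<^sup>2)
      \<le> C\<^sup>2 * (\<Sum>\<alpha>\<in>mball N. (cmod (mcoeff y \<alpha> * of_real (R \<alpha>)))\<^sup>2)"
    by (rule LIMSEQ_le_const2[OF lim]) (use le in \<open>auto intro!: exI[of _ "Suc N"]\<close>)
  also have "(\<Sum>\<alpha>\<in>mball N. (cmod (c \<alpha>))\<^sup>2) = (\<Sum>\<alpha>\<in>mball N. (cmod (mcoeff (x * y) \<alpha>))\<^sup>2 * (R \<alpha>)\<^sup>2)"
    by (rule sum.cong) (auto simp: c_def norm_mult power_mult_distrib trunc)
  finally show ?thesis
    unfolding R_def by (simp only: norm_mult norm_of_real power_mult_distrib power2_abs)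
qed

text \<open>
  Homogenizing the inequality on the tori \<open>\<bar>z\<^sub>i\<bar>\<^sup>2 = t\<^sub>i / \<sigma>\<close> and letting \<open>\<sigma>\<close> decrease to
  \<open>\<Sum>t\<^sub>i\<close> frees the variables \<open>t\<^sub>i\<close> of all constraints but their sign.
\<close>

lemma homogeneous_torus_bound:
  fixes h :: "complex ^ 'd::finite \<Rightarrow> complex"
  assumes x: "expands x h" and C: "\<And>z. z \<in> unit_ball \<Longrightarrow> cmod (h z) \<le> C"
    and t: "\<And>i. 0 \<le> t i"
  shows "(\<Sum>\<alpha>\<in>mball N. (cmod (mcoeff (x * y) \<alpha>))\<^sup>2 *
      ((\<Prod>i\<in>UNIV. t i ^ \<alpha> i) * (\<Sum>i\<in>UNIV. t i) ^ (N - multi_size \<alpha>)))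
    \<le> C\<^sup>2 * (\<Sum>\<alpha>\<in>mball N. (cmod (mcoeff y \<alpha>))\<^sup>2 *
      ((\<Prod>i\<in>UNIV. t i ^ \<alpha> i) * (\<Sum>i\<in>UNIV. t i) ^ (N - multi_size \<alpha>)))"
proof -
  define \<tau> where "\<tau> = (\<Sum>i\<in>UNIV. t i)"
  have \<tau>0: "\<tau> \<ge> 0" unfolding \<tau>_def by (intro sum_nonneg) (simp add: t)
  define Q where "Q z \<sigma> = (\<Sum>\<alpha>\<in>mball N. (cmod (mcoeff z \<alpha>))\<^sup>2 *
      ((\<Prod>i\<in>UNIV. t i ^ \<alpha> i) * \<sigma> ^ (N - multi_size \<alpha>)))" for z :: "'d mpow" and \<sigma> :: real
  have "Q (x * y) \<sigma> \<le> C\<^sup>2 * Q y \<sigma>" if \<sigma>: "\<sigma> > \<tau>" for \<sigma>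
  proof -
    have \<sigma>0: "\<sigma> > 0" using \<sigma> \<tau>0 by simp
    define r where "r i = sqrt (t i / \<sigma>)" for i
    have r: "0 \<le> r i" "(r i)\<^sup>2 = t i / \<sigma>" for i
      using t \<sigma>0 by (auto simp: r_def)
    have rs: "(\<Sum>i\<in>UNIV. (r i)\<^sup>2) < 1"
      unfolding r sum_divide_distrib[symmetric] using \<sigma> \<sigma>0 by (simp add: \<tau>_def)
    have Q: "Q z \<sigma> = \<sigma> ^ N * (\<Sum>\<alpha>\<in>mball N. (cmod (mcoeff z \<alpha>))\<^sup>2 * (\<Prod>i\<in>UNIV. r i ^ \<alpha> i)\<^sup>2)" for z
      unfolding Q_def sum_distrib_left
    proof (rule sum.cong[OF refl])
      fix \<alpha> :: "'d \<Rightarrow> nat" assume "\<alpha> \<in> mball N"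
      then have N: "\<sigma> ^ N = \<sigma> ^ multi_size \<alpha> * \<sigma> ^ (N - multi_size \<alpha>)"
        by (simp add: mball_def power_add[symmetric])
      have "(\<Prod>i\<in>UNIV. r i ^ \<alpha> i)\<^sup>2 = (\<Prod>i\<in>UNIV. (t i / \<sigma>) ^ \<alpha> i)"
        unfolding prod_power_distrib r(2)[symmetric] by (simp add: power_mult[symmetric] mult.commute)
      also have "\<dots> = (\<Prod>i\<in>UNIV. t i ^ \<alpha> i) / \<sigma> ^ multi_size \<alpha>"
        by (simp add: power_divide prod_dividef multi_size_def power_sum)
      finally show "(cmod (mcoeff z \<alpha>))\<^sup>2 * ((\<Prod>i\<in>UNIV. t i ^ \<alpha> i) * \<sigma> ^ (N - multi_size \<alpha>)) =
          \<sigma> ^ N * ((cmod (mcoeff z \<alpha>))\<^sup>2 * (\<Prod>i\<in>UNIV. r i ^ \<alpha> i)\<^sup>2)"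
        using \<sigma>0 by (simp add: N)
    qed
    show ?thesis
      unfolding Q using mult_left_mono[OF torus_bound[OF x C r(1) rs, where N = N and y = y], of "\<sigma> ^ N"] \<sigma>0
      by (simp add: mult.left_commute)
  qed
  then have "eventually (\<lambda>\<sigma>. Q (x * y) \<sigma> \<le> C\<^sup>2 * Q y \<sigma>) (at_right \<tau>)"
    by (auto simp: eventually_at_filter)
  moreover have lim: "((\<lambda>\<sigma>. Q z \<sigma>) \<longlongrightarrow> Q z \<tau>) (at_right \<tau>)" for z
    unfolding Q_def by (intro tendsto_intros)
  ultimately have "Q (x * y) \<tau> \<le> C\<^sup>2 * Q y \<tau>"
    by (intro tendsto_le[OF _ tendsto_mult[OF tendsto_const lim] lim]) simp_all
  then show ?thesis by (simp add: Q_def \<tau>_def)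
qed

text \<open>
  The function \<open>exp (- t)\<close> for \<open>t \<ge> 0\<close>, extended by \<open>0\<close>.
\<close>

definition exp_weight :: "real \<Rightarrow> real" where
  "exp_weight = erlang_density 0 1"

lemma exp_weight_nonneg: "0 \<le> exp_weight t"
  by (simp add: exp_weight_def)

lemma exp_weight_neg: "t < 0 \<Longrightarrow> exp_weight t = 0"
  by (simp add: exp_weight_def erlang_density_def)

lemma exp_weight_moment:
  "has_bochner_integral lborel (\<lambda>t. exp_weight t * t ^ n) (fact n)"
proof (rule has_bochner_integral_nn_integral)
  show "(\<lambda>t. exp_weight t * t ^ n) \<in> borel_measurable lborel"
    unfolding exp_weight_def by simp
  show "AE t in lborel. 0 \<le> exp_weight t * t ^ n"
    by (rule AE_I2) (auto simp: exp_weight_def erlang_density_def)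
  show "(\<integral>\<^sup>+ t. ennreal (exp_weight t * t ^ n) \<partial>lborel) = ennreal (fact n)"
    unfolding exp_weight_def using nn_integral_erlang_ith_moment[of 1 0 n] by simp
qed simp

lemma multi_fact_upd: "multi_fact (\<alpha>(i := Suc (\<alpha> i))) = real (Suc (\<alpha> i)) * multi_fact \<alpha>"
proof -
  have "(\<Prod>k\<in>UNIV - {i}. fact ((\<alpha>(i := Suc (\<alpha> i))) k)) = (\<Prod>k\<in>UNIV - {i}. fact (\<alpha> k) :: real)"
    by (rule prod.cong) auto
  then show ?thesis
    unfolding multi_fact_def by (simp add: prod.remove[of UNIV i])
qed

lemma multi_size_upd: "multi_size (\<alpha>(i := Suc (\<alpha> i))) = Suc (multi_size \<alpha>)"
proof -
  have "(\<Sum>k\<in>UNIV - {i}. (\<alpha>(i := Suc (\<alpha> i))) k) = (\<Sum>k\<in>UNIV - {i}. \<alpha> k)"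
    by (rule sum.cong) auto
  then show ?thesis
    unfolding multi_size_def by (simp add: sum.remove[of UNIV i])
qed

text \<open>
  Multiplying by \<open>\<Sum>t\<^sub>i\<close> raises the exponents one at a time, which gives a recursion in \<open>m\<close>.
\<close>

lemma gamma_moment:
  fixes \<alpha> :: "'d::finite \<Rightarrow> nat"
  defines "q \<equiv> \<lambda>\<alpha> :: 'd \<Rightarrow> nat. multi_size \<alpha> + (CARD('d) - 1)"
  shows "has_bochner_integral (\<Pi>\<^sub>M i\<in>(UNIV :: 'd set). lborel)
    (\<lambda>t. (\<Prod>i\<in>UNIV. exp_weight (t i) * t i ^ \<alpha> i) * (\<Sum>i\<in>UNIV. t i) ^ m)
    (multi_fact \<alpha> * fact (q \<alpha> + m) / fact (q \<alpha>))"
proof (induction m arbitrary: \<alpha>)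
  case 0
  interpret product_sigma_finite "\<lambda>_ :: 'd. lborel :: real measure" by standard
  have int: "integrable lborel (\<lambda>t. exp_weight t * t ^ n)"
    and val: "(\<integral>t. exp_weight t * t ^ n \<partial>lborel) = fact n" for n
    using exp_weight_moment[of n] by (auto simp: has_bochner_integral_iff)
  show ?case
    unfolding has_bochner_integral_iff
    using product_integrable_prod[of UNIV "\<lambda>i t. exp_weight t * t ^ \<alpha> i"]
      product_integral_prod[of UNIV "\<lambda>i t. exp_weight t * t ^ \<alpha> i"]
    by (simp add: int val multi_fact_def)
next
  case (Suc m)
  define \<alpha>' where "\<alpha>' i = \<alpha>(i := Suc (\<alpha> i))" for i
  have q': "q (\<alpha>' i) = Suc (q \<alpha>)" for i
    by (simp add: q_def \<alpha>'_def multi_size_upd)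
  have up: "(\<Prod>k\<in>UNIV. exp_weight (t k) * t k ^ \<alpha>' i k) =
      (\<Prod>k\<in>UNIV. exp_weight (t k) * t k ^ \<alpha> k) * t i" for t i
  proof -
    have "(\<Prod>k\<in>UNIV - {i}. exp_weight (t k) * t k ^ \<alpha>' i k) =
        (\<Prod>k\<in>UNIV - {i}. exp_weight (t k) * t k ^ \<alpha> k)"
      by (rule prod.cong) (auto simp: \<alpha>'_def)
    then show ?thesis
      by (simp add: prod.remove[of UNIV i] \<alpha>'_def)
  qed
  have "has_bochner_integral (\<Pi>\<^sub>M i\<in>(UNIV :: 'd set). lborel)
      (\<lambda>t. \<Sum>i\<in>UNIV. (\<Prod>k\<in>UNIV. exp_weight (t k) * t k ^ \<alpha>' i k) * (\<Sum>k\<in>UNIV. t k) ^ m)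
      (\<Sum>i\<in>UNIV. multi_fact (\<alpha>' i) * fact (q (\<alpha>' i) + m) / fact (q (\<alpha>' i)))"
    by (intro has_bochner_integral_sum Suc.IH)
  moreover have "(\<Sum>i\<in>UNIV. (\<Prod>k\<in>UNIV. exp_weight (t k) * t k ^ \<alpha>' i k) * (\<Sum>k\<in>UNIV. t k) ^ m) =
      (\<Prod>k\<in>UNIV. exp_weight (t k) * t k ^ \<alpha> k) * (\<Sum>k\<in>UNIV. t k) ^ Suc m" for t
    unfolding up by (simp add: sum_distrib_left sum_distrib_right mult_ac)
  moreover have "(\<Sum>i\<in>UNIV. multi_fact (\<alpha>' i) * fact (q (\<alpha>' i) + m) / fact (q (\<alpha>' i))) =
      multi_fact \<alpha> * fact (q \<alpha> + Suc m) / fact (q \<alpha>)"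
  proof -
    have "(\<Sum>i\<in>UNIV. real (Suc (\<alpha> i))) = real (Suc (q \<alpha>))"
      by (simp add: q_def multi_size_def sum.distrib)
    moreover have F: "Suc (q \<alpha>) + m = q \<alpha> + Suc m" by simp
    ultimately have "(\<Sum>i\<in>UNIV. real (Suc (\<alpha> i))) * (multi_fact \<alpha> * fact (Suc (q \<alpha>) + m) / fact (Suc (q \<alpha>))) =
        multi_fact \<alpha> * fact (q \<alpha> + Suc m) / fact (q \<alpha>)"
      unfolding F fact_Suc[of "q \<alpha>"] by (simp del: of_nat_Suc fact_Suc)
    then show ?thesis
      unfolding q' by (simp only: \<alpha>'_def multi_fact_upd sum_distrib_right mult.assoc
          times_divide_eq_right sum_divide_distrib)
  qed
  ultimately show ?case by simp
qed

text \<open>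
  Integrating against \<open>exp (- \<Sum>t\<^sub>i)\<close> turns the inequality on tori into one for the weights of the
  Hardy space of the ball.
\<close>

lemma hardy_bound:
  fixes h :: "complex ^ 'd::finite \<Rightarrow> complex"
  assumes x: "expands x h" and C: "\<And>z. z \<in> unit_ball \<Longrightarrow> cmod (h z) \<le> C"
  defines "u \<equiv> \<lambda>\<alpha> :: 'd \<Rightarrow> nat. multi_fact \<alpha> / fact (multi_size \<alpha> + (CARD('d) - 1))"
  shows "(\<Sum>\<alpha>\<in>mball N. u \<alpha> * (cmod (mcoeff (x * y) \<alpha>))\<^sup>2)
    \<le> C\<^sup>2 * (\<Sum>\<alpha>\<in>mball N. u \<alpha> * (cmod (mcoeff y \<alpha>))\<^sup>2)"
proof -
  let ?M = "\<Pi>\<^sub>M i\<in>(UNIV :: 'd set). lborel :: real measure"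
  define W where "W t = (\<Prod>i\<in>UNIV. exp_weight (t i))" for t :: "'d \<Rightarrow> real"
  define S where "S z t = (\<Sum>\<alpha>\<in>mball N. (cmod (mcoeff z \<alpha>))\<^sup>2 *
      ((\<Prod>i\<in>UNIV. t i ^ \<alpha> i) * (\<Sum>i\<in>UNIV. t i) ^ (N - multi_size \<alpha>)))" for z and t :: "'d \<Rightarrow> real"
  have int: "has_bochner_integral ?M (\<lambda>t. W t * S z t)
      (fact (N + (CARD('d) - 1)) * (\<Sum>\<alpha>\<in>mball N. u \<alpha> * (cmod (mcoeff z \<alpha>))\<^sup>2))" for z
  proof -
    have "has_bochner_integral ?M
        (\<lambda>t. \<Sum>\<alpha>\<in>mball N. (cmod (mcoeff z \<alpha>))\<^sup>2 *
          ((\<Prod>i\<in>UNIV. exp_weight (t i) * t i ^ \<alpha> i) * (\<Sum>i\<in>UNIV. t i) ^ (N - multi_size \<alpha>)))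
        (\<Sum>\<alpha>\<in>mball N. (cmod (mcoeff z \<alpha>))\<^sup>2 *
          (multi_fact \<alpha> * fact (multi_size \<alpha> + (CARD('d) - 1) + (N - multi_size \<alpha>))
            / fact (multi_size \<alpha> + (CARD('d) - 1))))"
      by (intro has_bochner_integral_sum has_bochner_integral_mult_right gamma_moment)
    moreover have "(\<Sum>\<alpha>\<in>mball N. (cmod (mcoeff z \<alpha>))\<^sup>2 *
          ((\<Prod>i\<in>UNIV. exp_weight (t i) * t i ^ \<alpha> i) * (\<Sum>i\<in>UNIV. t i) ^ (N - multi_size \<alpha>))) = W t * S z t"
      for t
      unfolding W_def S_def prod.distrib sum_distrib_left by (simp only: mult_ac)
    moreover have "(\<Sum>\<alpha>\<in>mball N. (cmod (mcoeff z \<alpha>))\<^sup>2 *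
          (multi_fact \<alpha> * fact (multi_size \<alpha> + (CARD('d) - 1) + (N - multi_size \<alpha>))
            / fact (multi_size \<alpha> + (CARD('d) - 1)))) =
        fact (N + (CARD('d) - 1)) * (\<Sum>\<alpha>\<in>mball N. u \<alpha> * (cmod (mcoeff z \<alpha>))\<^sup>2)"
      unfolding sum_distrib_left
    proof (rule sum.cong[OF refl])
      fix \<alpha> :: "'d \<Rightarrow> nat" assume "\<alpha> \<in> mball N"
      then have "multi_size \<alpha> \<le> N" by (simp add: mball_def)
      then have "multi_size \<alpha> + (CARD('d) - 1) + (N - multi_size \<alpha>) = N + (CARD('d) - 1)"
        by arith
      then show "(cmod (mcoeff z \<alpha>))\<^sup>2 *
          (multi_fact \<alpha> * fact (multi_size \<alpha> + (CARD('d) - 1) + (N - multi_size \<alpha>))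
            / fact (multi_size \<alpha> + (CARD('d) - 1))) =
          fact (N + (CARD('d) - 1)) * (u \<alpha> * (cmod (mcoeff z \<alpha>))\<^sup>2)"
        by (simp add: u_def)
    qed
    ultimately show ?thesis by simp
  qed
  have "W t * S (x * y) t \<le> C\<^sup>2 * (W t * S y t)" for t
  proof (cases "\<forall>i. 0 \<le> t i")
    case True
    have "W t \<ge> 0" unfolding W_def by (intro prod_nonneg) (simp add: exp_weight_nonneg)
    moreover have "S (x * y) t \<le> C\<^sup>2 * S y t"
      unfolding S_def by (rule homogeneous_torus_bound[OF x C]) (use True in auto)
    ultimately show ?thesis
      using mult_left_mono[of "S (x * y) t" "C\<^sup>2 * S y t" "W t"] by (simp add: mult.left_commute)
  next
    case False
    then obtain i where "t i < 0" by (auto simp: not_le)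
    then have "W t = 0" unfolding W_def by (intro prod_zero) (auto intro: exp_weight_neg)
    then show ?thesis by simp
  qed
  then have "(\<integral>t. W t * S (x * y) t \<partial>?M) \<le> (\<integral>t. C\<^sup>2 * (W t * S y t) \<partial>?M)"
    using int[of "x * y"] has_bochner_integral_mult_right[OF int[of y], of "C\<^sup>2"]
    by (intro integral_mono) (auto simp: has_bochner_integral_iff)
  then have "fact (N + (CARD('d) - 1)) * (\<Sum>\<alpha>\<in>mball N. u \<alpha> * (cmod (mcoeff (x * y) \<alpha>))\<^sup>2)
      \<le> fact (N + (CARD('d) - 1)) * (C\<^sup>2 * (\<Sum>\<alpha>\<in>mball N. u \<alpha> * (cmod (mcoeff y \<alpha>))\<^sup>2))"
    unfolding has_bochner_integral_integral_eq[OF int]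
      has_bochner_integral_integral_eq[OF has_bochner_integral_mult_right[OF int]]
    by (simp only: mult.left_commute)
  then show ?thesis
    by (rule mult_left_le_imp_le) simp
qed

lemma decseq_hardy_ratio:
  assumes d: "d > 0"
  shows "decseq (\<lambda>n. fact (n + (d - 1)) / fact n / (1 + real n) ^ (2 * d))"
proof (rule decseq_SucI)
  fix n
  define k where "k = 1 + real n"
  have k: "k > 0" by (simp add: k_def)
  have "1 + real (2 * d) * (1 / k) \<le> (1 + 1 / k) ^ (2 * d)"
    by (rule Bernoulli_inequality) (use zero_less_divide_1_iff[of k] k in linarith)
  then have "k ^ (2 * d) * (1 + real (2 * d) / k) \<le> (k * (1 + 1 / k)) ^ (2 * d)"
    using k unfolding power_mult_distrib by (intro mult_left_mono) auto
  moreover have "(real n + real d) / k \<le> 1 + real (2 * d) / k"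
    using k by (simp add: field_simps k_def)
  ultimately have key: "(real n + real d) / k * k ^ (2 * d) \<le> (k + 1) ^ (2 * d)"
    using k mult_left_mono[of "(real n + real d) / k" "1 + real (2 * d) / k" "k ^ (2 * d)"]
    by (simp add: distrib_left mult.commute)
  obtain e where e: "d = Suc e" using d by (cases d) auto
  have eq: "fact (Suc n + (d - 1)) / fact (Suc n) = (real n + real d) / k * (fact (n + (d - 1)) / fact n)"
    by (simp add: e k_def field_simps)
  have k1: "1 + real (Suc n) = k + 1" by (simp add: k_def)
  have "fact (Suc n + (d - 1)) / fact (Suc n) / (1 + real (Suc n)) ^ (2 * d) =
      fact (n + (d - 1)) / fact n / k ^ (2 * d) * ((real n + real d) / k * k ^ (2 * d) / (k + 1) ^ (2 * d))"
    unfolding eq k1 using k by (simp add: mult_ac)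
  also have "\<dots> \<le> fact (n + (d - 1)) / fact n / k ^ (2 * d) * 1"
  proof (rule mult_left_mono)
    have "(k + 1) ^ (2 * d) > 0" using k by simp
    then show "(real n + real d) / k * k ^ (2 * d) / (k + 1) ^ (2 * d) \<le> 1"
      using key by (simp only: divide_le_eq_1_pos)
    show "0 \<le> fact (n + (d - 1)) / fact n / k ^ (2 * d)"
      using k by (intro divide_nonneg_nonneg) auto
  qed
  finally show "fact (Suc n + (d - 1)) / fact (Suc n) / (1 + real (Suc n)) ^ (2 * d)
      \<le> fact (n + (d - 1)) / fact n / (1 + real n) ^ (2 * d)"
    by (simp add: k_def)
qed

text \<open>
  Relative to the weights of the Hardy space, the weight of index \<open>CARD('d)\<close> decreases with the degree,
  so summation by parts carries the Hardy space bound over.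
\<close>

theorem H_infty_mult_bounded:
  fixes h :: "complex ^ 'd::finite \<Rightarrow> complex"
  assumes x: "expands x h" and C: "\<And>z. z \<in> unit_ball \<Longrightarrow> cmod (h z) \<le> C" and C0: "0 \<le> C"
  shows "mult_bounded (CARD('d)) x C"
  by (rule mult_boundedI_abel[OF C0 hardy_bound[OF x C] decseq_hardy_ratio[OF zero_less_card_finite[where 'a = 'd]]])
    (simp_all add: weight_def)

section \<open>Square summable functions of words\<close>

definition ell2 :: "('a \<Rightarrow> complex) \<Rightarrow> bool" where
  "ell2 v \<longleftrightarrow> (\<lambda>u. (cmod (v u))\<^sup>2) summable_on UNIV"

definition sq_norm :: "('a \<Rightarrow> complex) \<Rightarrow> real" where
  "sq_norm v = (\<Sum>\<^sub>\<infinity>u. (cmod (v u))\<^sup>2)"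

definition inner2 :: "('a \<Rightarrow> complex) \<Rightarrow> ('a \<Rightarrow> complex) \<Rightarrow> complex" where
  "inner2 v w = (\<Sum>\<^sub>\<infinity>u. v u * cnj (w u))"

lemma sq_norm_has_sum: "ell2 v \<Longrightarrow> ((\<lambda>u. (cmod (v u))\<^sup>2) has_sum sq_norm v) UNIV"
  by (simp add: ell2_def sq_norm_def)

lemma sq_norm_nonneg: "0 \<le> sq_norm v"
  unfolding sq_norm_def by (rule infsum_nonneg) simp

lemma inner2_has_sum:
  assumes "ell2 v" and "ell2 w"
  shows "((\<lambda>u. v u * cnj (w u)) has_sum inner2 v w) UNIV"
proof -
  have "(\<lambda>u. cmod (v u * cnj (w u))) summable_on UNIV"
    by (rule Infinite_Sum.abs_summable_product)
      (use assms in \<open>simp_all add: ell2_def norm_mult power2_eq_square\<close>)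
  then have "(\<lambda>u. v u * cnj (w u)) summable_on UNIV"
    by (rule Infinite_Sum.abs_summable_summable)
  then show ?thesis by (simp add: inner2_def)
qed

lemma add_unit_multiple:
  fixes v F :: "'a \<Rightarrow> complex" and s :: complex
  assumes v: "ell2 v" and F: "ell2 F" "sq_norm F = 1"
  defines "w \<equiv> \<lambda>u. v u + s * F u"
  shows "ell2 w" "sq_norm w = sq_norm v + 2 * Re (cnj s * inner2 v F) + (cmod s)\<^sup>2"
    "inner2 w F = inner2 v F + s"
proof -
  have "((\<lambda>u. (cmod (v u))\<^sup>2 + 2 * Re (cnj s * (v u * cnj (F u))) + (cmod s)\<^sup>2 * (cmod (F u))\<^sup>2)
      has_sum sq_norm v + 2 * Re (cnj s * inner2 v F) + (cmod s)\<^sup>2 * sq_norm F) UNIV"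
    by (intro has_sum_add has_sum_cmult_right has_sum_Re sq_norm_has_sum inner2_has_sum v F)
  moreover have "(cmod (v u))\<^sup>2 + 2 * Re (cnj s * (v u * cnj (F u))) + (cmod s)\<^sup>2 * (cmod (F u))\<^sup>2
      = (cmod (w u))\<^sup>2" for u
    unfolding w_def cmod_power2 by (simp add: power2_eq_square algebra_simps)
  ultimately have *: "((\<lambda>u. (cmod (w u))\<^sup>2)
      has_sum sq_norm v + 2 * Re (cnj s * inner2 v F) + (cmod s)\<^sup>2) UNIV"
    using F(2) by simp
  then show w: "ell2 w" by (auto simp: ell2_def summable_on_def)
  show "sq_norm w = sq_norm v + 2 * Re (cnj s * inner2 v F) + (cmod s)\<^sup>2"
    using * sq_norm_has_sum[OF w] has_sum_unique by blast
  have FF: "inner2 F F = 1"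
  proof -
    have "((\<lambda>u. complex_of_real ((cmod (F u))\<^sup>2)) has_sum of_real 1) UNIV"
      using sq_norm_has_sum[OF F(1)] F(2) by (simp only: has_sum_of_real_iff)
    then have "((\<lambda>u. F u * cnj (F u)) has_sum 1) UNIV"
      by (simp only: complex_norm_square of_real_1)
    then show ?thesis using inner2_has_sum[OF F(1) F(1)] has_sum_unique by blast
  qed
  have "((\<lambda>u. v u * cnj (F u) + s * (F u * cnj (F u))) has_sum inner2 v F + s * inner2 F F) UNIV"
    by (intro has_sum_add has_sum_cmult_right inner2_has_sum v F)
  then have "((\<lambda>u. w u * cnj (F u)) has_sum inner2 v F + s) UNIV"
    by (simp add: w_def FF algebra_simps)
  then show "inner2 w F = inner2 v F + s"
    using inner2_has_sum[OF w F(1)] has_sum_unique by blast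
qed

lemma ell2_Cons:
  assumes "ell2 v"
  shows "ell2 (\<lambda>u. v (i # u))"
proof -
  have "(\<lambda>u. (cmod (v u))\<^sup>2) summable_on range (Cons i)"
    by (rule summable_on_subset_banach[OF assms[unfolded ell2_def]]) simp
  then show ?thesis
    by (subst (asm) summable_on_reindex) (auto simp: ell2_def o_def inj_on_def)
qed

lemma sq_norm_Cons:
  fixes v :: "'a::finite list \<Rightarrow> complex"
  assumes v: "ell2 v"
  shows "sq_norm v = (cmod (v []))\<^sup>2 + (\<Sum>i\<in>UNIV. sq_norm (\<lambda>u. v (i # u)))"
proof -
  have "((\<lambda>u. (cmod (v u))\<^sup>2) has_sum sq_norm v - (cmod (v []))\<^sup>2) (UNIV - {[]})"
    by (rule has_sum_Diff[OF sq_norm_has_sum[OF v]]) (auto intro: has_sum_finiteI)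
  moreover have "((\<lambda>u. (cmod (v u))\<^sup>2) has_sum sq_norm v - (cmod (v []))\<^sup>2) (UNIV - {[]}) =
      ((\<lambda>(i, u). (cmod (v (i # u)))\<^sup>2) has_sum sq_norm v - (cmod (v []))\<^sup>2) (UNIV \<times> UNIV)"
    by (rule has_sum_reindex_bij_witness[where i = "\<lambda>(i, u). i # u" and j = "\<lambda>u. (hd u, tl u)"]) auto
  ultimately have "((\<lambda>(i, u). (cmod (v (i # u)))\<^sup>2) has_sum sq_norm v - (cmod (v []))\<^sup>2) (UNIV \<times> UNIV)"
    by simp
  then have "((\<lambda>i. sq_norm (\<lambda>u. v (i # u))) has_sum sq_norm v - (cmod (v []))\<^sup>2) UNIV"
    by (rule has_sum_SigmaD) (use sq_norm_has_sum[OF ell2_Cons[OF v]] in auto)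
  then show ?thesis by (simp add: has_sum_finite_iff)
qed

lemma has_sum_sum_finite:
  fixes f :: "'i \<Rightarrow> 'a \<Rightarrow> complex"
  assumes "\<And>k. k \<in> I \<Longrightarrow> (f k has_sum S k) A"
  shows "((\<lambda>u. \<Sum>k\<in>I. f k u) has_sum (\<Sum>k\<in>I. S k)) A"
  using assms by (induction I rule: infinite_finite_induct) (auto intro: has_sum_add)

section \<open>An energy-preserving recursion\<close>

text \<open>
  A state is a square summable function of words. Reading the letter \<open>i\<close> shifts the state, replaces
  its component along the unit vector \<open>F\<close> by the input \<open>q\<close>, and emits the component removed.
\<close>

primrec state :: "('a list \<Rightarrow> complex) \<Rightarrow> ('a list \<Rightarrow> complex) \<Rightarrow> 'a list \<Rightarrow> 'a list \<Rightarrow> complex" where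
  "state F q [] = (\<lambda>u. q [] * F u)"
| "state F q (i # w) = (\<lambda>u. state F q w (i # u) +
      (q (i # w) - inner2 (\<lambda>u. state F q w (i # u)) F) * F u)"

definition emitted :: "('a list \<Rightarrow> complex) \<Rightarrow> ('a list \<Rightarrow> complex) \<Rightarrow> 'a list \<Rightarrow> complex" where
  "emitted F q w = (case w of [] \<Rightarrow> 0 | i # w \<Rightarrow> inner2 (\<lambda>u. state F q w (i # u)) F)"

definition words :: "nat \<Rightarrow> 'a list set" where
  "words n = {w. length w = n}"

definition words_upto :: "nat \<Rightarrow> 'a list set" where
  "words_upto n = {w. length w \<le> n}"

lemma finite_words [simp]: "finite (words n :: 'a::finite list set)"
  using finite_lists_length_eq[of "UNIV :: 'a set" n] by (simp add: words_def)

lemma finite_words_upto [simp]: "finite (words_upto n :: 'a::finite list set)"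
  using finite_lists_length_le[of "UNIV :: 'a set" n] by (simp add: words_upto_def)

lemma sum_words_Suc:
  fixes f :: "'a::finite list \<Rightarrow> 'b::comm_monoid_add"
  shows "sum f (words (Suc n)) = (\<Sum>w\<in>words n. \<Sum>i\<in>UNIV. f (i # w))"
proof -
  have "sum f (words (Suc n)) = (\<Sum>(w, i)\<in>words n \<times> UNIV. f (i # w))"
    by (rule sum.reindex_bij_witness[where i = "\<lambda>(w, i). i # w" and j = "\<lambda>w. (tl w, hd w)"])
      (auto simp: words_def length_Suc_conv)
  then show ?thesis by (simp add: sum.cartesian_product)
qed

lemma sum_words_upto_Suc:
  fixes f :: "'a::finite list \<Rightarrow> 'b::comm_monoid_add"
  shows "sum f (words_upto (Suc n)) = sum f (words_upto n) + sum f (words (Suc n))"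
proof -
  have "words_upto (Suc n) = words_upto n \<union> (words (Suc n) :: 'a list set)"
    by (auto simp: words_upto_def words_def)
  then show ?thesis
    by (simp only:) (rule sum.union_disjoint[OF finite_words_upto finite_words],
        auto simp: words_upto_def words_def)
qed

context
  fixes F :: "'a::finite list \<Rightarrow> complex"
  assumes F: "ell2 F" "sq_norm F = 1"
begin

lemma state_ell2: "ell2 (state F q w)" and state_inner2: "inner2 (state F q w) F = q w"
proof -
  have "ell2 (state F q w) \<and> inner2 (state F q w) F = q w"
  proof (induction w)
    case Nil
    have z: "ell2 (\<lambda>_ :: 'a list. 0 :: complex)" "inner2 (\<lambda>_. 0) F = 0"
      by (simp_all add: ell2_def inner2_def)
    show ?case
      using add_unit_multiple(1,3)[OF z(1) F, of "q []"] z(2) by simp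
  next
    case (Cons i w)
    then show ?case
      using add_unit_multiple(1,3)[OF ell2_Cons[of "state F q w" i] F,
          of "q (i # w) - inner2 (\<lambda>u. state F q w (i # u)) F"] by simp
  qed
  then show "ell2 (state F q w)" "inner2 (state F q w) F = q w" by auto
qed

lemma sq_norm_state_Nil: "sq_norm (state F q []) = (cmod (q []))\<^sup>2"
proof -
  have z: "ell2 (\<lambda>_ :: 'a list. 0 :: complex)" "inner2 (\<lambda>_. 0) F = 0" "sq_norm (\<lambda>_ :: 'a list. 0) = 0"
    by (simp_all add: ell2_def inner2_def sq_norm_def)
  show ?thesis
    using add_unit_multiple(2)[OF z(1) F, of "q []"] z(2,3) by simp
qed

lemma sq_norm_state_Cons:
  "sq_norm (state F q (i # w)) =
    sq_norm (\<lambda>u. state F q w (i # u)) + (cmod (q (i # w)))\<^sup>2 - (cmod (emitted F q (i # w)))\<^sup>2"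
proof -
  define e where "e = inner2 (\<lambda>u. state F q w (i # u)) F"
  have "2 * Re (cnj (q (i # w) - e) * e) + (cmod (q (i # w) - e))\<^sup>2 =
      (cmod (q (i # w)))\<^sup>2 - (cmod e)\<^sup>2"
    unfolding cmod_power2 by (simp add: power2_eq_square algebra_simps)
  then show ?thesis
    using add_unit_multiple(2)[OF ell2_Cons[OF state_ell2[of q w], of i] F, of "q (i # w) - e"]
    by (simp add: emitted_def e_def)
qed

text \<open>
  Pythagoras, twice: the norm of a state is shared between its value at the empty word and its shifts by
  the letters, and that of a shift between its component along \<open>F\<close> and the rest. Hence the outputs
  carry off what the inputs have brought in, up to the energy still stored, and summation over all
  words up to a given length telescopes.
\<close>

lemma energy_step:
  "(\<Sum>i\<in>UNIV. sq_norm (state F q (i # w)) - (cmod (q (i # w)))\<^sup>2 + (cmod (emitted F q (i # w)))\<^sup>2)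
    + (cmod (state F q w []))\<^sup>2 = sq_norm (state F q w)"
  unfolding sq_norm_state_Cons using sq_norm_Cons[OF state_ell2, of q w] by (simp del: state.simps)

lemma energy_balance:
  "(\<Sum>w\<in>words_upto N. (cmod (emitted F q w))\<^sup>2) + (\<Sum>w\<in>words_upto N. (cmod (state F q w []))\<^sup>2)
    + (\<Sum>w\<in>words N. sq_norm (state F q w) - (cmod (state F q w []))\<^sup>2)
    = (\<Sum>w\<in>words_upto N. (cmod (q w))\<^sup>2)"
proof (induction N)
  case 0
  have "words_upto 0 = {[] :: 'a list}" "words 0 = {[] :: 'a list}"
    by (auto simp: words_upto_def words_def)
  then show ?case by (simp add: emitted_def sq_norm_state_Nil del: state.simps)
next
  case (Suc N)
  have "(\<Sum>w\<in>words N. sq_norm (state F q w) - (cmod (state F q w []))\<^sup>2) =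
      (\<Sum>w\<in>words N. \<Sum>i\<in>UNIV. sq_norm (state F q (i # w)) - (cmod (q (i # w)))\<^sup>2
        + (cmod (emitted F q (i # w)))\<^sup>2)"
    by (rule sum.cong) (use energy_step[of q] in \<open>auto simp: algebra_simps\<close>)
  also have "\<dots> = (\<Sum>w\<in>words (Suc N). sq_norm (state F q w) - (cmod (q w))\<^sup>2 + (cmod (emitted F q w))\<^sup>2)"
    by (rule sum_words_Suc[symmetric])
  finally have "(\<Sum>w\<in>words N. sq_norm (state F q w) - (cmod (state F q w []))\<^sup>2) = \<dots>" .
  then show ?case
    using Suc by (simp add: sum_words_upto_Suc sum.distrib sum_subtractf del: state.simps)
qed

lemma energy_inequality:
  "(\<Sum>w\<in>words_upto N. (cmod (emitted F q w))\<^sup>2) + (\<Sum>w\<in>words_upto N. (cmod (state F q w []))\<^sup>2)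
    \<le> (\<Sum>w\<in>words_upto N. (cmod (q w))\<^sup>2)"
proof -
  have "0 \<le> sq_norm (state F q w) - (cmod (state F q w []))\<^sup>2" for w
    unfolding sq_norm_Cons[OF state_ell2, of q w] by (simp add: sum_nonneg sq_norm_nonneg)
  then have "0 \<le> (\<Sum>w\<in>words N. sq_norm (state F q w) - (cmod (state F q w []))\<^sup>2)"
    by (rule sum_nonneg)
  then show ?thesis using energy_balance[where N = N and q = q] by linarith
qed

text \<open>
  Unrolled, the recursion is a convolution of \<open>q - emitted F q\<close> with \<open>F\<close>, and so is the output at the
  empty word. By the next lemma the input itself is a convolution of the same factor with the
  autocorrelation of \<open>F\<close>. Once the letters commute, the common factor can be eliminated.
\<close>

lemma state_expand:
  "state F q w u = (\<Sum>k\<le>length w. (q (drop k w) - emitted F q (drop k w)) * F (rev (take k w) @ u))"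
proof (induction w arbitrary: u)
  case Nil
  then show ?case by (simp add: emitted_def)
next
  case (Cons i w)
  have "state F q (i # w) u = (q (i # w) - emitted F q (i # w)) * F u + state F q w (i # u)"
    by (simp add: emitted_def)
  then show ?case
    unfolding Cons length_Cons sum.atMost_Suc_shift by (simp del: state.simps)
qed

lemma input_expand:
  "q w = (\<Sum>k\<le>length w. (q (drop k w) - emitted F q (drop k w)) * inner2 (\<lambda>u. F (rev (take k w) @ u)) F)"
proof -
  have el: "ell2 (\<lambda>u. F (a @ u))" for a
  proof (induction a rule: rev_induct)
    case (snoc i a)
    from ell2_Cons[OF this, of i] show ?case by simp
  qed (simp add: F)
  have "((\<lambda>u. \<Sum>k\<le>length w. (q (drop k w) - emitted F q (drop k w)) * (F (rev (take k w) @ u) * cnj (F u)))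
      has_sum (\<Sum>k\<le>length w. (q (drop k w) - emitted F q (drop k w)) * inner2 (\<lambda>u. F (rev (take k w) @ u)) F)) UNIV"
    by (intro has_sum_sum_finite has_sum_cmult_right inner2_has_sum el F)
  then have "((\<lambda>u. state F q w u * cnj (F u))
      has_sum (\<Sum>k\<le>length w. (q (drop k w) - emitted F q (drop k w)) * inner2 (\<lambda>u. F (rev (take k w) @ u)) F)) UNIV"
    by (simp add: state_expand sum_distrib_right mult.assoc)
  from has_sum_unique[OF this inner2_has_sum[OF state_ell2 F(1)]] show ?thesis
    by (simp add: state_inner2)
qed

end

section \<open>Abelianization\<close>

definition letter_count :: "'a list \<Rightarrow> 'a \<Rightarrow> nat" where
  "letter_count w = (\<lambda>i. count_list w i)"

lemma letter_count_simps [simp]: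
  "letter_count (v @ w) = letter_count v + letter_count w"
  "letter_count (rev w) = letter_count w"
  by (auto simp: letter_count_def fun_eq_iff)

lemma multi_size_letter_count [simp]: "multi_size (letter_count w) = length (w :: 'a::finite list)"
  unfolding multi_size_def letter_count_def by (rule sum_count_set) auto

lemma letter_count_eq_0_iff [simp]: "letter_count w = 0 \<longleftrightarrow> w = ([] :: 'a::finite list)"
proof
  assume "letter_count w = 0"
  then have "multi_size (letter_count w) = 0" by simp
  then show "w = []" by simp
qed (simp add: letter_count_def fun_eq_iff)

definition arrangements :: "('a::finite \<Rightarrow> nat) \<Rightarrow> 'a list set" where
  "arrangements \<alpha> = {w. letter_count w = \<alpha>}"

lemma finite_arrangements [simp]: "finite (arrangements \<alpha>)"
  by (rule finite_subset[OF _ finite_words[of "multi_size \<alpha>"]]) (auto simp: arrangements_def words_def)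

lemma card_arrangements: "real (card (arrangements \<alpha>)) * weight 0 \<alpha> = 1"
proof -
  define A where "A = Abs_multiset \<alpha>"
  have cA: "count A = \<alpha>" unfolding A_def by (rule count_Abs_multiset) simp
  have "arrangements \<alpha> = permutations_of_multiset A"
    by (auto simp: arrangements_def permutations_of_multiset_def letter_count_def
        multiset_eq_iff cA fun_eq_iff count_mset)
  moreover have "(\<Prod>x\<in>set_mset A. fact (count A x)) = (\<Prod>x\<in>UNIV. fact (\<alpha> x) :: nat)"
    by (rule prod.mono_neutral_cong_left) (auto simp: cA set_mset_def)
  moreover have "size A = multi_size \<alpha>"
    unfolding size_multiset_overloaded_eq multi_size_def
    by (rule sum.mono_neutral_cong_left) (auto simp: cA set_mset_def)
  ultimately have "card (arrangements \<alpha>) * (\<Prod>x\<in>UNIV. fact (\<alpha> x)) = (fact (multi_size \<alpha>) :: nat)"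
    using card_permutations_of_multiset_aux[of A] by simp
  then have "real (card (arrangements \<alpha>) * (\<Prod>x\<in>UNIV. fact (\<alpha> x))) = real (fact (multi_size \<alpha>))"
    by (simp only:)
  then show ?thesis
    by (simp add: weight_def multi_fact_def)
qed

text \<open>
  Letting the letters commute turns a function of words into a power series. Each monomial has many
  arrangements, and \<open>word_lift\<close> spreads its coefficient evenly over them; this is the preimage of least
  norm, and it is what makes the Drury-Arveson space a quotient of the space of square summable
  functions of words.
\<close>

definition abelianize :: "('a::finite list \<Rightarrow> complex) \<Rightarrow> 'a mpow" where
  "abelianize p = Mpow (\<lambda>\<alpha>. \<Sum>w\<in>arrangements \<alpha>. p w)"

definition word_lift :: "'a::finite mpow \<Rightarrow> 'a list \<Rightarrow> complex" where
  "word_lift x w = of_real (weight 0 (letter_count w)) * mcoeff x (letter_count w)"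

lemma abelianize_diff: "abelianize (\<lambda>w. p w - q w) = abelianize p - abelianize q"
  by (rule mpow_eqI) (simp add: abelianize_def sum_subtractf)

lemma abelianize_unit: "abelianize (\<lambda>w. if w = [] then 1 else 0) = 1"
proof (rule mpow_eqI)
  fix \<alpha> :: "'a \<Rightarrow> nat"
  have "[] \<in> arrangements \<alpha> \<longleftrightarrow> \<alpha> = 0"
    using letter_count_eq_0_iff[of "[] :: 'a list"] by (auto simp: arrangements_def)
  then show "mcoeff (abelianize (\<lambda>w. if w = [] then 1 else 0)) \<alpha> = mcoeff 1 \<alpha>"
    by (simp add: abelianize_def mcoeff_1 sum.delta)
qed

lemma abelianize_lift: "abelianize (word_lift x) = x"
proof (rule mpow_eqI)
  fix \<alpha> :: "'a \<Rightarrow> nat"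
  have "mcoeff (abelianize (word_lift x)) \<alpha> = (\<Sum>w\<in>arrangements \<alpha>. of_real (weight 0 \<alpha>) * mcoeff x \<alpha>)"
    unfolding abelianize_def mcoeff_Mpow by (rule sum.cong) (auto simp: arrangements_def word_lift_def)
  also have "\<dots> = of_real (real (card (arrangements \<alpha>)) * weight 0 \<alpha>) * mcoeff x \<alpha>"
    by simp
  finally show "mcoeff (abelianize (word_lift x)) \<alpha> = mcoeff x \<alpha>"
    unfolding card_arrangements by simp
qed

lemma abelianize_convolution:
  "abelianize (\<lambda>w. \<Sum>k\<le>length w. p (drop k w) * r (take k w)) = abelianize p * abelianize r"
proof (rule mpow_eqI)
  fix \<alpha> :: "'a \<Rightarrow> nat"
  have lc: "letter_count (drop k w) + letter_count (take k w) = letter_count w" for k and w :: "'a list"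
    by (metis letter_count_simps(1) append_take_drop_id add.commute)
  have "mcoeff (abelianize p * abelianize r) \<alpha> =
      (\<Sum>b\<in>splits \<alpha>. \<Sum>c\<in>arrangements (fst b) \<times> arrangements (snd b). p (fst c) * r (snd c))"
    unfolding mcoeff_mult abelianize_def mcoeff_Mpow
    by (rule sum.cong) (auto simp: sum_product sum.cartesian_product case_prod_unfold)
  also have "\<dots> = (\<Sum>(b, c)\<in>Sigma (splits \<alpha>) (\<lambda>b. arrangements (fst b) \<times> arrangements (snd b)).
      p (fst c) * r (snd c))"
    by (rule sum.Sigma) auto
  also have "\<dots> = (\<Sum>(w, k)\<in>Sigma (arrangements \<alpha>) (\<lambda>w. {..length w}). p (drop k w) * r (take k w))"
    by (rule sum.reindex_bij_witness
        [where i = "\<lambda>(w, k). ((letter_count (drop k w), letter_count (take k w)), (drop k w, take k w))"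
           and j = "\<lambda>(b, c). (snd c @ fst c, length (snd c))"])
      (auto simp: arrangements_def splits_def add.commute lc)
  also have "\<dots> = mcoeff (abelianize (\<lambda>w. \<Sum>k\<le>length w. p (drop k w) * r (take k w))) \<alpha>"
    unfolding abelianize_def mcoeff_Mpow by (rule sum.Sigma[symmetric]) auto
  finally show "mcoeff (abelianize (\<lambda>w. \<Sum>k\<le>length w. p (drop k w) * r (take k w))) \<alpha> =
      mcoeff (abelianize p * abelianize r) \<alpha>" by simp
qed

lemma sum_words_upto_group:
  fixes f :: "'a::finite list \<Rightarrow> 'b::comm_monoid_add"
  shows "(\<Sum>w\<in>words_upto N. f w) = (\<Sum>\<alpha>\<in>mball N. \<Sum>w\<in>arrangements \<alpha>. f w)"
proof -
  have "(\<Sum>\<alpha>\<in>mball N. \<Sum>w\<in>arrangements \<alpha>. f w) = (\<Sum>(\<alpha>, w)\<in>Sigma (mball N) arrangements. f w)"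
    by (rule sum.Sigma) auto
  also have "\<dots> = (\<Sum>w\<in>words_upto N. f w)"
    by (rule sum.reindex_bij_witness[where i = "\<lambda>w. (letter_count w, w)" and j = snd])
      (auto simp: arrangements_def mball_def words_upto_def)
  finally show ?thesis by simp
qed

lemma word_lift_norm:
  "(\<Sum>w\<in>words_upto N. (cmod (word_lift x w))\<^sup>2) = (trunc_norm 0 N x)\<^sup>2"
  unfolding sum_words_upto_group trunc_norm_power2
proof (rule sum.cong[OF refl])
  fix \<alpha> :: "'a \<Rightarrow> nat"
  have "(\<Sum>w\<in>arrangements \<alpha>. (cmod (word_lift x w))\<^sup>2) =
      (\<Sum>w\<in>arrangements \<alpha>. (weight 0 \<alpha>)\<^sup>2 * (cmod (mcoeff x \<alpha>))\<^sup>2)"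
    by (rule sum.cong) (auto simp: arrangements_def word_lift_def norm_mult power_mult_distrib)
  also have "\<dots> = (real (card (arrangements \<alpha>)) * weight 0 \<alpha>) * (weight 0 \<alpha> * (cmod (mcoeff x \<alpha>))\<^sup>2)"
    by (simp add: power2_eq_square)
  finally show "(\<Sum>w\<in>arrangements \<alpha>. (cmod (word_lift x w))\<^sup>2) = weight 0 \<alpha> * (cmod (mcoeff x \<alpha>))\<^sup>2"
    unfolding card_arrangements by simp
qed

lemma abelianize_norm:
  "(trunc_norm 0 N (abelianize p))\<^sup>2 \<le> (\<Sum>w\<in>words_upto N. (cmod (p w))\<^sup>2)"
  unfolding sum_words_upto_group trunc_norm_power2
proof (rule sum_mono)
  fix \<alpha> :: "'a \<Rightarrow> nat"
  have "cmod (\<Sum>w\<in>arrangements \<alpha>. p w) \<le> (\<Sum>w\<in>arrangements \<alpha>. cmod (p w))"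
    by (rule norm_sum)
  then have "(cmod (\<Sum>w\<in>arrangements \<alpha>. p w))\<^sup>2 \<le> (\<Sum>w\<in>arrangements \<alpha>. cmod (p w))\<^sup>2"
    by (rule power_mono) simp
  also have "\<dots> \<le> real (card (arrangements \<alpha>)) * (\<Sum>w\<in>arrangements \<alpha>. (cmod (p w))\<^sup>2)"
    using sum_squared_le_sum_of_squares[of "\<lambda>w. cmod (p w)" "arrangements \<alpha>"] by (simp add: mult.commute)
  finally have "weight 0 \<alpha> * (cmod (\<Sum>w\<in>arrangements \<alpha>. p w))\<^sup>2 \<le>
      weight 0 \<alpha> * (real (card (arrangements \<alpha>)) * (\<Sum>w\<in>arrangements \<alpha>. (cmod (p w))\<^sup>2))"
    by (rule mult_left_mono) simp
  also have "\<dots> = (real (card (arrangements \<alpha>)) * weight 0 \<alpha>) * (\<Sum>w\<in>arrangements \<alpha>. (cmod (p w))\<^sup>2)"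
    by (simp only: mult_ac)
  finally show "weight 0 \<alpha> * (cmod (mcoeff (abelianize p) \<alpha>))\<^sup>2 \<le> (\<Sum>w\<in>arrangements \<alpha>. (cmod (p w))\<^sup>2)"
    unfolding card_arrangements by (simp add: abelianize_def)
qed

text \<open>
  Let \<open>F\<close> be the unit vector in the direction of the lift of \<open>x\<close>, and let \<open>U\<close> be the abelianized
  autocorrelation of \<open>F\<close>, a series with constant term \<open>1\<close>. Its inverse \<open>t\<close> is the denominator: for an
  input that lifts \<open>y\<close>, the emitted sequence abelianizes to \<open>(1 - t) y\<close> and the output at the empty word
  to a multiple of \<open>t x y\<close>, and the energy inequality bounds both by the norm of \<open>y\<close>.
\<close>

theorem exists_denominator:
  fixes x :: "'a::finite mpow"
  assumes x: "\<And>N. trunc_norm 0 N x \<le> K" and x0: "x \<noteq> 0"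
  obtains t C where "mult_bounded 0 (1 - t) 1" "mcoeff (1 - t) 0 = 0" "mult_bounded 0 (t * x) C"
proof -
  have "(\<lambda>w. (cmod (word_lift x w))\<^sup>2) summable_on UNIV"
  proof (rule nonneg_bdd_above_summable_on)
    show "bdd_above (sum (\<lambda>w. (cmod (word_lift x w))\<^sup>2) ` {A. A \<subseteq> UNIV \<and> finite A})"
    proof (rule bdd_aboveI2)
      fix A :: "'a list set" assume "A \<in> {A. A \<subseteq> UNIV \<and> finite A}"
      then have A: "finite A" by simp
      define N where "N = Max (length ` A)"
      have "A \<subseteq> words_upto N" using A by (auto simp: words_upto_def N_def)
      then have "(\<Sum>w\<in>A. (cmod (word_lift x w))\<^sup>2) \<le> (\<Sum>w\<in>words_upto N. (cmod (word_lift x w))\<^sup>2)"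
        by (intro sum_mono2) auto
      also have "\<dots> \<le> K\<^sup>2"
        unfolding word_lift_norm by (intro power_mono x) simp
      finally show "(\<Sum>w\<in>A. (cmod (word_lift x w))\<^sup>2) \<le> K\<^sup>2" .
    qed
  qed simp
  then have l2: "ell2 (word_lift x)" by (simp add: ell2_def)
  define s where "s = sq_norm (word_lift x)"
  have s: "s > 0"
  proof -
    obtain \<alpha> where \<alpha>: "mcoeff x \<alpha> \<noteq> 0" using x0 mpow_eqI[of x 0] by auto
    have "card (arrangements \<alpha>) \<noteq> 0" using card_arrangements[of \<alpha>] by (metis mult_zero_left of_nat_0 zero_neq_one)
    then obtain w where w: "w \<in> arrangements \<alpha>" by (metis card.empty ex_in_conv)
    then have "0 < (cmod (word_lift x w))\<^sup>2"
      using \<alpha> weight_pos[of 0 \<alpha>] by (simp add: word_lift_def arrangements_def less_imp_neq[symmetric])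
    also have "(cmod (word_lift x w))\<^sup>2 \<le> s"
      using finite_sum_le_has_sum[OF sq_norm_has_sum[OF l2], of "{w}"] by (simp add: s_def)
    finally show ?thesis .
  qed
  define F where "F w = of_real (1 / sqrt s) * word_lift x w" for w
  have "((\<lambda>w. (1 / s) * (cmod (word_lift x w))\<^sup>2) has_sum (1 / s) * s) UNIV"
    unfolding s_def by (intro has_sum_cmult_right sq_norm_has_sum l2)
  then have "((\<lambda>w. (cmod (F w))\<^sup>2) has_sum 1) UNIV"
    using s by (simp add: F_def norm_mult power_mult_distrib norm_divide power_divide)
  then have F: "ell2 F" "sq_norm F = 1"
    by (auto simp: ell2_def sq_norm_def summable_on_def infsumI)
  have Frev: "F (rev w) = F w" for w
    by (simp add: F_def word_lift_def)
  have abF: "abelianize F = mconst (of_real (1 / sqrt s)) * x"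
  proof (rule mpow_eqI)
    fix \<alpha>
    have "mcoeff (abelianize F) \<alpha> = of_real (1 / sqrt s) * mcoeff (abelianize (word_lift x)) \<alpha>"
      by (simp add: abelianize_def F_def sum_distrib_left)
    then show "mcoeff (abelianize F) \<alpha> = mcoeff (mconst (of_real (1 / sqrt s)) * x) \<alpha>"
      by (simp add: abelianize_lift)
  qed
  define Q where "Q q w = q w - emitted F q w" for q w
  define U where "U = abelianize (\<lambda>a. inner2 (\<lambda>u. F (rev a @ u)) F)"
  have abq: "abelianize q = abelianize (Q q) * U" for q
  proof -
    have "q = (\<lambda>w. \<Sum>k\<le>length w. Q q (drop k w) * inner2 (\<lambda>u. F (rev (take k w) @ u)) F)"
      unfolding Q_def by (rule ext) (rule input_expand[OF F])
    then have "abelianize q = abelianize \<dots>" by (rule arg_cong)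
    also have "\<dots> = abelianize (Q q) * U" unfolding U_def by (rule abelianize_convolution)
    finally show ?thesis .
  qed
  have abY: "abelianize (\<lambda>w. state F q w []) = abelianize (Q q) * abelianize F" for q
  proof -
    have "(\<lambda>w. state F q w []) = (\<lambda>w. \<Sum>k\<le>length w. Q q (drop k w) * F (take k w))"
      unfolding Q_def by (rule ext) (simp add: state_expand[OF F] Frev)
    then show ?thesis by (simp only: abelianize_convolution)
  qed
  define \<delta> where "\<delta> w = (if w = [] then 1 else 0 :: complex)" for w :: "'a list"
  define t where "t = abelianize (Q \<delta>)"
  have tU: "t * U = 1"
    using abq[of \<delta>] by (simp add: t_def \<delta>_def[abs_def] abelianize_unit)
  have abQ: "abelianize (Q q) = t * abelianize q" for q
  proof -
    have "t * abelianize q = abelianize (Q q) * (t * U)"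
      unfolding abq[of q] by (simp only: mult_ac)
    then show ?thesis by (simp add: tU)
  qed
  have abE: "abelianize (emitted F q) = (1 - t) * abelianize q" for q
  proof -
    have "abelianize (Q q) = abelianize q - abelianize (emitted F q)"
      unfolding Q_def[abs_def] by (rule abelianize_diff)
    then show ?thesis unfolding abQ by (simp add: left_diff_distrib)
  qed
  have "mult_bounded 0 (1 - t) 1"
    unfolding mult_bounded_def
  proof (intro conjI allI)
    fix N y
    have "(trunc_norm 0 N ((1 - t) * y))\<^sup>2 = (trunc_norm 0 N (abelianize (emitted F (word_lift y))))\<^sup>2"
      unfolding abE abelianize_lift ..
    also have "\<dots> \<le> (\<Sum>w\<in>words_upto N. (cmod (emitted F (word_lift y) w))\<^sup>2)"
      by (rule abelianize_norm)
    also have "\<dots> \<le> (\<Sum>w\<in>words_upto N. (cmod (word_lift y w))\<^sup>2)"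
      using energy_inequality[OF F, of "word_lift y" N]
        sum_nonneg[of "words_upto N" "\<lambda>w. (cmod (state F (word_lift y) w []))\<^sup>2"] by simp
    also have "\<dots> = (trunc_norm 0 N y)\<^sup>2" by (rule word_lift_norm)
    finally have "trunc_norm 0 N ((1 - t) * y) \<le> trunc_norm 0 N y"
      by (rule power2_le_imp_le) simp
    then show "trunc_norm 0 N ((1 - t) * y) \<le> 1 * trunc_norm 0 N y" by simp
  qed simp
  moreover have "mcoeff (1 - t) 0 = 0"
  proof -
    have "1 - t = abelianize (emitted F \<delta>)"
      using abE[of \<delta>] by (simp add: \<delta>_def[abs_def] abelianize_unit)
    moreover have "arrangements (0 :: 'a \<Rightarrow> nat) = {[]}"
      by (auto simp: arrangements_def)
    ultimately show ?thesis by (simp add: abelianize_def emitted_def)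
  qed
  moreover have "mult_bounded 0 (t * x) (sqrt s)"
    unfolding mult_bounded_def
  proof (intro conjI allI)
    show "0 \<le> sqrt s" using s by simp
    fix N y
    have eq: "mconst (of_real (1 / sqrt s)) * (t * x * y) = abelianize (\<lambda>w. state F (word_lift y) w [])"
      unfolding abY abQ abF abelianize_lift by (simp only: mult_ac)
    have "(trunc_norm 0 N (mconst (of_real (1 / sqrt s)) * (t * x * y)))\<^sup>2
        \<le> (\<Sum>w\<in>words_upto N. (cmod (state F (word_lift y) w []))\<^sup>2)"
      unfolding eq by (rule abelianize_norm)
    also have "\<dots> \<le> (\<Sum>w\<in>words_upto N. (cmod (word_lift y w))\<^sup>2)"
      using energy_inequality[OF F, of "word_lift y" N]
        sum_nonneg[of "words_upto N" "\<lambda>w. (cmod (emitted F (word_lift y) w))\<^sup>2"] by simp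
    also have "\<dots> = (trunc_norm 0 N y)\<^sup>2" by (rule word_lift_norm)
    finally have "trunc_norm 0 N (mconst (of_real (1 / sqrt s)) * (t * x * y)) \<le> trunc_norm 0 N y"
      by (rule power2_le_imp_le) simp
    then show "trunc_norm 0 N (t * x * y) \<le> sqrt s * trunc_norm 0 N y"
      unfolding trunc_norm_mconst using s by (simp add: norm_divide field_simps)
  qed
  ultimately show thesis by (rule that)
qed

section \<open>The Drury-Arveson space in terms of coefficients\<close>

definition in_space :: "'d::finite mpow \<Rightarrow> bool" where
  "in_space x \<longleftrightarrow> (\<lambda>\<alpha>. weight 0 \<alpha> * (cmod (mcoeff x \<alpha>))\<^sup>2) summable_on UNIV"

definition full_norm :: "'d::finite mpow \<Rightarrow> real" where
  "full_norm x = sqrt (\<Sum>\<^sub>\<infinity>\<alpha>. weight 0 \<alpha> * (cmod (mcoeff x \<alpha>))\<^sup>2)"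

lemma full_norm_nonneg: "0 \<le> full_norm x"
  unfolding full_norm_def by (auto intro!: infsum_nonneg)

lemma trunc_norm_le_full_norm:
  assumes "in_space x"
  shows "trunc_norm 0 N x \<le> full_norm x"
proof (rule trunc_norm_leI[OF full_norm_nonneg])
  have "(\<Sum>\<alpha>\<in>mball N. weight 0 \<alpha> * (cmod (mcoeff x \<alpha>))\<^sup>2) \<le>
      (\<Sum>\<^sub>\<infinity>\<alpha>. weight 0 \<alpha> * (cmod (mcoeff x \<alpha>))\<^sup>2)"
    using assms unfolding in_space_def by (intro finite_sum_le_infsum) auto
  also have "\<dots> = (full_norm x)\<^sup>2"
    unfolding full_norm_def by (intro real_sqrt_pow2[symmetric] infsum_nonneg) simp
  finally show "(\<Sum>\<alpha>\<in>mball N. weight 0 \<alpha> * (cmod (mcoeff x \<alpha>))\<^sup>2) \<le> (full_norm x)\<^sup>2" .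
qed

lemma in_spaceI:
  assumes K: "\<And>N. trunc_norm 0 N x \<le> K"
  shows "in_space x" "full_norm x \<le> K"
proof -
  have K0: "0 \<le> K" using order_trans[OF trunc_norm_nonneg K] .
  have bound: "sum (\<lambda>\<alpha>. weight 0 \<alpha> * (cmod (mcoeff x \<alpha>))\<^sup>2) A \<le> K\<^sup>2" if A: "finite A" for A
  proof -
    obtain N where "A \<subseteq> mball N" using finite_subset_mball[OF A] .
    then have "sum (\<lambda>\<alpha>. weight 0 \<alpha> * (cmod (mcoeff x \<alpha>))\<^sup>2) A \<le> (trunc_norm 0 N x)\<^sup>2"
      unfolding trunc_norm_power2 by (intro sum_mono2) auto
    also have "\<dots> \<le> K\<^sup>2" by (intro power_mono K) simp
    finally show ?thesis .
  qed
  show sp: "in_space x"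
    unfolding in_space_def
    by (rule nonneg_bdd_above_summable_on) (auto intro!: bdd_aboveI2 bound)
  have "(\<Sum>\<^sub>\<infinity>\<alpha>. weight 0 \<alpha> * (cmod (mcoeff x \<alpha>))\<^sup>2) \<le> K\<^sup>2"
    using sp unfolding in_space_def by (rule infsum_le_finite_sums) (simp add: bound)
  then show "full_norm x \<le> K"
    unfolding full_norm_def using K0 by (simp add: real_le_lsqrt real_sqrt_le_iff[of _ "K\<^sup>2", symmetric] del: real_sqrt_le_iff)
qed

lemma full_norm_add:
  assumes "in_space x" "in_space y"
  shows "in_space (x + y)" "full_norm (x + y) \<le> full_norm x + full_norm y"
proof -
  have "trunc_norm 0 N (x + y) \<le> full_norm x + full_norm y" for N
    using trunc_norm_add[of 0 N x y] trunc_norm_le_full_norm[OF assms(1), of N]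
      trunc_norm_le_full_norm[OF assms(2), of N] by linarith
  then show "in_space (x + y)" "full_norm (x + y) \<le> full_norm x + full_norm y"
    by (rule in_spaceI)+
qed

lemma in_space_diff:
  assumes "in_space x" "in_space y"
  shows "in_space (x - y)"
proof -
  have "trunc_norm 0 N (x - y) \<le> full_norm x + full_norm y" for N
    using trunc_norm_diff[of 0 N x y] trunc_norm_le_full_norm[OF assms(1), of N]
      trunc_norm_le_full_norm[OF assms(2), of N] by linarith
  then show ?thesis by (rule in_spaceI)
qed

lemma full_norm_mult:
  assumes "mult_bounded 0 p C" "in_space y"
  shows "in_space (p * y)" "full_norm (p * y) \<le> C * full_norm y"
proof -
  have "trunc_norm 0 N (p * y) \<le> C * full_norm y" for N
    by (rule order_trans[OF mult_boundedD[OF assms(1)]])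
      (intro mult_left_mono trunc_norm_le_full_norm assms mult_bounded_nonneg[OF assms(1)])
  then show "in_space (p * y)" "full_norm (p * y) \<le> C * full_norm y"
    by (rule in_spaceI)+
qed

lemma in_space_1: "in_space 1"
proof -
  have "(\<lambda>\<alpha>. weight 0 \<alpha> * (cmod (mcoeff (1 :: 'a mpow) \<alpha>))\<^sup>2) summable_on {0}"
    by (rule summable_on_finite) simp
  then show ?thesis
    unfolding in_space_def
    by (rule summable_on_cong_neutral[THEN iffD1, rotated -1]) (auto simp: mcoeff_1)
qed

lemma mult_bounded_in_space: "mult_bounded 0 p C \<Longrightarrow> in_space p"
  using full_norm_mult(1)[OF _ in_space_1] by simp

lemma sum_words_monomial:
  fixes a :: "'d::finite \<Rightarrow> real"
  shows "(\<Sum>w\<in>words n. \<Prod>i\<in>UNIV. a i ^ letter_count w i) = (\<Sum>i\<in>UNIV. a i) ^ n"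
proof (induction n)
  case 0
  have "words 0 = {[] :: 'd list}" by (auto simp: words_def)
  then show ?case by (simp add: letter_count_def)
next
  case (Suc n)
  have "(\<Prod>k\<in>UNIV. a k ^ letter_count (i # w) k) = a i * (\<Prod>k\<in>UNIV. a k ^ letter_count w k)" for i w
  proof -
    have "(\<Prod>k\<in>UNIV. a k ^ letter_count (i # w) k) =
        (\<Prod>k\<in>UNIV. (if k = i then a i else 1) * a k ^ letter_count w k)"
      by (rule prod.cong) (auto simp: letter_count_def)
    then show ?thesis by (simp add: prod.distrib prod.delta)
  qed
  then show ?case
    by (simp add: sum_words_Suc Suc[symmetric] sum_distrib_left sum_distrib_right)
qed

text \<open>
  The reproducing kernel in coordinates: \<open>\<Sum>\<alpha>. \<bar>z\<^sup>\<alpha>\<bar>\<^sup>2 / weight 0 \<alpha> = 1 / (1 - \<bar>z\<bar>\<^sup>2)\<close>.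
\<close>

lemma kernel_bound:
  fixes z :: "complex ^ 'd::finite"
  assumes z: "z \<in> unit_ball"
  shows "(\<Sum>\<alpha>\<in>mball N. (cmod (monomial \<alpha> z))\<^sup>2 / weight 0 \<alpha>) \<le> 1 / (1 - (norm z)\<^sup>2)"
proof -
  define a where "a i = (cmod (z $ i))\<^sup>2" for i
  have a: "(\<Sum>i\<in>UNIV. a i) = (norm z)\<^sup>2"
    unfolding norm_complex_vec a_def by (simp add: sum_nonneg)
  have n1: "(norm z)\<^sup>2 < 1" using z by (simp add: power_less_one_iff abs_square_less_1)
  have "(\<Sum>\<alpha>\<in>mball N. (cmod (monomial \<alpha> z))\<^sup>2 / weight 0 \<alpha>) =
      (\<Sum>\<alpha>\<in>mball N. \<Sum>w\<in>arrangements \<alpha>. \<Prod>i\<in>UNIV. a i ^ letter_count w i)"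
  proof (rule sum.cong[OF refl])
    fix \<alpha> :: "'d \<Rightarrow> nat"
    have "(\<Sum>w\<in>arrangements \<alpha>. \<Prod>i\<in>UNIV. a i ^ letter_count w i) =
        (\<Sum>w\<in>arrangements \<alpha>. (cmod (monomial \<alpha> z))\<^sup>2)"
      by (rule sum.cong) (auto simp: arrangements_def monomial_def a_def prod_norm[symmetric]
          prod_power_distrib norm_power power_mult[symmetric] mult.commute)
    also have "\<dots> = (cmod (monomial \<alpha> z))\<^sup>2 / weight 0 \<alpha>"
    proof -
      have "real (card (arrangements \<alpha>)) = 1 / weight 0 \<alpha>"
        using card_arrangements[of \<alpha>] weight_pos[of 0 \<alpha>]
        by (simp add: nonzero_eq_divide_eq less_imp_neq[symmetric])
      then show ?thesis by simp
    qed
    finally show "(cmod (monomial \<alpha> z))\<^sup>2 / weight 0 \<alpha> =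
        (\<Sum>w\<in>arrangements \<alpha>. \<Prod>i\<in>UNIV. a i ^ letter_count w i)" by simp
  qed
  also have "\<dots> = (\<Sum>w\<in>words_upto N. \<Prod>i\<in>UNIV. a i ^ letter_count w i)"
    by (rule sum_words_upto_group[symmetric])
  also have "\<dots> = (\<Sum>n\<le>N. ((norm z)\<^sup>2) ^ n)"
  proof (induction N)
    case 0
    have "words_upto 0 = (words 0 :: 'd list set)" by (auto simp: words_upto_def words_def)
    then show ?case by (simp add: sum_words_monomial)
  qed (simp add: sum_words_upto_Suc sum_words_monomial a)
  also have "\<dots> \<le> (\<Sum>n. ((norm z)\<^sup>2) ^ n)"
    using n1 by (intro sum_le_suminf summable_geometric) auto
  also have "\<dots> = 1 / (1 - (norm z)\<^sup>2)"
    using n1 by (intro suminf_geometric) auto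
  finally show ?thesis .
qed

text \<open>
  By the inequality between the means, each term is at most the sum of a term of the norm of \<open>x\<close> and a
  term of the reproducing kernel.
\<close>

lemma in_space_expands:
  fixes x :: "'d::finite mpow"
  assumes x: "in_space x"
  obtains f where "expands x f"
proof -
  have "(\<lambda>\<alpha>. mcoeff x \<alpha> * monomial \<alpha> z) summable_on UNIV" if z: "z \<in> unit_ball" for z
  proof -
    have "(\<lambda>\<alpha>. cmod (mcoeff x \<alpha> * monomial \<alpha> z)) summable_on UNIV"
    proof (rule nonneg_bdd_above_summable_on)
      show "bdd_above (sum (\<lambda>\<alpha>. cmod (mcoeff x \<alpha> * monomial \<alpha> z)) ` {A. A \<subseteq> UNIV \<and> finite A})"
      proof (rule bdd_aboveI2)
        fix A :: "('d \<Rightarrow> nat) set" assume "A \<in> {A. A \<subseteq> UNIV \<and> finite A}"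
        then obtain N where N: "A \<subseteq> mball N" using finite_subset_mball by auto
        have "sum (\<lambda>\<alpha>. cmod (mcoeff x \<alpha> * monomial \<alpha> z)) A \<le>
            (\<Sum>\<alpha>\<in>mball N. cmod (mcoeff x \<alpha> * monomial \<alpha> z))"
          using N by (intro sum_mono2) auto
        also have "\<dots> \<le> (\<Sum>\<alpha>\<in>mball N. weight 0 \<alpha> * (cmod (mcoeff x \<alpha>))\<^sup>2
            + (cmod (monomial \<alpha> z))\<^sup>2 / weight 0 \<alpha>)"
        proof (rule sum_mono)
          fix \<alpha> :: "'d \<Rightarrow> nat"
          define s where "s = sqrt (weight 0 \<alpha>)"
          have s: "s > 0" "weight 0 \<alpha> = s\<^sup>2" by (simp_all add: s_def less_imp_le)
          define p q where "p = s * cmod (mcoeff x \<alpha>)" and "q = cmod (monomial \<alpha> z) / s"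
          have pq: "0 \<le> p * q" using s by (simp add: p_def q_def)
          have "p * q \<le> 2 * p * q" using pq by simp
          also have "\<dots> \<le> p\<^sup>2 + q\<^sup>2" by (rule sum_squares_bound)
          finally show "cmod (mcoeff x \<alpha> * monomial \<alpha> z) \<le>
              weight 0 \<alpha> * (cmod (mcoeff x \<alpha>))\<^sup>2 + (cmod (monomial \<alpha> z))\<^sup>2 / weight 0 \<alpha>"
            using s by (simp add: p_def q_def norm_mult power_mult_distrib power_divide)
        qed
        also have "\<dots> \<le> (full_norm x)\<^sup>2 + 1 / (1 - (norm z)\<^sup>2)"
          unfolding sum.distrib trunc_norm_power2[symmetric]
          by (intro add_mono kernel_bound z power_mono trunc_norm_le_full_norm x) simp
        finally show "sum (\<lambda>\<alpha>. cmod (mcoeff x \<alpha> * monomial \<alpha> z)) A \<le>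
            (full_norm x)\<^sup>2 + 1 / (1 - (norm z)\<^sup>2)" .
      qed
    qed simp
    then show ?thesis by (rule Infinite_Sum.abs_summable_summable)
  qed
  then show thesis
    by (intro that[of "\<lambda>z. \<Sum>\<^sub>\<infinity>\<alpha>. mcoeff x \<alpha> * monomial \<alpha> z"]) (simp add: expands_def)
qed

lemma expands_cong: "expands x f \<Longrightarrow> (\<And>z. z \<in> unit_ball \<Longrightarrow> f z = g z) \<Longrightarrow> expands x g"
  by (simp add: expands_def)

lemma da_term_eq: "expands x f \<Longrightarrow> da_term f \<alpha> = weight 0 \<alpha> * (cmod (mcoeff x \<alpha>))\<^sup>2"
  by (simp add: da_term_def power_coeff_eq weight_def)

lemma drury_arveson_iff:
  assumes x: "expands x f"
  shows "f \<in> drury_arveson \<longleftrightarrow> in_space x"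
proof -
  have "da_term f = (\<lambda>\<alpha>. weight 0 \<alpha> * (cmod (mcoeff x \<alpha>))\<^sup>2)"
    by (rule ext) (rule da_term_eq[OF x])
  then show ?thesis
    using expands_imp_analytic[OF x] by (simp add: drury_arveson_def in_space_def)
qed

lemma da_norm_eq: "expands x f \<Longrightarrow> da_norm f = full_norm x"
  by (simp add: da_norm_def full_norm_def da_term_eq)

lemma drury_arvesonE:
  assumes "f \<in> drury_arveson"
  obtains x where "expands x f" "in_space x"
proof -
  have "analytic_in_ball f" using assms by (simp add: drury_arveson_def)
  then obtain x where "expands x f" by (rule analytic_in_ball_expands)
  then show thesis using assms drury_arveson_iff that by blast
qed

lemma da_multI:
  assumes "expands p \<phi>" "mult_bounded 0 p C"
  shows "\<phi> \<in> da_mult"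
  unfolding da_mult_def
proof (intro CollectI ballI)
  fix f :: "complex ^ 'a \<Rightarrow> complex" assume "f \<in> drury_arveson"
  then obtain x where x: "expands x f" "in_space x" by (rule drury_arvesonE)
  then show "(\<lambda>z. \<phi> z * f z) \<in> drury_arveson"
    using full_norm_mult(1)[OF assms(2) x(2)] drury_arveson_iff[OF expands_mult[OF assms(1) x(1)]]
    by simp
qed

lemma da_mult_mult:
  assumes "\<phi> \<in> da_mult" "\<psi> \<in> da_mult"
  shows "(\<lambda>z. \<phi> z * \<psi> z) \<in> da_mult"
  using assms unfolding da_mult_def by (simp add: mult.assoc)

lemma da_mult_subset: "\<phi> \<in> da_mult \<Longrightarrow> \<phi> \<in> drury_arveson"
proof -
  assume "\<phi> \<in> da_mult"
  moreover have "(\<lambda>_. 1) \<in> drury_arveson"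
    using drury_arveson_iff[OF expands_1] in_space_1 by blast
  ultimately show ?thesis unfolding da_mult_def by force
qed

lemma da_norm_triangle:
  assumes "f \<in> drury_arveson" "g \<in> drury_arveson" "h \<in> drury_arveson"
  shows "da_norm (\<lambda>z. f z - h z) \<le> da_norm (\<lambda>z. f z - g z) + da_norm (\<lambda>z. g z - h z)"
proof -
  obtain x where x: "expands x f" "in_space x" using assms(1) by (rule drury_arvesonE)
  obtain y where y: "expands y g" "in_space y" using assms(2) by (rule drury_arvesonE)
  obtain w where w: "expands w h" "in_space w" using assms(3) by (rule drury_arvesonE)
  show ?thesis
    using full_norm_add(2)[OF in_space_diff[OF x(2) y(2)] in_space_diff[OF y(2) w(2)]]
    by (simp add: da_norm_eq[OF expands_diff[OF x(1) y(1)]] da_norm_eq[OF expands_diff[OF y(1) w(1)]]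
        da_norm_eq[OF expands_diff[OF x(1) w(1)]])
qed

lemma da_cyclic_iff:
  "da_cyclic f \<longleftrightarrow> f \<in> drury_arveson \<and>
    (\<forall>u\<in>drury_arveson. \<forall>\<epsilon>>0. \<exists>\<phi>\<in>da_mult. da_norm (\<lambda>z. u z - \<phi> z * f z) < \<epsilon>)"
proof -
  define P where "P u \<longleftrightarrow> (\<forall>\<epsilon>>0. \<exists>\<phi>\<in>da_mult. da_norm (\<lambda>z. u z - \<phi> z * f z) < \<epsilon>)" for u
  have "(\<exists>v\<in>{(\<lambda>z. \<phi> z * f z) | \<phi>. \<phi> \<in> da_mult}. da_norm (\<lambda>z. u z - v z) < \<epsilon>) \<longleftrightarrow>
      (\<exists>\<phi>\<in>da_mult. da_norm (\<lambda>z. u z - \<phi> z * f z) < \<epsilon>)" for u \<epsilon>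
    by auto
  then have "da_closure {(\<lambda>z. \<phi> z * f z) | \<phi>. \<phi> \<in> da_mult} = {u \<in> drury_arveson. P u}"
    by (simp only: da_closure_def P_def)
  then have "da_cyclic f \<longleftrightarrow> f \<in> drury_arveson \<and> {u \<in> drury_arveson. P u} = drury_arveson"
    by (simp only: da_cyclic_def)
  also have "\<dots> \<longleftrightarrow> f \<in> drury_arveson \<and> (\<forall>u\<in>drury_arveson. P u)"
    by auto
  finally show ?thesis by (simp only: P_def)
qed

section \<open>Denominators are cyclic\<close>

lemma mcoeff_mult_low_order:
  assumes x: "\<And>\<alpha>. multi_size \<alpha> < a \<Longrightarrow> mcoeff x \<alpha> = 0"
    and y: "\<And>\<alpha>. multi_size \<alpha> < b \<Longrightarrow> mcoeff y \<alpha> = 0"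
    and \<alpha>: "multi_size \<alpha> < a + b"
  shows "mcoeff (x * y) \<alpha> = 0"
  unfolding mcoeff_mult
proof (rule sum.neutral, safe)
  fix \<beta> \<gamma> assume "(\<beta>, \<gamma>) \<in> splits \<alpha>"
  then have "multi_size \<beta> + multi_size \<gamma> = multi_size \<alpha>" by (auto simp: splits_def)
  then have "multi_size \<beta> < a \<or> multi_size \<gamma> < b" using \<alpha> by linarith
  then show "mcoeff x \<beta> * mcoeff y \<gamma> = 0" using x y by auto
qed

lemma mcoeff_power_low_order:
  assumes "mcoeff p 0 = 0" and "multi_size \<alpha> < k"
  shows "mcoeff (p ^ k) \<alpha> = 0"
  using assms(2)
proof (induction k arbitrary: \<alpha>)
  case (Suc k)
  have "mcoeff (p * p ^ k) \<alpha> = 0"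
    by (rule mcoeff_mult_low_order[of 1 p k]) (use assms(1) Suc in auto)
  then show ?case by simp
qed simp

lemma mult_bounded_sum_powers: "mult_bounded j p C \<Longrightarrow> \<exists>D. mult_bounded j (\<Sum>i<k. p ^ i) D"
proof (induction k)
  case 0
  have "mult_bounded j 0 0" by (simp add: mult_bounded_def trunc_norm_def L2_set_def)
  then show ?case by auto
next
  case (Suc k)
  then obtain D where "mult_bounded j (\<Sum>i<k. p ^ i) D" by blast
  from mult_bounded_add[OF this mult_bounded_power[OF Suc.prems, of k]] show ?case
    unfolding sum.lessThan_Suc by blast
qed

lemma trunc_norm_tail:
  fixes s :: "'d::finite mpow"
  assumes K: "\<And>N. trunc_norm 0 N s \<le> K" and e: "e > 0"
  obtains k where "\<And>N. (\<Sum>\<alpha>\<in>{\<alpha>\<in>mball N. k \<le> multi_size \<alpha>}. weight 0 \<alpha> * (cmod (mcoeff s \<alpha>))\<^sup>2) \<le> e"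
proof -
  define S where "S N = (trunc_norm 0 N s)\<^sup>2" for N
  have "S N \<le> K\<^sup>2" for N unfolding S_def by (intro power_mono K) simp
  then have bdd: "bdd_above (range S)" by (intro bdd_aboveI2)
  have "Sup (range S) - e < Sup (range S)" using e by simp
  then obtain k where k: "Sup (range S) - e < S k"
    using less_cSupD[of "range S"] by blast
  have "(\<Sum>\<alpha>\<in>{\<alpha>\<in>mball N. Suc k \<le> multi_size \<alpha>}. weight 0 \<alpha> * (cmod (mcoeff s \<alpha>))\<^sup>2) \<le> e" for N
  proof -
    have "S k + (\<Sum>\<alpha>\<in>{\<alpha>\<in>mball N. Suc k \<le> multi_size \<alpha>}. weight 0 \<alpha> * (cmod (mcoeff s \<alpha>))\<^sup>2) =
        (\<Sum>\<alpha>\<in>mball k \<union> {\<alpha>\<in>mball N. Suc k \<le> multi_size \<alpha>}. weight 0 \<alpha> * (cmod (mcoeff s \<alpha>))\<^sup>2)"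
      unfolding S_def trunc_norm_power2
      by (rule sum.union_disjoint[OF finite_mball, symmetric]) (auto simp: mball_def[of k])
    also have "\<dots> \<le> S (max k N)"
      unfolding S_def trunc_norm_power2 by (rule sum_mono2[OF finite_mball]) (auto simp: mball_def)
    also have "\<dots> \<le> Sup (range S)" by (rule cSup_upper[OF rangeI bdd])
    finally show ?thesis using k by linarith
  qed
  then show thesis by (rule that)
qed

text \<open>
  The powers of a contractive multiplier \<open>p\<close> without constant term move any fixed vector to ever
  higher degrees, so a sparse sequence of them is nearly orthogonal and its averages tend to \<open>0\<close>
  in norm, as in the theorem of Banach and Saks. Since \<open>1 - p\<^sup>k\<close> is divisible by \<open>1 - p\<close>, the
  vector is a limit of multiples of its product with \<open>1 - p\<close>.
\<close>

lemma denominator_sums: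
  fixes p y :: "'d::finite mpow"
  assumes p: "mult_bounded 0 p 1" "mcoeff p 0 = 0" and K: "K > 0" "\<And>N. trunc_norm 0 N y \<le> K"
  shows "\<exists>r D. mult_bounded 0 r D \<and>
    (\<forall>N. (trunc_norm 0 N (of_nat m * y - r * ((1 - p) * y)))\<^sup>2 \<le> 2 * real m * K\<^sup>2)"
proof (induction m)
  case 0
  have "mult_bounded 0 (0 :: 'd mpow) 0" by (simp add: mult_bounded_def trunc_norm_def L2_set_def)
  then show ?case by (intro exI[of _ 0]) (simp add: trunc_norm_def L2_set_def)
next
  case (Suc m)
  then obtain r D where r: "mult_bounded 0 r D" and
    s: "\<And>N. (trunc_norm 0 N (of_nat m * y - r * ((1 - p) * y)))\<^sup>2 \<le> 2 * real m * K\<^sup>2" by blast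
  define s where "s = of_nat m * y - r * ((1 - p) * y)"
  have "trunc_norm 0 N s \<le> sqrt (2 * real m * K\<^sup>2)" for N
    using s[of N] unfolding s_def by (rule real_le_rsqrt)
  moreover have "K\<^sup>2 / 4 > 0" using K(1) by simp
  ultimately obtain k where
    k: "\<And>N. (\<Sum>\<alpha>\<in>{\<alpha>\<in>mball N. k \<le> multi_size \<alpha>}. weight 0 \<alpha> * (cmod (mcoeff s \<alpha>))\<^sup>2) \<le> K\<^sup>2 / 4"
    using trunc_norm_tail by blast
  define z where "z = p ^ k * y"
  have z0: "mcoeff z \<alpha> = 0" if "multi_size \<alpha> < k" for \<alpha>
    unfolding z_def
    by (rule mcoeff_mult_low_order[where a = k and b = 0]) (use mcoeff_power_low_order[OF p(2)] that in auto)
  have zK: "(trunc_norm 0 N z)\<^sup>2 \<le> K\<^sup>2" for N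
  proof -
    have "trunc_norm 0 N z \<le> 1 ^ k * trunc_norm 0 N y"
      unfolding z_def by (rule mult_boundedD[OF mult_bounded_power[OF p(1)]])
    then show ?thesis using K(2)[of N] by (intro power_mono) auto
  qed
  have est: "(trunc_norm 0 N (s + z))\<^sup>2 \<le> 2 * real (Suc m) * K\<^sup>2" for N
  proof -
    have "(trunc_norm 0 N (s + z))\<^sup>2 \<le> (\<Sum>\<alpha>\<in>mball N. weight 0 \<alpha> * (cmod (mcoeff s \<alpha>))\<^sup>2
        + 2 * (if k \<le> multi_size \<alpha> then weight 0 \<alpha> * (cmod (mcoeff s \<alpha>))\<^sup>2 else 0)
        + 3 / 2 * (weight 0 \<alpha> * (cmod (mcoeff z \<alpha>))\<^sup>2))"
      unfolding trunc_norm_power2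
    proof (rule sum_mono)
      fix \<alpha> :: "'d \<Rightarrow> nat"
      let ?w = "weight 0 \<alpha>" and ?a = "cmod (mcoeff s \<alpha>)" and ?b = "cmod (mcoeff z \<alpha>)"
      show "?w * (cmod (mcoeff (s + z) \<alpha>))\<^sup>2 \<le> ?w * ?a\<^sup>2
          + 2 * (if k \<le> multi_size \<alpha> then ?w * ?a\<^sup>2 else 0) + 3 / 2 * (?w * ?b\<^sup>2)"
      proof (cases "k \<le> multi_size \<alpha>")
        case True
        have "(cmod (mcoeff (s + z) \<alpha>))\<^sup>2 \<le> (?a + ?b)\<^sup>2"
          by (intro power_mono) (auto intro: norm_triangle_ineq)
        \<comment> \<open>In high degree \<open>s\<close> is tiny and may be tripled, so that \<open>z\<close> only costs the factor \<open>3 / 2\<close>; the budget is \<open>2 K\<^sup>2\<close> per step.\<close>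
        also have "\<dots> \<le> 3 * ?a\<^sup>2 + 3 / 2 * ?b\<^sup>2"
          using zero_le_power2[of "2 * ?a - ?b"] by (simp add: power2_eq_square algebra_simps)
        finally have "?w * (cmod (mcoeff (s + z) \<alpha>))\<^sup>2 \<le> ?w * (3 * ?a\<^sup>2 + 3 / 2 * ?b\<^sup>2)"
          by (intro mult_left_mono) auto
        then show ?thesis using True by (simp add: distrib_left)
      next
        case False
        then show ?thesis using z0[of \<alpha>] by simp
      qed
    qed
    also have "\<dots> = (trunc_norm 0 N s)\<^sup>2
        + 2 * (\<Sum>\<alpha>\<in>{\<alpha>\<in>mball N. k \<le> multi_size \<alpha>}. weight 0 \<alpha> * (cmod (mcoeff s \<alpha>))\<^sup>2)
        + 3 / 2 * (trunc_norm 0 N z)\<^sup>2"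
      unfolding trunc_norm_power2 sum.distrib sum_distrib_left[symmetric]
      by (simp add: sum.inter_filter)
    also have "\<dots> \<le> 2 * real m * K\<^sup>2 + 2 * (K\<^sup>2 / 4) + 3 / 2 * K\<^sup>2"
      using s[of N] k[of N] zK[of N] unfolding s_def[symmetric] by linarith
    finally show ?thesis by (simp add: algebra_simps)
  qed
  obtain E where E: "mult_bounded 0 (\<Sum>i<k. p ^ i) E"
    using mult_bounded_sum_powers[OF p(1)] by blast
  have "p ^ k = 1 - (1 - p) * (\<Sum>i<k. p ^ i)"
    using one_diff_power_eq[of p k] by (simp add: algebra_simps)
  then have "z = (1 - (1 - p) * (\<Sum>i<k. p ^ i)) * y"
    by (simp only: z_def)
  also have "\<dots> = y - (\<Sum>i<k. p ^ i) * ((1 - p) * y)"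
    unfolding left_diff_distrib[of 1 "(1 - p) * (\<Sum>i<k. p ^ i)" y] by (simp only: mult_1 mult_ac)
  finally have "z = y - (\<Sum>i<k. p ^ i) * ((1 - p) * y)" .
  then have "s + z = of_nat (Suc m) * y - (r + (\<Sum>i<k. p ^ i)) * ((1 - p) * y)"
    unfolding s_def by (simp only: of_nat_Suc distrib_right mult_1) (simp add: algebra_simps)
  then show ?case
    using mult_bounded_add[OF r E] est by metis
qed

lemma denominator_approx:
  fixes t y :: "'d::finite mpow"
  assumes t: "mult_bounded 0 (1 - t) 1" "mcoeff (1 - t) 0 = 0" and y: "in_space y" and e: "e > 0"
  obtains r D where "mult_bounded 0 r D" "full_norm (y - r * (t * y)) < e"
proof -
  define K where "K = full_norm y + 1"
  have K: "K > 0" using full_norm_nonneg[of y] by (simp add: K_def)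
  have yK: "trunc_norm 0 N y \<le> K" for N
    using trunc_norm_le_full_norm[OF y, of N] by (simp add: K_def)
  obtain m where m: "real m > 2 * (2 * K / e)\<^sup>2" using reals_Archimedean2 by blast
  then have m0: "m > 0" using zero_le_power2[of "2 * K / e"] by (cases m) auto
  obtain r D where r: "mult_bounded 0 r D" and
    s: "\<And>N. (trunc_norm 0 N (of_nat m * y - r * (t * y)))\<^sup>2 \<le> 2 * real m * K\<^sup>2"
    using denominator_sums[OF t K yK, of m] by auto
  define c where "c = complex_of_real (1 / real m)"
  have eq: "y - mconst c * r * (t * y) = mconst c * (of_nat m * y - r * (t * y))"
    by (rule mpow_eqI) (use m0 in \<open>simp add: of_nat_mpow c_def mult.assoc right_diff_distrib\<close>)
  have "trunc_norm 0 N (y - mconst c * r * (t * y)) \<le> e / 2" for N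
  proof (rule power2_le_imp_le)
    have "(trunc_norm 0 N (y - mconst c * r * (t * y)))\<^sup>2 \<le> (1 / real m)\<^sup>2 * (2 * real m * K\<^sup>2)"
      unfolding eq trunc_norm_mconst power_mult_distrib
      by (intro mult_mono s) (simp_all add: c_def norm_divide)
    also have "\<dots> = 2 * K\<^sup>2 / real m" using m0 by (simp add: power2_eq_square)
    also have "\<dots> \<le> (e / 2)\<^sup>2"
      using m m0 e by (simp add: field_simps power2_eq_square)
    finally show "(trunc_norm 0 N (y - mconst c * r * (t * y)))\<^sup>2 \<le> (e / 2)\<^sup>2" .
  qed (use e in simp)
  then have "full_norm (y - mconst c * r * (t * y)) \<le> e / 2" by (rule in_spaceI)
  then show thesis
    using e by (intro that[OF mult_bounded_mult[OF mult_bounded_mconst[of 0 c] r]]) auto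
qed

lemma da_cyclic_denominator:
  assumes t: "mult_bounded 0 (1 - t) 1" "mcoeff (1 - t) 0 = 0" and \<theta>: "expands t \<theta>" "\<theta> \<in> da_mult"
    and b: "da_cyclic b"
  shows "da_cyclic (\<lambda>z. \<theta> z * b z)"
  unfolding da_cyclic_iff
proof (intro conjI ballI allI impI)
  have bD: "b \<in> drury_arveson" using b by (simp add: da_cyclic_iff)
  show \<theta>b: "(\<lambda>z. \<theta> z * b z) \<in> drury_arveson"
    using \<theta>(2) bD by (simp add: da_mult_def)
  fix u :: "complex ^ 'a \<Rightarrow> complex" and e :: real assume u: "u \<in> drury_arveson" and e: "e > 0"
  then obtain \<phi> where \<phi>: "\<phi> \<in> da_mult" "da_norm (\<lambda>z. u z - \<phi> z * b z) < e / 2"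
    using b unfolding da_cyclic_iff by (metis half_gt_zero)
  have \<phi>b: "(\<lambda>z. \<phi> z * b z) \<in> drury_arveson" using \<phi>(1) bD by (simp add: da_mult_def)
  then obtain y where y: "expands y (\<lambda>z. \<phi> z * b z)" "in_space y" by (rule drury_arvesonE)
  obtain r D where r: "mult_bounded 0 r D" "full_norm (y - r * (t * y)) < e / 2"
    using denominator_approx[OF t y(2), of "e / 2"] e by auto
  obtain \<rho> where \<rho>: "expands r \<rho>" using in_space_expands[OF mult_bounded_in_space[OF r(1)]] .
  have \<rho>m: "\<rho> \<in> da_mult" by (rule da_multI[OF \<rho> r(1)])
  have "da_norm (\<lambda>z. \<phi> z * b z - \<rho> z * (\<theta> z * (\<phi> z * b z))) < e / 2"
    using r(2) da_norm_eq[OF expands_diff[OF y(1) expands_mult[OF \<rho> expands_mult[OF \<theta>(1) y(1)]]]]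
    by simp
  moreover have "(\<lambda>z. \<rho> z * (\<theta> z * (\<phi> z * b z))) \<in> drury_arveson"
    using \<rho>m \<theta>(2) \<phi>b by (simp add: da_mult_def)
  ultimately have "da_norm (\<lambda>z. u z - \<rho> z * (\<theta> z * (\<phi> z * b z))) < e"
    using da_norm_triangle[OF u \<phi>b] \<phi>(2) by fastforce
  then have "da_norm (\<lambda>z. u z - (\<rho> z * \<phi> z) * (\<theta> z * b z)) < e"
    by (simp add: mult_ac)
  then show "\<exists>\<psi>\<in>da_mult. da_norm (\<lambda>z. u z - \<psi> z * (\<theta> z * b z)) < e"
    by (rule bexI[where x = "\<lambda>z. \<rho> z * \<phi> z"]) (rule da_mult_mult[OF \<rho>m \<phi>(1)])
qed

text \<open>
  If \<open>\<phi> a\<close> is close to \<open>u\<close> and \<open>\<omega> b\<close> is close to \<open>\<phi>\<close>, then \<open>\<omega> a b\<close> is close to \<open>\<phi> a\<close>, because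
  multiplication by \<open>a\<close> is bounded.
\<close>

lemma da_cyclic_mult:
  assumes A: "expands A a" "mult_bounded 0 A C" and a: "da_cyclic a" and b: "da_cyclic b"
  shows "da_cyclic (\<lambda>z. a z * b z)"
  unfolding da_cyclic_iff
proof (intro conjI ballI allI impI)
  have am: "a \<in> da_mult" by (rule da_multI[OF A])
  have aD: "a \<in> drury_arveson" and bD: "b \<in> drury_arveson" using a b by (simp_all add: da_cyclic_iff)
  show "(\<lambda>z. a z * b z) \<in> drury_arveson" using am bD by (simp add: da_mult_def)
  fix u :: "complex ^ 'a \<Rightarrow> complex" and e :: real assume u: "u \<in> drury_arveson" and e: "e > 0"
  have C0: "0 \<le> C" by (rule mult_bounded_nonneg[OF A(2)])
  obtain \<phi> where \<phi>: "\<phi> \<in> da_mult" "da_norm (\<lambda>z. u z - \<phi> z * a z) < e / 2"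
    using a u e unfolding da_cyclic_iff by (metis half_gt_zero)
  have \<phi>D: "\<phi> \<in> drury_arveson" by (rule da_mult_subset[OF \<phi>(1)])
  have "e / (2 * (C + 1)) > 0" using e C0 by simp
  then obtain \<omega> where \<omega>: "\<omega> \<in> da_mult" "da_norm (\<lambda>z. \<phi> z - \<omega> z * b z) < e / (2 * (C + 1))"
    using b \<phi>D unfolding da_cyclic_iff by blast
  have \<omega>b: "(\<lambda>z. \<omega> z * b z) \<in> drury_arveson" using \<omega>(1) bD by (simp add: da_mult_def)
  obtain x where x: "expands x \<phi>" "in_space x" using \<phi>D by (rule drury_arvesonE)
  obtain y where y: "expands y (\<lambda>z. \<omega> z * b z)" "in_space y" using \<omega>b by (rule drury_arvesonE)
  have "da_norm (\<lambda>z. \<phi> z * a z - \<omega> z * (a z * b z)) = full_norm (A * (x - y))"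
    by (rule da_norm_eq, rule expands_cong[OF expands_mult[OF A(1) expands_diff[OF x(1) y(1)]]])
      (simp add: algebra_simps)
  also have "\<dots> \<le> C * full_norm (x - y)"
    by (rule full_norm_mult[OF A(2) in_space_diff[OF x(2) y(2)]])
  also have "full_norm (x - y) = da_norm (\<lambda>z. \<phi> z - \<omega> z * b z)"
    by (rule da_norm_eq[symmetric, OF expands_diff[OF x(1) y(1)]])
  also have "C * \<dots> \<le> C * (e / (2 * (C + 1)))"
    using \<omega>(2) C0 by (intro mult_left_mono) auto
  also have "\<dots> \<le> e / 2" using C0 e by (simp add: field_simps)
  finally have 1: "da_norm (\<lambda>z. \<phi> z * a z - \<omega> z * (a z * b z)) \<le> e / 2" .
  have "(\<lambda>z. \<phi> z * a z) \<in> drury_arveson" using \<phi>(1) aD by (simp add: da_mult_def)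
  moreover have "(\<lambda>z. \<omega> z * (a z * b z)) \<in> drury_arveson"
    using am bD \<omega>(1) by (simp add: da_mult_def)
  ultimately have "da_norm (\<lambda>z. u z - \<omega> z * (a z * b z)) < e"
    using da_norm_triangle[OF u] \<phi>(2) 1 by fastforce
  then show "\<exists>\<psi>\<in>da_mult. da_norm (\<lambda>z. u z - \<psi> z * (a z * b z)) < e"
    using \<omega>(1) by blast
qed

lemma da_cyclic_power:
  assumes A: "expands A a" "mult_bounded 0 A C" and a: "da_cyclic a"
  shows "da_cyclic (\<lambda>z. a z ^ Suc n)"
proof (induction n)
  case (Suc n)
  from da_cyclic_mult[OF A a this] show ?case by simp
qed (simp add: a)

lemma da_cyclic_divisor:
  assumes \<phi>: "\<phi> \<in> da_mult" and g: "g \<in> drury_arveson" and c: "da_cyclic k"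
    and eq: "\<And>z. z \<in> unit_ball \<Longrightarrow> k z = \<phi> z * g z"
  shows "da_cyclic g"
  unfolding da_cyclic_iff
proof (intro conjI ballI allI impI g)
  fix u :: "complex ^ 'a \<Rightarrow> complex" and e :: real assume u: "u \<in> drury_arveson" and e: "e > 0"
  then obtain \<psi> where \<psi>: "\<psi> \<in> da_mult" "da_norm (\<lambda>z. u z - \<psi> z * k z) < e"
    using c unfolding da_cyclic_iff by blast
  have "(\<lambda>z. \<psi> z * k z) \<in> drury_arveson" using \<psi>(1) c by (simp add: da_mult_def da_cyclic_iff)
  then obtain y where y: "expands y (\<lambda>z. \<psi> z * k z)" by (rule drury_arvesonE)
  obtain x where x: "expands x u" using u by (rule drury_arvesonE)
  have "expands (x - y) (\<lambda>z. u z - (\<psi> z * \<phi> z) * g z)"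
    by (rule expands_cong[OF expands_diff[OF x y]]) (simp add: eq mult.assoc)
  then have "da_norm (\<lambda>z. u z - (\<psi> z * \<phi> z) * g z) < e"
    using \<psi>(2) da_norm_eq da_norm_eq[OF expands_diff[OF x y]] by metis
  then show "\<exists>\<phi>\<in>da_mult. da_norm (\<lambda>z. u z - \<phi> z * g z) < e"
    using da_mult_mult[OF \<psi>(1) \<phi>] by (intro bexI[of _ "\<lambda>z. \<psi> z * \<phi> z"])
qed

lemma denominator_function:
  assumes "in_space (x :: 'd::finite mpow)"
  obtains t \<theta> C where "mult_bounded 0 (1 - t) 1" "mcoeff (1 - t) 0 = 0" "mult_bounded 0 (t * x) C"
    "mult_bounded 0 t 2" "expands t \<theta>" "\<theta> \<in> da_mult"
proof -
  obtain t C where t: "mult_bounded 0 (1 - t) 1" "mcoeff (1 - t) 0 = 0" "mult_bounded 0 (t * x) C"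
  proof (cases "x = 0")
    case True
    have "mult_bounded 0 (0 :: 'd mpow) C" if "C \<ge> 0" for C
      using that by (simp add: mult_bounded_def trunc_norm_def[of _ _ 0] L2_set_def)
    then show thesis using True by (intro that[of 1 0]) auto
  next
    case False
    from exists_denominator[OF trunc_norm_le_full_norm[OF assms] this] that show thesis by blast
  qed
  have "mult_bounded 0 (1 + mconst (-1) * (1 - t)) (1 + cmod (-1) * 1)"
    by (intro mult_bounded_add mult_bounded_1 mult_bounded_mult mult_bounded_mconst t)
  moreover have "1 + mconst (-1) * (1 - t) = t"
    by (rule mpow_eqI) simp
  ultimately have t2: "mult_bounded 0 t 2" by simp
  obtain \<theta> where \<theta>: "expands t \<theta>" using in_space_expands[OF mult_bounded_in_space[OF t2]] .
  show thesis by (rule that[OF t t2 \<theta> da_multI[OF \<theta> t2]])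
qed

theorem mainTheorem8:
  fixes f g :: "complex ^ 'd::finite \<Rightarrow> complex"
  assumes "f \<in> drury_arveson" and "g \<in> drury_arveson"
    and "quotient_in_H_infty f g"
    and "da_cyclic f"
  shows "da_cyclic g"
proof -
  obtain h where h: "analytic_in_ball h" "bounded (h ` unit_ball)"
    and fhg: "\<And>z. z \<in> unit_ball \<Longrightarrow> f z = h z * g z"
    using assms(3) by (auto simp: quotient_in_H_infty_def H_infty_def)
  obtain x where x: "expands x f" "in_space x" using assms(1) by (rule drury_arvesonE)
  obtain y where y: "expands y g" "in_space y" using assms(2) by (rule drury_arvesonE)
  obtain w where w: "expands w h" using h(1) by (rule analytic_in_ball_expands)
  have xwy: "x = w * y" by (rule expands_unique[OF x(1) expands_mult[OF w y(1)] fhg])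
  obtain B where B: "0 < B" "\<And>z. z \<in> unit_ball \<Longrightarrow> cmod (h z) \<le> B"
    using h(2) unfolding bounded_pos by auto
  have hB: "mult_bounded (CARD('d)) w B"
    by (rule H_infty_mult_bounded[OF w B(2)]) (use B(1) in auto)
  obtain s \<sigma> Cf where s: "mult_bounded 0 (1 - s) 1" "mcoeff (1 - s) 0 = 0" "mult_bounded 0 (s * x) Cf"
    "mult_bounded 0 s 2" "expands s \<sigma>" "\<sigma> \<in> da_mult"
    using denominator_function[OF x(2)] .
  obtain t \<tau> Cg where t: "mult_bounded 0 (1 - t) 1" "mcoeff (1 - t) 0 = 0" "mult_bounded 0 (t * y) Cg"
    "mult_bounded 0 t 2" "expands t \<tau>" "\<tau> \<in> da_mult"
    using denominator_function[OF y(2)] .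
  \<comment> \<open>Multiplying by both denominators makes \<open>f\<close> and \<open>g\<close> multipliers and keeps their quotient \<open>h\<close>.\<close>
  define F G where "F = t * (s * x)" and "G = s * (t * y)"
  have F: "mult_bounded 0 F (2 * Cf)" unfolding F_def by (rule mult_bounded_mult[OF t(4) s(3)])
  have G: "mult_bounded 0 G (2 * Cg)" unfolding G_def by (rule mult_bounded_mult[OF s(4) t(3)])
  have "F = w * G" unfolding F_def G_def xwy by (simp only: mult_ac)
  then obtain C where C: "mult_bounded 0 (w * F ^ CARD('d)) C"
    using quotient_multiplier[OF _ F G hB] by blast
  define f' where "f' z = \<tau> z * (\<sigma> z * f z)" for z
  have f': "expands F f'" unfolding F_def f'_def[abs_def] by (intro expands_mult t s x)
  have "da_cyclic f'"
    unfolding f'_def[abs_def]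
    by (intro da_cyclic_denominator[OF t(1,2,5,6)] da_cyclic_denominator[OF s(1,2,5,6)] assms(4))
  then have cyc: "da_cyclic (\<lambda>z. f' z ^ Suc CARD('d))" by (rule da_cyclic_power[OF f' F])
  \<comment> \<open>The multiplier with \<open>f'\<^sup>d\<^sup>+\<^sup>1 = \<mu> \<tau> \<sigma> g\<close>.\<close>
  define \<mu> where "\<mu> z = h z * f' z ^ CARD('d)" for z
  have "\<mu> \<in> da_mult"
    by (rule da_multI[OF _ C]) (unfold \<mu>_def[abs_def], intro expands_mult expands_power w f')
  then have m: "(\<lambda>z. \<mu> z * (\<tau> z * \<sigma> z)) \<in> da_mult"
    by (intro da_mult_mult t s)
  show ?thesis
    by (rule da_cyclic_divisor[OF m assms(2) cyc]) (simp add: \<mu>_def f'_def fhg mult_ac)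
qed

end
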